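(* Let $(\mathbf X,\boldsymbol\gamma)=(I\times M^3,-N^2dt^2+g)$ be an almost globally hyperbolic spacetime, and let $I'\times U\subset I\times M^3$ be a $k$-perfect fluid electric $\alpha$-expanding region whose parameters $k=k(t,x)\in[0,\frac43]$ and $\alpha=\alpha(t,x)\in[0,\frac13]$ satisfy $$0\le k'\le \frac{k(9k^2-12k+8)}{3(4-3k)}\min\Big\{\frac{9\alpha'}{4(1-3\alpha)},\,1\Big\},\qquad \alpha'\ge 0 .$$ Then on $I'\times U$ the Weyl entropy $\mathcal S^{\mathbf{pf}}=\mathcal S+\mathbf{s_{crit}}\sqrt g$ is monotonically increasing in time, i.e. $\mathbf D_T\mathcal S^{\mathbf{pf}}\ge 0$.
   Context: A spacetime $(\mathbf X,\boldsymbol\gamma)$ is a smooth connected $4$-dimensional Lorentzian manifold of signature $(-,+,+,+)$ satisfying the Einstein equation $\mathbf R_{\alpha\beta}-\frac12\mathbf R\,\boldsymbol\gamma_{\alpha\beta}=\boldsymbol{\mathcal T}_{\alpha\beta}$, where $\mathbf R_{\alpha\beta}$, $\mathbf R$ are the Ricci and scalar curvature of $\boldsymbol\gamma$ and $\boldsymbol{\mathcal T}$ is a symmetric $2$-tensor (stress-energy tensor). $\mathbf R_{\alpha\beta\gamma\delta}$ and $\mathbf W_{\alpha\beta\gamma\delta}$ denote the Riemann and Weyl tensors of $\boldsymbol\gamma$. Globally hyperbolic spacetimes (those with a Cauchy hypersurface, taken to be the maximal smooth Cauchy development of initial data on it) are written $(I\times M^3,-N^2dt^2+g)$, with $I=[0,\bar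 T)$, $M^3$ a smooth $3$-manifold, $t$ a time function, $N=N(t,x)$ the lapse function and $g=g_{ij}(t,x)dx^idx^j$ a Riemannian metric on each slice $\{t\}\times M^3$. "Almost globally hyperbolic" means that the gradient of $t$ is also allowed to be light-like on some subsets (so $N$ may vanish there). The unit normal is $T=N^{-1}\partial_t$, and on functions $\mathbf D_T=N^{-1}\partial_t$. Indices $i,j,\dots$ refer to coordinates on $M^3$, and a subscript $T$ means evaluation on $T$. The second fundamental form is $h_{ij}=-\frac1{2N}\partial_tg_{ij}$ and $H=g^{ij}h_{ij}$. For a function $u(t,x)$, $u'$ is defined by $\mathbf D_Tu=u'H$ where $H\ne0$, and $u':=0$ where $H=0$. The Riemannian metric associated to $\boldsymbol\gamma$ is $\bar{\boldsymbol\gamma}=N^2dt^2+g$; $|\cdot|_{\bar{\boldsymbol\gamma}}$ is the tensor norm with respect to it. $\sqrt g$ is the square root of the determinant of $(g_{ij})$. The Weyl entropy is $\mathcal S=\mathbf s\sqrt g$, where $\mathbf s=|\mathbf W_{\alpha\beta\gamma\delta}|_{\bar{\boldsymbol\gamma}}/|\mathbf R_{\alpha\beta\gamma\delta}|_{\bar{\boldsymbol\gamma}}$ where the Riemann tensor is nonzero and $\mathbf s=1$ where the Riemann tensor vanishes. Let $U\subset M^3$, $I'\subset I$ be nonempty open sets. $I'\times U$ is a $k$-perfect fluid electric region if on $I'\times U$: (1) $\boldsymbol{\mathcal T}_{TT}=M$, $\boldsymbol{\mathcal T}_{Ti}=0$, $\boldsymbol{\mathcal T}_{ij}=Pg_{ij}$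 for functions $M$ (mass density) and $P$ (pressure) with $P=(k-1)M$, $k=k(t,x)\in[0,\frac43]$; (2) $\mathbf W_{Tijk}\equiv0$; (3) $N>0$. It is $\alpha$-expanding if there is a function $\alpha=\alpha(t,x)\in[0,\frac13]$ with $h_{ij}\le\alpha Hg_{ij}\le0$ (as quadratic forms) on $I'\times U$. The critical density is $$\mathbf{s_{crit}}:=\sqrt{1-3\alpha}\left(\frac{\sqrt2}{4}+2k\sqrt{\frac{1-3\alpha}{9k^2-12k+8}}\right).$$ In the inequalities on $k',\alpha'$, a quotient with zero denominator ($k=\frac43$ or $\alpha=\frac13$) is read as $+\infty$ (imposing no restriction; in particular constant $k,\alpha$ satisfy the inequalities).
   Formalization: Added: k, α are differentiable in t and D_T k = D_T α = 0 where H = 0 (else Minkowski space with k = 0 and α increasing in t is a counterexample). D_T S^pf ≥ 0 is read as: S^pf is nondecreasing on time intervals in I', and D_T S^pf ≥ 0 wherever it is differentiable. *)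

theory Defs
  imports "HOL-Analysis.Analysis"
begin

section \<open>Smooth functions\<close>

text \<open>The derivative is taken within \<open>A\<close>, hence one-sided in time at the
  initial slice \<open>t = 0\<close> when \<open>A = [0, T) \<times> V\<close> with \<open>V\<close> open.\<close>

definition partial_on ::
  "'a::euclidean_space set \<Rightarrow> 'a \<Rightarrow> ('a \<Rightarrow> 'b::real_normed_vector) \<Rightarrow> 'a \<Rightarrow> 'b" where
  "partial_on A b f p =
     vector_derivative (\<lambda>s. f (p + s *\<^sub>R b)) (at 0 within {s. p + s *\<^sub>R b \<in> A})"

definition partial_exists_on ::
  "'a::euclidean_space set \<Rightarrow> 'a \<Rightarrow> ('a \<Rightarrow> 'b::real_normed_vector) \<Rightarrow> bool" where
  "partial_exists_on A b f \<longleftrightarrow>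
     (\<forall>p\<in>A. (\<lambda>s. f (p + s *\<^sub>R b)) differentiable (at 0 within {s. p + s *\<^sub>R b \<in> A}))"

primrec Ck_on ::
  "nat \<Rightarrow> 'a::euclidean_space set \<Rightarrow> ('a \<Rightarrow> 'b::real_normed_vector) \<Rightarrow> bool" where
  "Ck_on 0 A f \<longleftrightarrow> continuous_on A f"
| "Ck_on (Suc k) A f \<longleftrightarrow> continuous_on A f \<and>
     (\<forall>b\<in>Basis. partial_exists_on A b f \<and> Ck_on k A (partial_on A b f))"

text \<open>Only used for open sets and for \<open>A = [0, T) \<times> V\<close> with \<open>V\<close> open
  (smoothness up to the boundary).\<close>

definition smooth_on :: "'a::euclidean_space set \<Rightarrow> ('a \<Rightarrow> 'b::real_normed_vector) \<Rightarrow> bool" where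
  "smooth_on A f \<longleftrightarrow> (\<forall>k. Ck_on k A f)"


section \<open>Smooth 3-manifolds\<close>

text \<open>The manifold is the whole type; a chart is a pair (domain, coordinate map).\<close>

type_synonym 'm chart = "'m set \<times> ('m \<Rightarrow> real^3)"

abbreviation chart_dom :: "'m chart \<Rightarrow> 'm set" where "chart_dom c \<equiv> fst c"
abbreviation chart_map :: "'m chart \<Rightarrow> 'm \<Rightarrow> real^3" where "chart_map c \<equiv> snd c"
abbreviation chart_img :: "'m chart \<Rightarrow> (real^3) set" where
  "chart_img c \<equiv> chart_map c ` chart_dom c"

definition chart_inv :: "'m chart \<Rightarrow> real^3 \<Rightarrow> 'm" where
  "chart_inv c = inv_into (chart_dom c) (chart_map c)"

definition smooth_atlas :: "'m::topological_space chart set \<Rightarrow> bool" where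
  "smooth_atlas \<A> \<longleftrightarrow>
     (\<Union>c\<in>\<A>. chart_dom c) = UNIV \<and>
     (\<forall>c\<in>\<A>. open (chart_dom c) \<and> open (chart_img c) \<and>
        homeomorphism (chart_dom c) (chart_img c) (chart_map c) (chart_inv c)) \<and>
     (\<forall>c\<in>\<A>. \<forall>c'\<in>\<A>.
        smooth_on (chart_map c ` (chart_dom c \<inter> chart_dom c')) (chart_map c' \<circ> chart_inv c))"


section \<open>Spacetimes in the form \<open>(I \<times> M, -N\<^sup>2 dt\<^sup>2 + g)\<close>\<close>

text \<open>Spacetime indices: \<open>None\<close> is the time coordinate \<open>t\<close>, \<open>Some i\<close> the spatial
  coordinate \<open>x\<^sup>i\<close>. Tensor fields are given by their components in each chart
  of \<open>M\<close>, as functions of the chart, the time and the point of \<open>M\<close>.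
  The time interval is \<open>[0, st_end)\<close>, where \<open>st_end\<close> may be \<open>\<infinity>\<close>.\<close>

type_synonym idx = "3 option"

record 'm spacetime =
  st_atlas :: "'m chart set"
  st_end :: ereal
  lapse :: "real \<Rightarrow> 'm \<Rightarrow> real"
  slice_metric :: "'m chart \<Rightarrow> real \<Rightarrow> 'm \<Rightarrow> real^3^3"
  stress :: "'m chart \<Rightarrow> real \<Rightarrow> 'm \<Rightarrow> real^idx^idx"

definition time_interval :: "'m spacetime \<Rightarrow> real set" where
  "time_interval X = {t. 0 \<le> t \<and> ereal t < st_end X}"

definition region :: "'m spacetime \<Rightarrow> 'm chart \<Rightarrow> (real \<times> (real^3)) set" where
  "region X c = time_interval X \<times> chart_img c"

definition coord_dir :: "idx \<Rightarrow> real \<times> (real^3)" where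
  "coord_dir a = (case a of None \<Rightarrow> (1, 0) | Some i \<Rightarrow> (0, axis i 1))"

definition pd :: "'m spacetime \<Rightarrow> 'm chart \<Rightarrow> idx \<Rightarrow> (real \<times> (real^3) \<Rightarrow> real) \<Rightarrow> real \<times> (real^3) \<Rightarrow> real" where
  "pd X c a f = partial_on (region X c) (coord_dir a) f"

text \<open>The matrix of \<open>\<epsilon> N\<^sup>2 dt\<^sup>2 + g\<close> at a coordinate point:
  \<open>\<epsilon> = -1\<close> gives the spacetime metric, \<open>\<epsilon> = 1\<close> the associated Riemannian metric.\<close>

definition block_metric :: "real \<Rightarrow> 'm spacetime \<Rightarrow> 'm chart \<Rightarrow> real \<times> (real^3) \<Rightarrow> real^idx^idx" where
  "block_metric \<epsilon> X c p = (let t = fst p; x = chart_inv c (snd p) in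
     \<chi> a b. case (a, b) of
        (None, None) \<Rightarrow> \<epsilon> * (lapse X t x)\<^sup>2
      | (Some i, Some j) \<Rightarrow> slice_metric X c t x $ i $ j
      | _ \<Rightarrow> 0)"

abbreviation st_metric :: "'m spacetime \<Rightarrow> 'm chart \<Rightarrow> real \<times> (real^3) \<Rightarrow> real^idx^idx" where
  "st_metric \<equiv> block_metric (-1)"

abbreviation riem_metric :: "'m spacetime \<Rightarrow> 'm chart \<Rightarrow> real \<times> (real^3) \<Rightarrow> real^idx^idx" where
  "riem_metric \<equiv> block_metric 1"


subsection \<open>Curvature in coordinates\<close>

definition christoffel :: "'m spacetime \<Rightarrow> 'm chart \<Rightarrow> idx \<Rightarrow> idx \<Rightarrow> idx \<Rightarrow> real \<times> (real^3) \<Rightarrow> real" where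
  "christoffel X c a b e p = (1/2) * (\<Sum>d\<in>UNIV. matrix_inv (st_metric X c p) $ a $ d *
      (pd X c b (\<lambda>q. st_metric X c q $ d $ e) p
       + pd X c e (\<lambda>q. st_metric X c q $ b $ d) p
       - pd X c d (\<lambda>q. st_metric X c q $ b $ e) p))"

text \<open>\<open>R\<^sup>a\<^bsub>bcd\<^esub> = \<partial>\<^sub>c \<Gamma>\<^sup>a\<^bsub>db\<^esub> - \<partial>\<^sub>d \<Gamma>\<^sup>a\<^bsub>cb\<^esub> + \<Gamma>\<^sup>a\<^bsub>ce\<^esub> \<Gamma>\<^sup>e\<^bsub>db\<^esub> - \<Gamma>\<^sup>a\<^bsub>de\<^esub> \<Gamma>\<^sup>e\<^bsub>cb\<^esub>\<close>
  and \<open>R\<^bsub>bd\<^esub> = R\<^sup>a\<^bsub>bad\<^esub>\<close>, so that round spheres have positive Ricci curvature.\<close>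

definition riemann_up :: "'m spacetime \<Rightarrow> 'm chart \<Rightarrow> real \<times> (real^3) \<Rightarrow> idx \<Rightarrow> idx \<Rightarrow> idx \<Rightarrow> idx \<Rightarrow> real" where
  "riemann_up X ch p a b c d =
     pd X ch c (christoffel X ch a d b) p - pd X ch d (christoffel X ch a c b) p
     + (\<Sum>e\<in>UNIV. christoffel X ch a c e p * christoffel X ch e d b p
                - christoffel X ch a d e p * christoffel X ch e c b p)"

definition riemann :: "'m spacetime \<Rightarrow> 'm chart \<Rightarrow> real \<times> (real^3) \<Rightarrow> idx \<Rightarrow> idx \<Rightarrow> idx \<Rightarrow> idx \<Rightarrow> real" where
  "riemann X ch p a b c d = (\<Sum>e\<in>UNIV. st_metric X ch p $ a $ e * riemann_up X ch p e b c d)"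

definition ricci :: "'m spacetime \<Rightarrow> 'm chart \<Rightarrow> real \<times> (real^3) \<Rightarrow> idx \<Rightarrow> idx \<Rightarrow> real" where
  "ricci X ch p b d = (\<Sum>a\<in>UNIV. riemann_up X ch p a b a d)"

definition scalar_curv :: "'m spacetime \<Rightarrow> 'm chart \<Rightarrow> real \<times> (real^3) \<Rightarrow> real" where
  "scalar_curv X ch p =
     (\<Sum>a\<in>UNIV. \<Sum>b\<in>UNIV. matrix_inv (st_metric X ch p) $ a $ b * ricci X ch p a b)"

definition weyl :: "'m spacetime \<Rightarrow> 'm chart \<Rightarrow> real \<times> (real^3) \<Rightarrow> idx \<Rightarrow> idx \<Rightarrow> idx \<Rightarrow> idx \<Rightarrow> real" where
  "weyl X ch p a b c d = (let G = st_metric X ch p; Rc = ricci X ch p in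
     riemann X ch p a b c d
     - (1/2) * (G $ a $ c * Rc b d - G $ a $ d * Rc b c - G $ b $ c * Rc a d + G $ b $ d * Rc a c)
     + (scalar_curv X ch p / 6) * (G $ a $ c * G $ b $ d - G $ a $ d * G $ b $ c))"

definition norm4 :: "real^idx^idx \<Rightarrow> (idx \<Rightarrow> idx \<Rightarrow> idx \<Rightarrow> idx \<Rightarrow> real) \<Rightarrow> real" where
  "norm4 G A = (let Gi = matrix_inv G in
     sqrt (\<Sum>a\<in>UNIV. \<Sum>b\<in>UNIV. \<Sum>c\<in>UNIV. \<Sum>d\<in>UNIV. \<Sum>a'\<in>UNIV. \<Sum>b'\<in>UNIV. \<Sum>c'\<in>UNIV. \<Sum>d'\<in>UNIV.
       Gi $ a $ a' * Gi $ b $ b' * Gi $ c $ c' * Gi $ d $ d' * A a b c d * A a' b' c' d'))"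


subsection \<open>Almost globally hyperbolic spacetimes\<close>

text \<open>The lapse may vanish, so \<open>N \<ge> 0\<close>. Where \<open>N = 0\<close> the metric is degenerate in these
  coordinates and has no curvature there, so the Einstein equation is imposed where \<open>N > 0\<close>.
  The stress tensor need not be assumed to transform as a tensor: where \<open>N > 0\<close> this
  follows from the Einstein equation. No maximality of the development is imposed.\<close>

definition almost_globally_hyperbolic ::
  "'m::{t2_space, second_countable_topology} spacetime \<Rightarrow> bool" where
  "almost_globally_hyperbolic X \<longleftrightarrow>
     0 < st_end X \<and>
     connected (UNIV :: 'm set) \<and>
     smooth_atlas (st_atlas X) \<and>
     (\<forall>t\<in>time_interval X. \<forall>x. 0 \<le> lapse X t x) \<and>
     (\<forall>c\<in>st_atlas X.
        (\<forall>a b. smooth_on (region X c) (\<lambda>p. st_metric X c p $ a $ b)) \<and>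
        (\<forall>t\<in>time_interval X. \<forall>x\<in>chart_dom c.
           transpose (slice_metric X c t x) = slice_metric X c t x \<and>
           (\<forall>v. v \<noteq> 0 \<longrightarrow> 0 < v \<bullet> (slice_metric X c t x *v v)) \<and>
           transpose (stress X c t x) = stress X c t x)) \<and>
     (\<forall>c\<in>st_atlas X. \<forall>c'\<in>st_atlas X. \<forall>t\<in>time_interval X. \<forall>x\<in>chart_dom c \<inter> chart_dom c'.
        (let J = jacobian (chart_map c' \<circ> chart_inv c) (at (chart_map c x)) in
         slice_metric X c t x = transpose J ** slice_metric X c' t x ** J)) \<and>
     (\<forall>c\<in>st_atlas X. \<forall>t\<in>time_interval X. \<forall>x\<in>chart_dom c. 0 < lapse X t x \<longrightarrow>
        (let p = (t, chart_map c x) in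
         \<forall>a b. ricci X c p a b - (1/2) * scalar_curv X c p * st_metric X c p $ a $ b
               = stress X c t x $ a $ b))"


subsection \<open>Extrinsic geometry of the slices\<close>

definition D_T :: "'m spacetime \<Rightarrow> (real \<Rightarrow> 'm \<Rightarrow> real) \<Rightarrow> real \<Rightarrow> 'm \<Rightarrow> real" where
  "D_T X u t x = vector_derivative (\<lambda>s. u s x) (at t within time_interval X) / lapse X t x"

definition second_ff :: "'m spacetime \<Rightarrow> 'm chart \<Rightarrow> real \<Rightarrow> 'm \<Rightarrow> real^3^3" where
  "second_ff X c t x =
     (\<chi> i j. - (1/2) * D_T X (\<lambda>s y. slice_metric X c s y $ i $ j) t x)"

definition mean_curv :: "'m spacetime \<Rightarrow> 'm chart \<Rightarrow> real \<Rightarrow> 'm \<Rightarrow> real" where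
  "mean_curv X c t x =
     (\<Sum>i\<in>UNIV. \<Sum>j\<in>UNIV. matrix_inv (slice_metric X c t x) $ i $ j * second_ff X c t x $ i $ j)"

text \<open>The function \<open>u'\<close> with \<open>D\<^sub>T u = u' H\<close>. The value of the mean curvature does not
  depend on the chart \<open>c\<close> around \<open>x\<close>. The equation \<open>D\<^sub>T u = u' H\<close> holds automatically
  where \<open>H \<noteq> 0\<close>; where \<open>H = 0\<close> it says \<open>D\<^sub>T u = 0\<close>, which has to be assumed separately.\<close>

definition H_deriv :: "'m spacetime \<Rightarrow> 'm chart \<Rightarrow> (real \<Rightarrow> 'm \<Rightarrow> real) \<Rightarrow> real \<Rightarrow> 'm \<Rightarrow> real" where
  "H_deriv X c u t x =
     (if mean_curv X c t x = 0 then 0 else D_T X u t x / mean_curv X c t x)"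


section \<open>Perfect fluid electric regions and Weyl entropy\<close>

definition is_region :: "'m::topological_space spacetime \<Rightarrow> real set \<Rightarrow> 'm set \<Rightarrow> bool" where
  "is_region X I' U \<longleftrightarrow>
     I' \<noteq> {} \<and> U \<noteq> {} \<and> openin (top_of_set (time_interval X)) I' \<and> open U"

text \<open>Since \<open>T = N\<^sup>-\<^sup>1 \<partial>\<^sub>t\<close>, evaluating one slot on \<open>T\<close> divides the \<open>None\<close>-component by \<open>N\<close>.\<close>

definition perfect_fluid_electric ::
  "'m::topological_space spacetime \<Rightarrow> (real \<Rightarrow> 'm \<Rightarrow> real) \<Rightarrow> real set \<Rightarrow> 'm set \<Rightarrow> bool" where
  "perfect_fluid_electric X k I' U \<longleftrightarrow> is_region X I' U \<and>
     (\<exists>M P :: real \<Rightarrow> 'm \<Rightarrow> real. \<forall>t\<in>I'. \<forall>x\<in>U.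
        0 < lapse X t x \<and>
        k t x \<in> {0..4/3} \<and>
        P t x = (k t x - 1) * M t x \<and>
        (\<forall>c\<in>st_atlas X. x \<in> chart_dom c \<longrightarrow>
           stress X c t x $ None $ None / (lapse X t x)\<^sup>2 = M t x \<and>
           (\<forall>i. stress X c t x $ None $ Some i / lapse X t x = 0) \<and>
           (\<forall>i j. stress X c t x $ Some i $ Some j = P t x * slice_metric X c t x $ i $ j) \<and>
           (\<forall>i j l. weyl X c (t, chart_map c x) None (Some i) (Some j) (Some l) / lapse X t x = 0)))"

definition expanding ::
  "'m spacetime \<Rightarrow> (real \<Rightarrow> 'm \<Rightarrow> real) \<Rightarrow> real set \<Rightarrow> 'm set \<Rightarrow> bool" where
  "expanding X \<alpha> I' U \<longleftrightarrow>
     (\<forall>t\<in>I'. \<forall>x\<in>U. \<alpha> t x \<in> {0..1/3} \<and>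
        (\<forall>c\<in>st_atlas X. x \<in> chart_dom c \<longrightarrow>
           (\<forall>v. v \<bullet> (second_ff X c t x *v v)
                  \<le> \<alpha> t x * mean_curv X c t x * (v \<bullet> (slice_metric X c t x *v v)) \<and>
                \<alpha> t x * mean_curv X c t x * (v \<bullet> (slice_metric X c t x *v v)) \<le> 0)))"

definition weyl_ratio :: "'m spacetime \<Rightarrow> 'm chart \<Rightarrow> real \<Rightarrow> 'm \<Rightarrow> real" where
  "weyl_ratio X c t x = (let p = (t, chart_map c x) in
     if \<forall>a b d e. riemann X c p a b d e = 0 then 1
     else norm4 (riem_metric X c p) (weyl X c p) / norm4 (riem_metric X c p) (riemann X c p))"

definition sqrt_det :: "'m spacetime \<Rightarrow> 'm chart \<Rightarrow> real \<Rightarrow> 'm \<Rightarrow> real" where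
  "sqrt_det X c t x = sqrt (det (slice_metric X c t x))"

definition weyl_entropy :: "'m spacetime \<Rightarrow> 'm chart \<Rightarrow> real \<Rightarrow> 'm \<Rightarrow> real" where
  "weyl_entropy X c t x = weyl_ratio X c t x * sqrt_det X c t x"

definition s_crit :: "real \<Rightarrow> real \<Rightarrow> real" where
  "s_crit k \<alpha> =
     sqrt (1 - 3*\<alpha>) * (sqrt 2 / 4 + 2 * k * sqrt ((1 - 3*\<alpha>) / (9*k\<^sup>2 - 12*k + 8)))"

definition pf_entropy ::
  "'m spacetime \<Rightarrow> (real \<Rightarrow> 'm \<Rightarrow> real) \<Rightarrow> (real \<Rightarrow> 'm \<Rightarrow> real) \<Rightarrow> 'm chart \<Rightarrow> real \<Rightarrow> 'm \<Rightarrow> real" where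
  "pf_entropy X k \<alpha> c t x =
     weyl_entropy X c t x + s_crit (k t x) (\<alpha> t x) * sqrt_det X c t x"

text \<open>The conditions on the values \<open>k, \<alpha>, k', \<alpha>'\<close> at a point. A quotient with zero
  denominator counts as \<open>+\<infinity>\<close> (also for a zero numerator): for \<open>k = 4/3\<close> there is no upper
  bound on \<open>k'\<close>, and for \<open>\<alpha> = 1/3\<close> the minimum is \<open>1\<close>.\<close>

definition parameter_bounds :: "real \<Rightarrow> real \<Rightarrow> real \<Rightarrow> real \<Rightarrow> bool" where
  "parameter_bounds k \<alpha> k' \<alpha>' \<longleftrightarrow> 0 \<le> \<alpha>' \<and> 0 \<le> k' \<and>
     (k \<noteq> 4/3 \<longrightarrow>
        k' \<le> k * (9*k\<^sup>2 - 12*k + 8) / (3 * (4 - 3*k)) *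
              (if \<alpha> = 1/3 then 1 else min (9 * \<alpha>' / (4 * (1 - 3*\<alpha>))) 1))"

end

theory Submission
  imports Defs
begin

text \<open>
  Everything is expressed by mixed spatial tensors in coordinate time (a prime is \<open>\<partial>\<^sub>t\<close>):
  \<open>\<theta> = 1/2 g\<^sup>-\<^sup>1 \<partial>\<^sub>t g\<close> with trace \<open>\<Theta> = - N H\<close>, and the electric part \<open>E\<close> of the Weyl tensor.
  The fluid and electric conditions kill all curvature components with an odd number of time
  indices, so the second Bianchi identity turns into an ordinary differential equation along each
  time line. It gives \<open>M' = - k \<Theta> M\<close> and
  \<open>(tr E\<^sup>2)' = - 4 \<Theta> tr E\<^sup>2 + 6 tr (\<theta> E\<^sup>2) - k M tr (\<theta> E)\<close>, while the squared Weyl and Riemann norms are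
  \<open>8 tr E\<^sup>2\<close> and \<open>8 tr E\<^sup>2 + (9k\<^sup>2 - 12k + 8) M\<^sup>2 / 3\<close>. Since \<open>\<theta> - \<alpha> \<Theta>\<close> is positive semidefinite with
  trace \<open>(1 - 3\<alpha>) \<Theta>\<close> and \<open>E\<close> is symmetric and trace-free, the two cubic terms are bounded in terms of
  \<open>tr E\<^sup>2\<close>, and \<open>s_crit\<close> is large enough to absorb what is negative in the derivative of the entropy.
  The entropy need not be differentiable where \<open>E = 0\<close> or \<open>\<alpha> = 1/3\<close>; adding \<open>\<epsilon>\<close> to \<open>tr E\<^sup>2\<close> and to \<open>1 - 3\<alpha>\<close>
  preserves the differential inequalities, and the limit \<open>\<epsilon> \<rightarrow> 0\<close> even produces the
  convention \<open>s = 1\<close> for vanishing curvature.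
\<close>

section \<open>Partial derivatives up to the initial slice\<close>

text \<open>Put \<open>D = 9k^2 - 12k + 8\<close>, \<open>\<beta> = 1 - 3\<alpha>\<close>,
  \<open>Y = tr E^2\<close> and \<open>q = D M^2 / 24\<close>; the Weyl ratio is
  \<open>u = sqrt (Y / (Y + q))\<close>. The bounds on the cubic terms amount to \<open>Y' \<ge> - 2
  \<Theta> (1 + \<beta>) Y - 2 \<Theta> c sqrt (q Y)\<close> with
  \<open>c = 2 k \<beta> / sqrt D\<close>, and the upper bound on the fluid parameter's derivative
  makes \<open>q\<close> non-increasing. The quotient rule then yields
  \<open>u' + \<Theta> u \<ge> - \<Theta> (\<beta> (u - 2 u^3) + c)\<close>, where
  \<open>\<Theta> u\<close> is the share of the volume element. Since
  \<open>u - 2 u^3 \<le> sqrt 2 / 4\<close> and \<open>\<beta> \<le> sqrt \<beta>\<close>, the right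
  side is at least \<open>- \<Theta>\<close> times the critical density: this is the origin of its
  two summands. The other entry of the minimum in the parameter bounds keeps the critical density
  itself from decreasing. The differential equation closes because in three dimensions the spatial
  block of the Riemann tensor is determined by its contraction, which is \<open>E\<close> plus a
  multiple of \<open>M\<close>. The same relation supplies the smoothness of \<open>M\<close> and
  \<open>Y\<close>, although \<open>M\<close> and \<open>P\<close> enter as arbitrary
  functions.\<close>

text \<open>Approachability along the coordinate lines makes the one-sided derivatives unique; density
  of the interior transports the symmetry of second derivatives to the boundary by continuity.\<close>

definition thick :: "'a::euclidean_space set \<Rightarrow> bool" where
  "thick A \<longleftrightarrow> A \<subseteq> closure (interior A) \<and>
     (\<forall>p\<in>A. \<forall>b\<in>Basis. at 0 within {s. p + s *\<^sub>R b \<in> A} \<noteq> bot)"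

lemma partial_onI:
  assumes "thick A" "p \<in> A" "b \<in> Basis"
    and "((\<lambda>s. f (p + s *\<^sub>R b)) has_vector_derivative d) (at 0 within {s. p + s *\<^sub>R b \<in> A})"
  shows "partial_on A b f p = d"
  unfolding partial_on_def using assms
  by (intro vector_derivative_within) (auto simp: thick_def)

lemma partial_on_has_vector_derivative:
  assumes "partial_exists_on A b f" "p \<in> A"
  shows "((\<lambda>s. f (p + s *\<^sub>R b)) has_vector_derivative partial_on A b f p)
           (at 0 within {s. p + s *\<^sub>R b \<in> A})"
  using assms unfolding partial_on_def partial_exists_on_def
  by (simp add: vector_derivative_works)

lemma partial_on_cong:
  assumes "\<And>q. q \<in> A \<Longrightarrow> f q = g q" "p \<in> A"
  shows "partial_on A b f p = partial_on A b g p"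
proof -
  have "((\<lambda>s. f (p + s *\<^sub>R b)) has_vector_derivative d) (at 0 within {s. p + s *\<^sub>R b \<in> A}) \<longleftrightarrow>
        ((\<lambda>s. g (p + s *\<^sub>R b)) has_vector_derivative d) (at 0 within {s. p + s *\<^sub>R b \<in> A})" for d
    using assms by (intro has_vector_derivative_cong_ev) auto
  then show ?thesis by (simp add: partial_on_def vector_derivative_def)
qed

lemma partial_exists_on_cong:
  assumes "\<And>q. q \<in> A \<Longrightarrow> f q = g q"
  shows "partial_exists_on A b f \<longleftrightarrow> partial_exists_on A b g"
proof -
  have "((\<lambda>s. f (p + s *\<^sub>R b)) has_vector_derivative d) (at 0 within {s. p + s *\<^sub>R b \<in> A}) \<longleftrightarrow>
        ((\<lambda>s. g (p + s *\<^sub>R b)) has_vector_derivative d) (at 0 within {s. p + s *\<^sub>R b \<in> A})"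
    if "p \<in> A" for p d
    using assms that by (intro has_vector_derivative_cong_ev) auto
  then show ?thesis
    unfolding partial_exists_on_def by (metis differentiableI_vector vector_derivative_works)
qed

text \<open>A formula for \<open>partial_on A b f\<close> is available only at points of
  \<open>A\<close>; this congruence lets it be substituted under \<open>Ck_on\<close> in the
  inductions below.\<close>

lemma Ck_on_cong:
  assumes "\<And>q. q \<in> A \<Longrightarrow> f q = g q"
  shows "Ck_on k A f \<longleftrightarrow> Ck_on k A g"
  using assms
proof (induction k arbitrary: f g)
  case 0
  then show ?case by (auto intro: continuous_on_cong[THEN iffD1])
next
  case (Suc k)
  have "continuous_on A f \<longleftrightarrow> continuous_on A g"
    using Suc.prems by (intro continuous_on_cong) auto
  moreover have "partial_exists_on A b f \<longleftrightarrow> partial_exists_on A b g" for b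
    by (rule partial_exists_on_cong) (rule Suc.prems)
  moreover have "Ck_on k A (partial_on A b f) \<longleftrightarrow> Ck_on k A (partial_on A b g)" for b
    by (rule Suc.IH, rule partial_on_cong) (rule Suc.prems)
  ultimately show ?case by simp
qed

lemma Ck_on_SucD: "Ck_on (Suc k) A f \<Longrightarrow> Ck_on k A f"
  by (induction k arbitrary: f) auto

section \<open>Sums, products and inverses of smooth functions\<close>

lemma Ck_on_const: "thick A \<Longrightarrow> Ck_on k A (\<lambda>_. c)"
proof (induction k arbitrary: c)
  case (Suc k)
  have "partial_exists_on A b (\<lambda>_. c)" for b by (simp add: partial_exists_on_def)
  moreover have "Ck_on k A (partial_on A b (\<lambda>_. c))" if "b \<in> Basis" for b
    using Suc that by (subst Ck_on_cong[where g="\<lambda>_. 0"]) (auto intro: partial_onI)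
  ultimately show ?case by simp
qed simp

lemma has_vector_derivative_partial_add:
  assumes "partial_exists_on A b f" "partial_exists_on A b g" "p \<in> A"
  shows "((\<lambda>s. f (p + s *\<^sub>R b) + g (p + s *\<^sub>R b)) has_vector_derivative
           (partial_on A b f p + partial_on A b g p)) (at 0 within {s. p + s *\<^sub>R b \<in> A})"
  using assms by (intro has_vector_derivative_add partial_on_has_vector_derivative)

lemma has_vector_derivative_partial_mult:
  fixes f g :: "'a::euclidean_space \<Rightarrow> real"
  assumes "partial_exists_on A b f" "partial_exists_on A b g" "p \<in> A"
  shows "((\<lambda>s. f (p + s *\<^sub>R b) * g (p + s *\<^sub>R b)) has_vector_derivative
           (f p * partial_on A b g p + partial_on A b f p * g p)) (at 0 within {s. p + s *\<^sub>R b \<in> A})"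
  using has_vector_derivative_mult[OF partial_on_has_vector_derivative[OF assms(1,3)]
      partial_on_has_vector_derivative[OF assms(2,3)]] by simp

lemma partial_exists_onI:
  assumes "\<And>p. p \<in> A \<Longrightarrow>
    ((\<lambda>s. f (p + s *\<^sub>R b)) has_vector_derivative d p) (at 0 within {s. p + s *\<^sub>R b \<in> A})"
  shows "partial_exists_on A b f"
  using assms differentiableI_vector unfolding partial_exists_on_def by blast

lemma Ck_on_add:
  assumes "thick A"
  shows "Ck_on k A f \<Longrightarrow> Ck_on k A g \<Longrightarrow> Ck_on k A (\<lambda>p. f p + g p)"
proof (induction k arbitrary: f g)
  case 0
  then show ?case by (auto intro: continuous_on_add)
next
  case (Suc k)
  have *: "partial_exists_on A b (\<lambda>p. f p + g p)" if "b \<in> Basis" for b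
    using Suc.prems that by (intro partial_exists_onI[OF has_vector_derivative_partial_add]) auto
  have "Ck_on k A (partial_on A b (\<lambda>p. f p + g p))" if "b \<in> Basis" for b
  proof (subst Ck_on_cong)
    show "partial_on A b (\<lambda>p. f p + g p) q = partial_on A b f q + partial_on A b g q" if "q \<in> A" for q
      using Suc.prems that \<open>b \<in> Basis\<close> by (intro partial_onI[OF assms] has_vector_derivative_partial_add) auto
    show "Ck_on k A (\<lambda>q. partial_on A b f q + partial_on A b g q)"
      using Suc that by simp
  qed
  with * Suc.prems show ?case by (auto intro: continuous_on_add)
qed

lemma Ck_on_mult:
  fixes f g :: "'a::euclidean_space \<Rightarrow> real"
  assumes "thick A"
  shows "Ck_on k A f \<Longrightarrow> Ck_on k A g \<Longrightarrow> Ck_on k A (\<lambda>p. f p * g p)"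
proof (induction k arbitrary: f g)
  case 0
  then show ?case by (auto intro: continuous_on_mult)
next
  case (Suc k)
  have *: "partial_exists_on A b (\<lambda>p. f p * g p)" if "b \<in> Basis" for b
    using Suc.prems that by (intro partial_exists_onI[OF has_vector_derivative_partial_mult]) auto
  have "Ck_on k A (partial_on A b (\<lambda>p. f p * g p))" if "b \<in> Basis" for b
  proof (subst Ck_on_cong)
    show "partial_on A b (\<lambda>p. f p * g p) q = f q * partial_on A b g q + partial_on A b f q * g q"
      if "q \<in> A" for q
      using Suc.prems that \<open>b \<in> Basis\<close> by (intro partial_onI[OF assms] has_vector_derivative_partial_mult) auto
    show "Ck_on k A (\<lambda>q. f q * partial_on A b g q + partial_on A b f q * g q)"
      using Suc.prems that Ck_on_SucD[OF Suc.prems(1)] Ck_on_SucD[OF Suc.prems(2)]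
      by (intro Ck_on_add[OF assms] Suc.IH) auto
  qed
  with * Suc.prems show ?case by (auto intro: continuous_on_mult)
qed

text \<open>The derivative is written as a product containing \<open>inverse (f p)\<close> twice, so
  that the induction hypothesis and \<open>Ck_on_mult\<close> apply to it.\<close>

lemma Ck_on_inverse:
  fixes f :: "'a::euclidean_space \<Rightarrow> real"
  assumes "thick A" and nz: "\<And>p. p \<in> A \<Longrightarrow> f p \<noteq> 0"
  shows "Ck_on k A f \<Longrightarrow> Ck_on k A (\<lambda>p. inverse (f p))"
proof (induction k)
  case 0
  then show ?case using nz by (auto intro: continuous_on_inverse)
next
  case (Suc k)
  have *: "((\<lambda>s. inverse (f (p + s *\<^sub>R b))) has_vector_derivative
       ((-1) * partial_on A b f p) * (inverse (f p) * inverse (f p))) (at 0 within {s. p + s *\<^sub>R b \<in> A})"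
    if "p \<in> A" "b \<in> Basis" for p b
  proof -
    have "((\<lambda>s. f (p + s *\<^sub>R b)) has_real_derivative partial_on A b f p) (at 0 within {s. p + s *\<^sub>R b \<in> A})"
      using partial_on_has_vector_derivative[of A b f p] Suc.prems that
      by (simp add: has_real_derivative_iff_has_vector_derivative)
    from DERIV_inverse_fun[OF this] show ?thesis using nz[OF that(1)]
      by (simp add: has_real_derivative_iff_has_vector_derivative power2_eq_square field_simps)
  qed
  have "Ck_on k A (partial_on A b (\<lambda>p. inverse (f p)))" if "b \<in> Basis" for b
  proof (subst Ck_on_cong)
    show "partial_on A b (\<lambda>p. inverse (f p)) q = ((-1) * partial_on A b f q) * (inverse (f q) * inverse (f q))"
      if "q \<in> A" for q
      using that \<open>b \<in> Basis\<close> by (intro partial_onI[OF assms(1)] *)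
    show "Ck_on k A (\<lambda>q. ((-1) * partial_on A b f q) * (inverse (f q) * inverse (f q)))"
      using Suc.prems that Suc.IH[OF Ck_on_SucD[OF Suc.prems]]
      by (intro Ck_on_mult[OF assms(1)] Ck_on_const assms) auto
  qed
  moreover have "partial_exists_on A b (\<lambda>p. inverse (f p))" if "b \<in> Basis" for b
    by (rule partial_exists_onI) (rule *[OF _ that])
  ultimately show ?case using Suc.prems nz by (auto intro: continuous_on_inverse)
qed

lemma smooth_on_const: "thick A \<Longrightarrow> smooth_on A (\<lambda>_. c)"
  and smooth_on_add: "thick A \<Longrightarrow> smooth_on A f \<Longrightarrow> smooth_on A g \<Longrightarrow> smooth_on A (\<lambda>p. f p + g p)"
  by (auto simp: smooth_on_def Ck_on_const Ck_on_add)

lemma smooth_on_mult: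
  fixes f g :: "'a::euclidean_space \<Rightarrow> real"
  shows "thick A \<Longrightarrow> smooth_on A f \<Longrightarrow> smooth_on A g \<Longrightarrow> smooth_on A (\<lambda>p. f p * g p)"
  by (auto simp: smooth_on_def Ck_on_mult)

lemma smooth_on_inverse:
  fixes f :: "'a::euclidean_space \<Rightarrow> real"
  shows "thick A \<Longrightarrow> smooth_on A f \<Longrightarrow> (\<And>p. p \<in> A \<Longrightarrow> f p \<noteq> 0) \<Longrightarrow> smooth_on A (\<lambda>p. inverse (f p))"
  by (auto simp: smooth_on_def Ck_on_inverse)

lemma smooth_on_diff:
  fixes f g :: "'a::euclidean_space \<Rightarrow> real"
  assumes "thick A" "smooth_on A f" "smooth_on A g"
  shows "smooth_on A (\<lambda>p. f p - g p)"
proof -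
  have "smooth_on A (\<lambda>p. f p + (-1) * g p)"
    using assms by (intro smooth_on_add smooth_on_mult smooth_on_const)
  then show ?thesis by simp
qed

lemma smooth_on_sum:
  assumes "thick A" "finite J" "\<And>j. j \<in> J \<Longrightarrow> smooth_on A (f j)"
  shows "smooth_on A (\<lambda>p. \<Sum>j\<in>J. f j p)"
  using assms(2,3) by (induction J) (auto intro: smooth_on_const smooth_on_add assms(1))

lemma smooth_on_cong:
  "(\<And>q. q \<in> A \<Longrightarrow> f q = g q) \<Longrightarrow> smooth_on A f \<longleftrightarrow> smooth_on A g"
  unfolding smooth_on_def using Ck_on_cong by blast

lemma smooth_on_partial: "smooth_on A f \<Longrightarrow> b \<in> Basis \<Longrightarrow> smooth_on A (partial_on A b f)"
  unfolding smooth_on_def by (metis Ck_on.simps(2))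

lemma smooth_on_partial_exists: "smooth_on A f \<Longrightarrow> b \<in> Basis \<Longrightarrow> partial_exists_on A b f"
  unfolding smooth_on_def by (metis Ck_on.simps(2))

lemma smooth_on_continuous: "smooth_on A f \<Longrightarrow> continuous_on A f"
  unfolding smooth_on_def by (metis Ck_on.simps(1))

text \<open>Near \<open>p\<close> the sets \<open>A\<close> and \<open>B\<close> coincide, so the
  two filters agree. This moves derivatives from the whole coordinate region, where the definitions
  take them, to the part where the fluid equations hold.\<close>

lemma partial_on_openin:
  fixes A B :: "'a::euclidean_space set"
  assumes "openin (top_of_set A) B" "p \<in> B"
  shows "at 0 within {s. p + s *\<^sub>R b \<in> B} = at 0 within {s. p + s *\<^sub>R b \<in> A}"
proof -
  obtain W where W: "open W" "B = A \<inter> W" using assms(1) by (auto simp: openin_open)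
  have "open ((\<lambda>s. p + s *\<^sub>R b) -` W)"
    by (intro open_vimage W continuous_intros)
  then show ?thesis
    using W assms(2) by (intro at_within_nhd[where S="(\<lambda>s. p + s *\<^sub>R b) -` W"]) auto
qed

lemma partial_on_subset_eq:
  assumes "openin (top_of_set A) B" "p \<in> B"
  shows "partial_on B b f p = partial_on A b f p"
  using partial_on_openin[OF assms] by (simp add: partial_on_def)

lemma smooth_on_openin:
  assumes "openin (top_of_set A) B" "smooth_on A f"
  shows "smooth_on B f"
proof -
  have "Ck_on k A f \<Longrightarrow> Ck_on k B f" for k
  proof (induction k arbitrary: f)
    case 0
    then show ?case using openin_imp_subset[OF assms(1)] by (auto intro: continuous_on_subset)
  next
    case (Suc k)
    have "Ck_on k B (partial_on B b f)" if "b \<in> Basis" for b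
      using Suc that by (subst Ck_on_cong[OF partial_on_subset_eq[OF assms(1)]]) auto
    moreover have "partial_exists_on B b f" if "b \<in> Basis" for b
      using Suc.prems that partial_on_openin[OF assms(1)] openin_imp_subset[OF assms(1)]
      by (auto simp: partial_exists_on_def)
    ultimately show ?case
      using Suc.prems openin_imp_subset[OF assms(1)] by (auto intro: continuous_on_subset)
  qed
  then show ?thesis using assms(2) by (simp add: smooth_on_def)
qed

lemma partial_on_add:
  assumes "thick A" "b \<in> Basis" "smooth_on A f" "smooth_on A g" "p \<in> A"
  shows "partial_on A b (\<lambda>q. f q + g q) p = partial_on A b f p + partial_on A b g p"
  using assms by (intro partial_onI has_vector_derivative_partial_add smooth_on_partial_exists)

lemma partial_on_mult:
  fixes f g :: "'a::euclidean_space \<Rightarrow> real"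
  assumes "thick A" "b \<in> Basis" "smooth_on A f" "smooth_on A g" "p \<in> A"
  shows "partial_on A b (\<lambda>q. f q * g q) p = f p * partial_on A b g p + partial_on A b f p * g p"
  using assms by (intro partial_onI has_vector_derivative_partial_mult smooth_on_partial_exists)

lemma partial_on_const:
  assumes "thick A" "b \<in> Basis" "p \<in> A"
  shows "partial_on A b (\<lambda>q. c) p = 0"
  using assms by (intro partial_onI) auto

lemma partial_on_cmult:
  fixes f :: "'a::euclidean_space \<Rightarrow> real"
  assumes "thick A" "b \<in> Basis" "smooth_on A f" "p \<in> A"
  shows "partial_on A b (\<lambda>q. c * f q) p = c * partial_on A b f p"
  using partial_on_mult[OF assms(1,2) smooth_on_const[OF assms(1)] assms(3,4), of c]
  by (simp add: partial_on_const assms)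

lemma partial_on_diff:
  fixes f g :: "'a::euclidean_space \<Rightarrow> real"
  assumes "thick A" "b \<in> Basis" "smooth_on A f" "smooth_on A g" "p \<in> A"
  shows "partial_on A b (\<lambda>q. f q - g q) p = partial_on A b f p - partial_on A b g p"
proof -
  have "partial_on A b (\<lambda>q. f q + (-1) * g q) p = partial_on A b f p + (-1) * partial_on A b g p"
    by (simp only: partial_on_add[OF assms(1-3) _ assms(5)] partial_on_cmult[OF assms(1,2,4,5)]
        smooth_on_mult[OF assms(1) smooth_on_const[OF assms(1)] assms(4)])
  then show ?thesis by simp
qed

lemma partial_on_sum:
  assumes "thick A" "b \<in> Basis" "p \<in> A" "finite J" "\<And>j. j \<in> J \<Longrightarrow> smooth_on A (f j)"
  shows "partial_on A b (\<lambda>q. \<Sum>j\<in>J. f j q) p = (\<Sum>j\<in>J. partial_on A b (f j) p)"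
  using assms(4,5)
  by (induction J)
    (auto simp: partial_on_const partial_on_add smooth_on_sum assms(1-3))

section \<open>Symmetry of second partial derivatives\<close>

lemma has_real_derivative_along_line:
  fixes f :: "'a::euclidean_space \<Rightarrow> real"
  assumes "partial_exists_on A b f" "h > 0" "\<And>s. 0 \<le> s \<Longrightarrow> s \<le> h \<Longrightarrow> p + s *\<^sub>R b \<in> interior A"
    and that: "0 \<le> s" "s \<le> h"
  shows "((\<lambda>s. f (p + s *\<^sub>R b)) has_real_derivative partial_on A b f (p + s *\<^sub>R b)) (at s)"
proof -
  let ?q = "p + s *\<^sub>R b"
  have q: "?q \<in> interior A" using assms(3) that by auto
  have "open ((\<lambda>s. ?q + s *\<^sub>R b) -` interior A)"
    by (intro open_vimage continuous_intros) auto
  then have nhd: "at 0 within {s. ?q + s *\<^sub>R b \<in> A} = at 0 within UNIV"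
    using q interior_subset[of A]
    by (intro at_within_nhd[where S="(\<lambda>s. ?q + s *\<^sub>R b) -` interior A"]) auto
  have "?q \<in> A" using q interior_subset by blast
  from partial_on_has_vector_derivative[OF assms(1) this]
  have "((\<lambda>r. f (?q + r *\<^sub>R b)) has_real_derivative partial_on A b f ?q) (at 0)"
    unfolding nhd has_real_derivative_iff_has_vector_derivative .
  moreover have "?q + r *\<^sub>R b = p + (r + s) *\<^sub>R b" for r by (simp add: scaleR_add_left)
  ultimately have "((\<lambda>r. f (p + (r + s) *\<^sub>R b)) has_real_derivative partial_on A b f ?q) (at 0)"
    by (simp only:)
  then show ?thesis
    using DERIV_shift[of "\<lambda>r. f (p + r *\<^sub>R b)" "partial_on A b f ?q" 0 s] by simp
qed

text \<open>Mean value theorem along \<open>a\<close> for the increment of \<open>f\<close> in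
  direction \<open>b\<close>, then along \<open>b\<close> for the \<open>a\<close>-derivative. The
  second difference on the left is symmetric in \<open>a\<close> and \<open>b\<close>, which is what
  makes the mixed derivatives comparable.\<close>

lemma second_difference_mvt:
  fixes f :: "'a::euclidean_space \<Rightarrow> real"
  assumes ex: "partial_exists_on A a f" "partial_exists_on A b (partial_on A a f)" and h: "h > 0"
    and int: "\<And>s t. 0 \<le> s \<Longrightarrow> s \<le> h \<Longrightarrow> 0 \<le> t \<Longrightarrow> t \<le> h \<Longrightarrow> p + s *\<^sub>R a + t *\<^sub>R b \<in> interior A"
  shows "\<exists>s t. 0 < s \<and> s < h \<and> 0 < t \<and> t < h \<and>
    f (p + h *\<^sub>R a + h *\<^sub>R b) - f (p + h *\<^sub>R a) - f (p + h *\<^sub>R b) + f p =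
       h * h * partial_on A b (partial_on A a f) (p + s *\<^sub>R a + t *\<^sub>R b)"
proof -
  define fa where "fa = partial_on A a f"
  have swap: "p + t *\<^sub>R b + s *\<^sub>R a = p + s *\<^sub>R a + t *\<^sub>R b" for s t by simp
  have 1: "((\<lambda>s. f (p + t *\<^sub>R b + s *\<^sub>R a)) has_real_derivative fa (p + t *\<^sub>R b + s *\<^sub>R a)) (at s)"
    if "0 \<le> s" "s \<le> h" "0 \<le> t" "t \<le> h" for s t
    unfolding fa_def
    by (rule has_real_derivative_along_line[OF ex(1) h]) (use int that in \<open>simp_all only: swap\<close>)
  have "((\<lambda>s. f (p + h *\<^sub>R b + s *\<^sub>R a) - f (p + 0 *\<^sub>R b + s *\<^sub>R a)) has_real_derivative
         fa (p + h *\<^sub>R b + s *\<^sub>R a) - fa (p + 0 *\<^sub>R b + s *\<^sub>R a)) (at s)" if "0 \<le> s" "s \<le> h" for s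
    by (rule DERIV_diff) (rule 1; use that h in simp)+
  from MVT2[OF h this] obtain s where s: "0 < s" "s < h"
    and e1: "f (p + h *\<^sub>R b + h *\<^sub>R a) - f (p + 0 *\<^sub>R b + h *\<^sub>R a) -
       (f (p + h *\<^sub>R b + 0 *\<^sub>R a) - f (p + 0 *\<^sub>R b + 0 *\<^sub>R a)) =
       (h - 0) * (fa (p + h *\<^sub>R b + s *\<^sub>R a) - fa (p + 0 *\<^sub>R b + s *\<^sub>R a))" by blast
  have "((\<lambda>t. fa (p + s *\<^sub>R a + t *\<^sub>R b)) has_real_derivative
          partial_on A b fa (p + s *\<^sub>R a + t *\<^sub>R b)) (at t)" if "0 \<le> t" "t \<le> h" for t
    unfolding fa_def
    by (rule has_real_derivative_along_line[OF ex(2) h]) (use int that s in simp_all)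
  from MVT2[OF h this] obtain t where t: "0 < t" "t < h"
    and e2: "fa (p + s *\<^sub>R a + h *\<^sub>R b) - fa (p + s *\<^sub>R a + 0 *\<^sub>R b) =
       (h - 0) * partial_on A b fa (p + s *\<^sub>R a + t *\<^sub>R b)" by blast
  have "f (p + h *\<^sub>R a + h *\<^sub>R b) - f (p + h *\<^sub>R a) - f (p + h *\<^sub>R b) + f p =
     h * (fa (p + s *\<^sub>R a + h *\<^sub>R b) - fa (p + s *\<^sub>R a))"
    using e1 unfolding swap by simp
  also have "\<dots> = h * h * partial_on A b fa (p + s *\<^sub>R a + t *\<^sub>R b)"
    using e2 by simp
  finally show ?thesis using s t unfolding fa_def by blast
qed

lemma partial_on_commute:
  fixes f :: "'a::euclidean_space \<Rightarrow> real"
  assumes A: "thick A" and f: "smooth_on A f" and a: "a \<in> Basis" and b: "b \<in> Basis" and p: "p \<in> A"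
  shows "partial_on A a (partial_on A b f) p = partial_on A b (partial_on A a f) p"
proof -
  let ?u = "partial_on A a (partial_on A b f)" and ?v = "partial_on A b (partial_on A a f)"
  have cu: "continuous_on A ?u" and cv: "continuous_on A ?v"
    using f a b by (auto intro!: smooth_on_continuous smooth_on_partial)
  have eq: "?u q = ?v q" if q: "q \<in> interior A" for q
  proof (rule ccontr)
    assume ne: "?u q \<noteq> ?v q"
    define e where "e = \<bar>?u q - ?v q\<bar> / 2"
    have e: "e > 0" using ne by (simp add: e_def)
    have "isCont ?u q" "isCont ?v q"
      using cu cv q continuous_on_interior by blast+
    then obtain d1 d2 where d1: "d1 > 0" "\<And>r. dist r q < d1 \<Longrightarrow> dist (?u r) (?u q) < e"
      and d2: "d2 > 0" "\<And>r. dist r q < d2 \<Longrightarrow> dist (?v r) (?v q) < e"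
      using e unfolding continuous_at_eps_delta by metis
    obtain d3 where d3: "d3 > 0" "ball q d3 \<subseteq> interior A"
      using q open_interior open_contains_ball by blast
    \<comment> \<open>Points of the square with side \<open>h\<close> lie within
      \<open>2 * h\<close> of \<open>q\<close>; dividing by 3 keeps \<open>2 * h\<close> below all
      three radii.\<close>
    define h where "h = min d1 (min d2 d3) / 3"
    have h: "h > 0" "2 * h < d1" "2 * h < d2" "2 * h < d3"
      using d1(1) d2(1) d3(1) by (auto simp: h_def min_def)
    have dd: "dist (q + s *\<^sub>R x + t *\<^sub>R y) q \<le> 2 * h"
      if "0 \<le> s" "s \<le> h" "0 \<le> t" "t \<le> h" "x \<in> Basis" "y \<in> Basis" for s t and x y :: 'a
    proof -
      have "dist (q + s *\<^sub>R x + t *\<^sub>R y) q = norm (s *\<^sub>R x + t *\<^sub>R y)" by (simp add: dist_norm add.assoc)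
      also have "\<dots> \<le> norm (s *\<^sub>R x) + norm (t *\<^sub>R y)" by (rule norm_triangle_ineq)
      also have "\<dots> \<le> 2 * h" using that by simp
      finally show ?thesis .
    qed
    have int: "q + s *\<^sub>R x + t *\<^sub>R y \<in> interior A"
      if "0 \<le> s" "s \<le> h" "0 \<le> t" "t \<le> h" "x \<in> Basis" "y \<in> Basis" for s t and x y :: 'a
      using dd[OF that] d3 h by (auto simp: dist_commute)
    have ex: "partial_exists_on A a f" "partial_exists_on A b f"
      "partial_exists_on A a (partial_on A b f)" "partial_exists_on A b (partial_on A a f)"
      using f a b by (simp_all add: smooth_on_partial_exists smooth_on_partial)
    obtain s t where st: "0 < s" "s < h" "0 < t" "t < h"
      and 1: "f (q + h *\<^sub>R b + h *\<^sub>R a) - f (q + h *\<^sub>R b) - f (q + h *\<^sub>R a) + f q =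
         h * h * ?u (q + s *\<^sub>R b + t *\<^sub>R a)"
      using second_difference_mvt[OF ex(2,3) h(1) int[OF _ _ _ _ b a]] by blast
    obtain s' t' where st': "0 < s'" "s' < h" "0 < t'" "t' < h"
      and 2: "f (q + h *\<^sub>R a + h *\<^sub>R b) - f (q + h *\<^sub>R a) - f (q + h *\<^sub>R b) + f q =
         h * h * ?v (q + s' *\<^sub>R a + t' *\<^sub>R b)"
      using second_difference_mvt[OF ex(1,4) h(1) int[OF _ _ _ _ a b]] by blast
    \<comment> \<open>The two second differences coincide, so \<open>?u\<close> and
      \<open>?v\<close> agree at two points close to \<open>q\<close>. As \<open>e\<close> is half
      the gap between them at \<open>q\<close>, this contradicts continuity.\<close>
    have swap: "q + h *\<^sub>R b + h *\<^sub>R a = q + h *\<^sub>R a + h *\<^sub>R b" by simp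
    have "h * h * ?u (q + s *\<^sub>R b + t *\<^sub>R a) = h * h * ?v (q + s' *\<^sub>R a + t' *\<^sub>R b)"
      using 1 2 unfolding swap by linarith
    then have uv: "?u (q + s *\<^sub>R b + t *\<^sub>R a) = ?v (q + s' *\<^sub>R a + t' *\<^sub>R b)" using h(1) by simp
    have "dist (?u (q + s *\<^sub>R b + t *\<^sub>R a)) (?u q) < e"
      using dd[of s t b a] st a b h by (intro d1(2)) linarith
    moreover have "dist (?v (q + s' *\<^sub>R a + t' *\<^sub>R b)) (?v q) < e"
      using dd[of s' t' a b] st' a b h by (intro d2(2)) linarith
    ultimately have "dist (?u q) (?v q) < e + e"
      using dist_triangle3[of "?u q" "?v q" "?u (q + s *\<^sub>R b + t *\<^sub>R a)"]
      unfolding uv by linarith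
    then show False by (simp add: e_def dist_real_def)
  qed
  obtain x where x: "\<And>n. x n \<in> interior A" "x \<longlonglongrightarrow> p"
    using A p closure_sequential[of p "interior A"] unfolding thick_def by blast
  have xA: "\<forall>n. x n \<in> A" using x(1) interior_subset by blast
  have "(\<lambda>n. ?u (x n)) \<longlonglongrightarrow> ?u p" "(\<lambda>n. ?v (x n)) \<longlonglongrightarrow> ?v p"
    using cu cv x(2) xA p unfolding continuous_on_sequentially o_def by blast+
  then show ?thesis using eq[OF x(1)] LIMSEQ_unique by auto
qed

section \<open>Curvature in coordinates and the Bianchi identity\<close>

lemma matrix_add_rdistrib: "(A + B) ** C = A ** C + B ** (C :: real^'n^'m)"
  by (simp add: vec_eq_iff matrix_matrix_mult_def distrib_right sum.distrib)

lemma matrix_diff_ldistrib: "A ** (B - C) = A ** B - A ** (C :: real^'n^'m)"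
  by (simp add: vec_eq_iff matrix_matrix_mult_def right_diff_distrib sum_subtractf)

lemma matrix_diff_rdistrib: "(A - B) ** C = A ** C - B ** (C :: real^'n^'m)"
  by (simp add: vec_eq_iff matrix_matrix_mult_def left_diff_distrib sum_subtractf)

text \<open>The inverse metric is a parameter with its own smoothness, and the signature is left
  open: the curvature identities below use only symmetry and invertibility.\<close>

locale coordinate_metric =
  fixes A :: "'a::euclidean_space set" and dir :: "'i::finite \<Rightarrow> 'a"
    and G Gi :: "'i \<Rightarrow> 'i \<Rightarrow> 'a \<Rightarrow> real"
  assumes thick: "thick A" and dir_Basis: "\<And>a. dir a \<in> Basis"
    and smooth_G: "\<And>a b. smooth_on A (G a b)" and smooth_Gi: "\<And>a b. smooth_on A (Gi a b)"
    and G_sym: "\<And>a b p. p \<in> A \<Longrightarrow> G a b p = G b a p"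
    and Gi_sym: "\<And>a b p. p \<in> A \<Longrightarrow> Gi a b p = Gi b a p"
    and G_Gi: "\<And>a b p. p \<in> A \<Longrightarrow> (\<Sum>e\<in>UNIV. G a e p * Gi e b p) = (if a = b then 1 else 0)"
begin

definition D :: "'i \<Rightarrow> ('a \<Rightarrow> real) \<Rightarrow> 'a \<Rightarrow> real" where
  "D a f = partial_on A (dir a) f"

text \<open>Christoffel symbols of the first kind, the lowered index standing first.\<close>

definition Chr1 :: "'i \<Rightarrow> 'i \<Rightarrow> 'i \<Rightarrow> 'a \<Rightarrow> real" where
  "Chr1 d b e p = (1/2) * (D b (G d e) p + D e (G b d) p - D d (G b e) p)"

definition Chr :: "'i \<Rightarrow> 'i \<Rightarrow> 'i \<Rightarrow> 'a \<Rightarrow> real" where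
  "Chr a b e p = (\<Sum>d\<in>UNIV. Gi a d p * Chr1 d b e p)"

definition Riem :: "'i \<Rightarrow> 'i \<Rightarrow> 'i \<Rightarrow> 'i \<Rightarrow> 'a \<Rightarrow> real" where
  "Riem a b c d p = D c (Chr a d b) p - D d (Chr a c b) p
     + (\<Sum>e\<in>UNIV. Chr a c e p * Chr e d b p - Chr a d e p * Chr e c b p)"

definition Riem_low :: "'i \<Rightarrow> 'i \<Rightarrow> 'i \<Rightarrow> 'i \<Rightarrow> 'a \<Rightarrow> real" where
  "Riem_low a b c d p = (\<Sum>e\<in>UNIV. G a e p * Riem e b c d p)"

lemma smooth_D: "smooth_on A f \<Longrightarrow> smooth_on A (D a f)"
  unfolding D_def by (rule smooth_on_partial[OF _ dir_Basis])

lemma D_cong: "(\<And>q. q \<in> A \<Longrightarrow> f q = g q) \<Longrightarrow> p \<in> A \<Longrightarrow> D a f p = D a g p"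
  unfolding D_def by (rule partial_on_cong)

lemma D_add: "smooth_on A f \<Longrightarrow> smooth_on A g \<Longrightarrow> p \<in> A \<Longrightarrow>
    D a (\<lambda>q. f q + g q) p = D a f p + D a g p"
  unfolding D_def by (rule partial_on_add[OF thick dir_Basis])

lemma D_diff: "smooth_on A f \<Longrightarrow> smooth_on A g \<Longrightarrow> p \<in> A \<Longrightarrow>
    D a (\<lambda>q. f q - g q) p = D a f p - D a g p"
  unfolding D_def by (rule partial_on_diff[OF thick dir_Basis])

lemma D_mult: "smooth_on A f \<Longrightarrow> smooth_on A g \<Longrightarrow> p \<in> A \<Longrightarrow>
    D a (\<lambda>q. f q * g q) p = f p * D a g p + D a f p * g p"
  unfolding D_def by (rule partial_on_mult[OF thick dir_Basis])

lemma D_cmult: "smooth_on A f \<Longrightarrow> p \<in> A \<Longrightarrow> D a (\<lambda>q. c * f q) p = c * D a f p"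
  unfolding D_def by (rule partial_on_cmult[OF thick dir_Basis])

lemma D_const: "p \<in> A \<Longrightarrow> D a (\<lambda>q. c) p = 0"
  unfolding D_def by (rule partial_on_const[OF thick dir_Basis])

lemma D_sum: "finite J \<Longrightarrow> (\<And>j. j \<in> J \<Longrightarrow> smooth_on A (f j)) \<Longrightarrow> p \<in> A \<Longrightarrow>
    D a (\<lambda>q. \<Sum>j\<in>J. f j q) p = (\<Sum>j\<in>J. D a (f j) p)"
  unfolding D_def by (rule partial_on_sum[OF thick dir_Basis])

lemma D_commute: "smooth_on A f \<Longrightarrow> p \<in> A \<Longrightarrow> D a (D b f) p = D b (D a f) p"
  unfolding D_def by (rule partial_on_commute[OF thick _ dir_Basis dir_Basis])

lemmas smooth_rules = smooth_on_const[OF thick] smooth_on_add[OF thick] smooth_on_diff[OF thick]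
  smooth_on_mult[OF thick] smooth_on_sum[OF thick finite] smooth_D smooth_G smooth_Gi

lemma smooth_Chr1: "smooth_on A (Chr1 a b c)"
  unfolding Chr1_def by (intro smooth_rules)

lemma smooth_Chr: "smooth_on A (Chr a b c)"
  unfolding Chr_def by (intro smooth_rules smooth_Chr1)

lemma smooth_Riem: "smooth_on A (Riem a b c d)"
  unfolding Riem_def by (intro smooth_rules smooth_Chr)

lemma D_G_sym: "p \<in> A \<Longrightarrow> D a (G b c) p = D a (G c b) p"
  by (rule D_cong[OF G_sym])

lemma Chr1_sym: "p \<in> A \<Longrightarrow> Chr1 a b c p = Chr1 a c b p"
  unfolding Chr1_def using D_G_sym[of p b a c] D_G_sym[of p c a b] D_G_sym[of p a b c] by argo

lemma Chr_sym: "p \<in> A \<Longrightarrow> Chr a b c p = Chr a c b p"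
  unfolding Chr_def using Chr1_sym by simp

text \<open>Metric compatibility of the Levi-Civita connection, expressed by symbols of the first
  kind.\<close>

lemma D_G_eq: "p \<in> A \<Longrightarrow> D c (G a e) p = Chr1 a c e p + Chr1 e c a p"
  unfolding Chr1_def using D_G_sym[of p c a e] D_G_sym[of p e c a] D_G_sym[of p a c e] by argo

lemma lower_raise:
  assumes "p \<in> A"
  shows "(\<Sum>e\<in>UNIV. G a e p * (\<Sum>d\<in>UNIV. Gi e d p * f d)) = f a"
proof -
  have "(\<Sum>e\<in>UNIV. G a e p * (\<Sum>d\<in>UNIV. Gi e d p * f d)) =
      (\<Sum>d\<in>UNIV. (\<Sum>e\<in>UNIV. G a e p * Gi e d p) * f d)"
    unfolding sum_distrib_left sum_distrib_right mult.assoc by (rule sum.swap)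
  also have "\<dots> = (\<Sum>d\<in>UNIV. if a = d then f d else 0)"
    by (rule sum.cong) (auto simp: G_Gi[OF assms])
  finally show ?thesis by simp
qed

lemma lower_Chr: "p \<in> A \<Longrightarrow> (\<Sum>e\<in>UNIV. G a e p * Chr e b c p) = Chr1 a b c p"
  unfolding Chr_def by (rule lower_raise)

section \<open>Algebraic symmetries of the lowered Riemann tensor\<close>

definition hess :: "'i \<Rightarrow> 'i \<Rightarrow> 'i \<Rightarrow> 'i \<Rightarrow> 'a \<Rightarrow> real" where
  "hess a b c d p = D a (D b (G c d)) p"

text \<open>The metric product of the vectors \<open>\<Gamma>_ca\<close> and
  \<open>\<Gamma>_db\<close>, one of them lowered.\<close>

definition quad :: "'i \<Rightarrow> 'i \<Rightarrow> 'i \<Rightarrow> 'i \<Rightarrow> 'a \<Rightarrow> real" where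
  "quad c a d b p = (\<Sum>e\<in>UNIV. Chr1 e c a p * Chr e d b p)"

lemma hess_sym1: "p \<in> A \<Longrightarrow> hess a b c d p = hess b a c d p"
  unfolding hess_def by (rule D_commute[OF smooth_G])

lemma hess_sym2: "p \<in> A \<Longrightarrow> hess a b c d p = hess a b d c p"
  unfolding hess_def by (rule D_cong[OF D_G_sym])

lemma quad_sym: "p \<in> A \<Longrightarrow> quad c a d b p = quad a c d b p"
  unfolding quad_def using Chr1_sym by simp

lemma quad_swap:
  assumes "p \<in> A"
  shows "quad c a d b p = quad d b c a p"
proof -
  have "quad c a d b p = (\<Sum>e\<in>UNIV. \<Sum>f\<in>UNIV. Chr1 e c a p * Gi e f p * Chr1 f d b p)"
    unfolding quad_def Chr_def by (simp add: sum_distrib_left mult.assoc)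
  also have "\<dots> = (\<Sum>f\<in>UNIV. \<Sum>e\<in>UNIV. Chr1 e c a p * Gi e f p * Chr1 f d b p)"
    by (rule sum.swap)
  also have "\<dots> = quad d b c a p"
    unfolding quad_def Chr_def sum_distrib_left
    by (intro sum.cong refl) (simp add: Gi_sym[OF assms] mult_ac)
  finally show ?thesis .
qed

lemma D_Chr1:
  "p \<in> A \<Longrightarrow> D c (Chr1 a d b) p = (1/2) * (hess c d a b p + hess c b d a p - hess c a d b p)"
  unfolding Chr1_def hess_def by (simp only: D_cmult D_add D_diff smooth_rules)

text \<open>Product rule for the identity \<open>lower_Chr\<close>; metric compatibility splits the
  derivative of \<open>G\<close> into the two Christoffel products.\<close>

lemma lower_D_Chr:
  assumes "p \<in> A"
  shows "(\<Sum>e\<in>UNIV. G a e p * D c (Chr e d b) p) =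
    D c (Chr1 a d b) p - (\<Sum>e\<in>UNIV. Chr1 a c e p * Chr e d b p) - quad c a d b p"
proof -
  have "D c (Chr1 a d b) p = D c (\<lambda>q. \<Sum>e\<in>UNIV. G a e q * Chr e d b q) p"
    by (rule D_cong[OF _ assms]) (simp add: lower_Chr)
  also have "\<dots> = (\<Sum>e\<in>UNIV. G a e p * D c (Chr e d b) p + D c (G a e) p * Chr e d b p)"
    using assms by (simp add: D_sum D_mult smooth_rules smooth_Chr)
  also have "\<dots> = (\<Sum>e\<in>UNIV. G a e p * D c (Chr e d b) p)
      + (\<Sum>e\<in>UNIV. Chr1 a c e p * Chr e d b p) + quad c a d b p"
    using assms by (simp add: D_G_eq quad_def distrib_right sum.distrib add.assoc)
  finally show ?thesis by simp
qed

lemma lower_Chr_mult: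
  assumes "p \<in> A"
  shows "(\<Sum>e\<in>UNIV. G a e p * (\<Sum>f\<in>UNIV. Chr e c f p * Chr f d b p)) =
    (\<Sum>f\<in>UNIV. Chr1 a c f p * Chr f d b p)"
proof -
  have "(\<Sum>e\<in>UNIV. G a e p * (\<Sum>f\<in>UNIV. Chr e c f p * Chr f d b p)) =
      (\<Sum>f\<in>UNIV. \<Sum>e\<in>UNIV. G a e p * Chr e c f p * Chr f d b p)"
    unfolding sum_distrib_left mult.assoc by (rule sum.swap)
  then show ?thesis by (simp add: sum_distrib_right[symmetric] lower_Chr[OF assms])
qed

text \<open>The products \<open>Chr1 * Chr\<close> coming from \<open>lower_D_Chr\<close> cancel
  those in the definition of the curvature and leave only second derivatives of the metric and
  \<open>quad\<close>. All index symmetries can be read off from this form.\<close>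

lemma Riem_low_eq:
  assumes "p \<in> A"
  shows "Riem_low a b c d p =
    (1/2) * (hess c b d a p - hess c a d b p - hess d b c a p + hess d a c b p)
    - quad c a d b p + quad d a c b p"
proof -
  have "Riem_low a b c d p =
      (\<Sum>e\<in>UNIV. G a e p * D c (Chr e d b) p) - (\<Sum>e\<in>UNIV. G a e p * D d (Chr e c b) p)
      + (\<Sum>e\<in>UNIV. G a e p * (\<Sum>f\<in>UNIV. Chr e c f p * Chr f d b p))
      - (\<Sum>e\<in>UNIV. G a e p * (\<Sum>f\<in>UNIV. Chr e d f p * Chr f c b p))"
    unfolding Riem_low_def Riem_def
    by (simp add: algebra_simps sum.distrib sum_subtractf)
  then show ?thesis
    using hess_sym1[OF assms, of c d a b]
    unfolding lower_D_Chr[OF assms] lower_Chr_mult[OF assms] D_Chr1[OF assms] by argo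
qed

lemma Riem_low_antisym:
  assumes "p \<in> A"
  shows "Riem_low a b c d p = - Riem_low b a c d p"
  using quad_swap[OF assms, of c a d b] quad_swap[OF assms, of d a c b]
  unfolding Riem_low_eq[OF assms] by argo

lemma Riem_antisym: "Riem a b c d p = - Riem a b d c p"
  by (simp add: Riem_def sum_subtractf)

lemma Riem_low_antisym': "Riem_low a b c d p = - Riem_low a b d c p"
  unfolding Riem_low_def by (subst Riem_antisym) (simp add: sum_negf)

lemma Riem_low_pair:
  assumes "p \<in> A"
  shows "Riem_low a b c d p = Riem_low c d a b p"
  using hess_sym1[OF assms, of c b d a] hess_sym2[OF assms, of b c d a]
    hess_sym1[OF assms, of c a d b] hess_sym2[OF assms, of a c d b]
    hess_sym1[OF assms, of d b c a] hess_sym2[OF assms, of b d c a]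
    hess_sym1[OF assms, of d a c b] hess_sym2[OF assms, of a d c b]
    quad_sym[OF assms, of c a d b] quad_swap[OF assms, of a c d b] quad_sym[OF assms, of d b a c]
    quad_swap[OF assms, of b d a c]
    quad_sym[OF assms, of d a c b] quad_swap[OF assms, of a d c b] quad_sym[OF assms, of c b a d]
    quad_swap[OF assms, of b c a d]
  unfolding Riem_low_eq[OF assms] by argo

text \<open>As matrices in the first two indices, \<open>R\<^sub>c\<^sub>d = \<partial>\<^sub>c \<Gamma>\<^sub>d - \<partial>\<^sub>d \<Gamma>\<^sub>c + [\<Gamma>\<^sub>c, \<Gamma>\<^sub>d]\<close>. In this
  form the Bianchi identity needs only commuting partial derivatives and the Jacobi identity.\<close>

definition Chr_mat :: "'i \<Rightarrow> 'a \<Rightarrow> real^'i^'i" where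
  "Chr_mat c p = (\<chi> a b. Chr a c b p)"

definition D_Chr_mat :: "'i \<Rightarrow> 'i \<Rightarrow> 'a \<Rightarrow> real^'i^'i" where
  "D_Chr_mat e c p = (\<chi> a b. D e (Chr a c b) p)"

definition Riem_mat :: "'i \<Rightarrow> 'i \<Rightarrow> 'a \<Rightarrow> real^'i^'i" where
  "Riem_mat c d p = (\<chi> a b. Riem a b c d p)"

definition D_Riem_mat :: "'i \<Rightarrow> 'i \<Rightarrow> 'i \<Rightarrow> 'a \<Rightarrow> real^'i^'i" where
  "D_Riem_mat e c d p = (\<chi> a b. D e (Riem a b c d) p)"

definition DD_Chr_mat :: "'i \<Rightarrow> 'i \<Rightarrow> 'i \<Rightarrow> 'a \<Rightarrow> real^'i^'i" where
  "DD_Chr_mat e c d p = (\<chi> a b. D e (D c (Chr a d b)) p)"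

lemma Riem_mat_eq:
  "Riem_mat c d p = D_Chr_mat c d p - D_Chr_mat d c p
     + (Chr_mat c p ** Chr_mat d p - Chr_mat d p ** Chr_mat c p)"
  by (simp add: vec_eq_iff Riem_mat_def D_Chr_mat_def Chr_mat_def Riem_def
      matrix_matrix_mult_def sum_subtractf)

lemma D_Riem_mat_eq:
  assumes "p \<in> A"
  shows "D_Riem_mat e c d p = DD_Chr_mat e c d p - DD_Chr_mat e d c p
     + (Chr_mat c p ** D_Chr_mat e d p + D_Chr_mat e c p ** Chr_mat d p
        - (Chr_mat d p ** D_Chr_mat e c p + D_Chr_mat e d p ** Chr_mat c p))"
proof -
  have "D e (Riem a b c d) p = D e (D c (Chr a d b)) p - D e (D d (Chr a c b)) p
      + (\<Sum>f\<in>UNIV. (Chr a c f p * D e (Chr f d b) p + D e (Chr a c f) p * Chr f d b p)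
         - (Chr a d f p * D e (Chr f c b) p + D e (Chr a d f) p * Chr f c b p))" for a b
    unfolding Riem_def using assms
    by (simp add: D_add D_diff D_sum D_mult smooth_rules smooth_Chr)
  then show ?thesis
    by (simp add: vec_eq_iff D_Riem_mat_def DD_Chr_mat_def D_Chr_mat_def Chr_mat_def
      matrix_matrix_mult_def sum_subtractf sum.distrib)
qed

lemma bianchi_mat:
  assumes "p \<in> A"
  shows "D_Riem_mat e c d p + (Chr_mat e p ** Riem_mat c d p - Riem_mat c d p ** Chr_mat e p)
       + D_Riem_mat c d e p + (Chr_mat c p ** Riem_mat d e p - Riem_mat d e p ** Chr_mat c p)
       + D_Riem_mat d e c p + (Chr_mat d p ** Riem_mat e c p - Riem_mat e c p ** Chr_mat d p) = 0"
proof -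
  have "DD_Chr_mat a b c p = DD_Chr_mat b a c p" for a b c
    unfolding DD_Chr_mat_def using D_commute[OF smooth_Chr assms] by simp
  from this[of e c d] this[of c d e] this[of d e c] show ?thesis
    by (simp add: D_Riem_mat_eq[OF assms] Riem_mat_eq matrix_add_ldistrib matrix_add_rdistrib
        matrix_diff_ldistrib matrix_diff_rdistrib matrix_mul_assoc)
qed

text \<open>The Christoffel terms acting on \<open>c\<close>, \<open>d\<close>, \<open>e\<close>
  cancel in the cyclic sum, so these partial derivatives with corrections on \<open>a\<close> and
  \<open>b\<close> alone are the second Bianchi identity.\<close>

lemma bianchi:
  assumes "p \<in> A"
  shows "D e (Riem a b c d) p
      + (\<Sum>f\<in>UNIV. Chr a e f p * Riem f b c d p) - (\<Sum>f\<in>UNIV. Riem a f c d p * Chr f e b p)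
      + D c (Riem a b d e) p
      + (\<Sum>f\<in>UNIV. Chr a c f p * Riem f b d e p) - (\<Sum>f\<in>UNIV. Riem a f d e p * Chr f c b p)
      + D d (Riem a b e c) p
      + (\<Sum>f\<in>UNIV. Chr a d f p * Riem f b e c p) - (\<Sum>f\<in>UNIV. Riem a f e c p * Chr f d b p) = 0"
  using arg_cong[OF bianchi_mat[OF assms, of e c d], of "\<lambda>M. M $ a $ b"]
  unfolding D_Riem_mat_def Chr_mat_def Riem_mat_def matrix_matrix_mult_def
    vector_add_component vector_minus_component zero_index vec_lambda_beta
  by linarith

end

section \<open>Evolution of the curvature of an electric perfect fluid\<close>

lemma sum_option: "(\<Sum>a\<in>UNIV. f a) = f None + (\<Sum>i\<in>UNIV. f (Some i))"
  for f :: "'j::finite option \<Rightarrow> 'b::comm_monoid_add"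
  by (simp add: UNIV_option_conv sum.reindex)

context coordinate_metric
begin

definition Ric :: "'i \<Rightarrow> 'i \<Rightarrow> 'a \<Rightarrow> real" where
  "Ric b d p = (\<Sum>a\<in>UNIV. Riem a b a d p)"

definition scal :: "'a \<Rightarrow> real" where
  "scal p = (\<Sum>a\<in>UNIV. \<Sum>b\<in>UNIV. Gi a b p * Ric a b p)"

definition Weyl :: "'i \<Rightarrow> 'i \<Rightarrow> 'i \<Rightarrow> 'i \<Rightarrow> 'a \<Rightarrow> real" where
  "Weyl a b c d p = Riem_low a b c d p
     - (1/2) * (G a c p * Ric b d p - G a d p * Ric b c p - G b c p * Ric a d p + G b d p * Ric a c p)
     + (scal p / 6) * (G a c p * G b d p - G a d p * G b c p)"

lemma Gi_G:
  assumes "p \<in> A"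
  shows "(\<Sum>e\<in>UNIV. Gi a e p * G e b p) = (if a = b then 1 else 0)"
proof -
  have "(\<Sum>e\<in>UNIV. Gi a e p * G e b p) = (\<Sum>e\<in>UNIV. G b e p * Gi e a p)"
    by (intro sum.cong refl) (simp add: G_sym[OF assms, of _ b] Gi_sym[OF assms, of a] mult.commute)
  then show ?thesis by (simp add: G_Gi[OF assms])
qed

lemma Riem_eq_raise:
  assumes "p \<in> A"
  shows "Riem a b c d p = (\<Sum>e\<in>UNIV. Gi a e p * Riem_low e b c d p)"
proof -
  have "(\<Sum>e\<in>UNIV. Gi a e p * Riem_low e b c d p) =
      (\<Sum>f\<in>UNIV. (\<Sum>e\<in>UNIV. Gi a e p * G e f p) * Riem f b c d p)"
    unfolding Riem_low_def sum_distrib_left sum_distrib_right mult.assoc by (rule sum.swap)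
  also have "\<dots> = (\<Sum>f\<in>UNIV. if a = f then Riem f b c d p else 0)"
    by (intro sum.cong refl) (simp add: Gi_G[OF assms])
  finally show ?thesis by simp
qed

end

text \<open>An antisymmetric pair takes three values, so \<open>r\<close> has nine independent
  components, as many as \<open>q\<close>, and the contraction can be inverted. The first pair of
  indices is meant to be raised, hence Kronecker deltas in place of the metric.\<close>

lemma curvature_from_contraction_3:
  fixes r :: "3 \<Rightarrow> 3 \<Rightarrow> 3 \<Rightarrow> 3 \<Rightarrow> real"
  assumes "\<And>i j k l. r i j k l = - r j i k l" "\<And>i j k l. r i j k l = - r i j l k"
    and q: "\<And>j l. q j l = (\<Sum>i\<in>UNIV. r i j i l)"
  shows "r i j k l = (if i = k then q j l else 0) - (if i = l then q j k else 0)
    - (if j = k then q i l else 0) + (if j = l then q i k else 0)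
    - (1/2) * (\<Sum>m\<in>UNIV. q m m) *
      ((if i = k then 1 else 0) * (if j = l then 1 else 0) - (if i = l then 1 else 0) * (if j = k then 1 else 0))"
proof -
  have z: "r i i k l = 0" "r i j k k = 0" for i j k l
    using assms(1)[of i i k l] assms(2)[of i j k k] by auto
  have s: "r 2 1 k l = - r 1 2 k l" "r 3 1 k l = - r 1 3 k l" "r 3 2 k l = - r 2 3 k l"
    "r i j 2 1 = - r i j 1 2" "r i j 3 1 = - r i j 1 3" "r i j 3 2 = - r i j 2 3" for i j k l
    by (rule assms)+
  have qs: "q 1 1 = r 1 2 1 2 + r 1 3 1 3" "q 2 2 = r 1 2 1 2 + r 2 3 2 3" "q 3 3 = r 1 3 1 3 + r 2 3 2 3"
    "q 1 2 = r 1 3 2 3" "q 2 1 = r 2 3 1 3" "q 1 3 = - r 1 2 2 3" "q 3 1 = - r 2 3 1 2"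
    "q 2 3 = r 1 2 1 3" "q 3 2 = r 1 3 1 2"
    by (simp_all add: q sum_3 z s)
  have tr: "(1/2) * (\<Sum>m\<in>UNIV. q m m) = r 1 2 1 2 + r 1 3 1 3 + r 2 3 2 3"
    by (simp add: sum_3 qs)
  have "\<forall>i j k l. r i j k l = (if i = k then q j l else 0) - (if i = l then q j k else 0)
    - (if j = k then q i l else 0) + (if j = l then q i k else 0)
    - (1/2) * (\<Sum>m\<in>UNIV. q m m) *
      ((if i = k then 1 else 0) * (if j = l then 1 else 0) - (if i = l then 1 else 0) * (if j = k then 1 else 0))"
    unfolding forall_3 tr by (simp add: z s qs)
  then show ?thesis by blast
qed

text \<open>Here \<open>e\<close> is the electric Weyl tensor, \<open>q\<close> the spatial Ricci contraction and \<open>t\<close> the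
  tidal tensor, with \<open>m = M/3\<close> and \<open>c = (M + 3P)/6\<close>; \<open>dq\<close> is the contracted Bianchi identity.\<close>

lemma evolution_algebra:
  fixes e th q t dq :: "3 \<Rightarrow> 3 \<Rightarrow> real" and r :: "3 \<Rightarrow> 3 \<Rightarrow> 3 \<Rightarrow> 3 \<Rightarrow> real" and m c :: real
  assumes tr: "(\<Sum>i\<in>UNIV. e i i) = 0"
    and q: "\<And>i j. q i j = e i j + (if i = j then 2 * m else 0)"
    and t: "\<And>i j. t i j = e i j + (if i = j then c else 0)"
    and r: "\<And>i j k l. r i j k l = (if i = k then q j l else 0) - (if i = l then q j k else 0)
      - (if j = k then q i l else 0) + (if j = l then q i k else 0)
      - 3 * m * ((if i = k then 1 else 0) * (if j = l then 1 else 0) - (if i = l then 1 else 0) * (if j = k then 1 else 0))"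
    and dq: "\<And>j l. dq j l = - (\<Sum>i\<in>UNIV. \<Sum>n\<in>UNIV. th i n * r n j i l) - (\<Sum>n\<in>UNIV. th j n * q n l)
      - (\<Sum>i\<in>UNIV. th i i) * t j l + (\<Sum>i\<in>UNIV. t i l * th j i)
      + (\<Sum>i\<in>UNIV. th i l * t j i) - (\<Sum>i\<in>UNIV. t i i) * th j l"
  shows "(\<Sum>i\<in>UNIV. dq i i) = - 4 * (\<Sum>i\<in>UNIV. th i i) * (m + c)"
    and "(\<Sum>i\<in>UNIV. \<Sum>j\<in>UNIV. e i j * dq j i) =
      - 2 * (\<Sum>i\<in>UNIV. th i i) * (\<Sum>i\<in>UNIV. \<Sum>j\<in>UNIV. e i j * e j i)
      + 3 * (\<Sum>i\<in>UNIV. \<Sum>j\<in>UNIV. \<Sum>k\<in>UNIV. th i j * e j k * e k i)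
      - (m + c) * (\<Sum>i\<in>UNIV. \<Sum>j\<in>UNIV. th i j * e j i)"
proof -
  \<comment> \<open>With \<open>e 3 3\<close> eliminated, trace-freeness becomes a substitution and
    each of the nine components below is a polynomial identity.\<close>
  have e33: "e 3 3 = - e 1 1 - e 2 2" using tr by (simp add: sum_3)
  define h where "h = (\<Sum>i\<in>UNIV. th i i)"
  define w where "w = (\<Sum>i\<in>UNIV. \<Sum>j\<in>UNIV. th i j * e j i)"
  \<comment> \<open>The diagonal term is harmless: in the trace its \<open>3 * w\<close> cancels the
    one from the products of \<open>e\<close> and \<open>th\<close>, and paired with
    \<open>e\<close> it meets the vanishing trace.\<close>
  have "\<forall>j l. dq j l =
      - 2 * h * e j l + 2 * (\<Sum>i\<in>UNIV. e j i * th i l) + (\<Sum>i\<in>UNIV. th j i * e i l)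
      - (m + c) * th j l - (if j = l then (m + c) * h + w else 0)"
    unfolding forall_3 dq r q t sum_3 h_def w_def by (simp add: e33 algebra_simps)
  then have *: "dq j l =
      - 2 * h * e j l + 2 * (\<Sum>i\<in>UNIV. e j i * th i l) + (\<Sum>i\<in>UNIV. th j i * e i l)
      - (m + c) * th j l - (if j = l then (m + c) * h + w else 0)" for j l by blast
  have "(\<Sum>i\<in>UNIV. dq i i) = - 2 * h * (\<Sum>i\<in>UNIV. e i i) + 3 * w - (m + c) * h - 3 * ((m + c) * h + w)"
    unfolding * w_def h_def by (simp add: sum_3 algebra_simps)
  then show "(\<Sum>i\<in>UNIV. dq i i) = - 4 * (\<Sum>i\<in>UNIV. th i i) * (m + c)"
    by (simp add: tr h_def[symmetric] algebra_simps)
  have "(\<Sum>i\<in>UNIV. \<Sum>j\<in>UNIV. e i j * dq j i) =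
      - 2 * h * (\<Sum>i\<in>UNIV. \<Sum>j\<in>UNIV. e i j * e j i)
      + 3 * (\<Sum>i\<in>UNIV. \<Sum>j\<in>UNIV. \<Sum>k\<in>UNIV. th i j * e j k * e k i)
      - (m + c) * w - ((m + c) * h + w) * (\<Sum>i\<in>UNIV. e i i)"
    unfolding * by (simp add: sum_3 w_def algebra_simps)
  then show "(\<Sum>i\<in>UNIV. \<Sum>j\<in>UNIV. e i j * dq j i) =
      - 2 * (\<Sum>i\<in>UNIV. th i i) * (\<Sum>i\<in>UNIV. \<Sum>j\<in>UNIV. e i j * e j i)
      + 3 * (\<Sum>i\<in>UNIV. \<Sum>j\<in>UNIV. \<Sum>k\<in>UNIV. th i j * e j k * e k i)
      - (m + c) * (\<Sum>i\<in>UNIV. \<Sum>j\<in>UNIV. th i j * e j i)"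
    by (simp add: tr h_def w_def)
qed

text \<open>The equations are required on all of \<open>A\<close>, not at one point, because
  vanishing curvature components are differentiated. Both orders of the mixed Einstein equation are
  listed since the symmetry of \<open>Ric\<close> is derived from the Einstein equation in
  \<open>Ric_sym\<close>.\<close>

locale perfect_fluid_metric =
  coordinate_metric A coord_dir G Gi
  for A :: "(real \<times> (real^3)) set" and G Gi :: "idx \<Rightarrow> idx \<Rightarrow> real \<times> (real^3) \<Rightarrow> real" +
  fixes M P :: "real \<times> (real^3) \<Rightarrow> real"
  assumes G_mixed: "\<And>p i. p \<in> A \<Longrightarrow> G None (Some i) p = 0"
    and G_time: "\<And>p. p \<in> A \<Longrightarrow> G None None p < 0"
    and einstein_time: "\<And>p. p \<in> A \<Longrightarrow> Ric None None p - (1/2) * scal p * G None None p = - M p * G None None p"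
    and einstein_mixed: "\<And>p i. p \<in> A \<Longrightarrow> Ric None (Some i) p - (1/2) * scal p * G None (Some i) p = 0"
    and einstein_mixed': "\<And>p i. p \<in> A \<Longrightarrow> Ric (Some i) None p - (1/2) * scal p * G (Some i) None p = 0"
    and einstein_space: "\<And>p i j. p \<in> A \<Longrightarrow>
      Ric (Some i) (Some j) p - (1/2) * scal p * G (Some i) (Some j) p = P p * G (Some i) (Some j) p"
    and weyl_electric: "\<And>p i j l. p \<in> A \<Longrightarrow> Weyl None (Some i) (Some j) (Some l) p = 0"
begin

text \<open>\<open>expn\<close> is \<open>\<theta>\<close>, the second fundamental form times \<open>-N\<close> with one index raised; \<open>tidal\<close> is
  \<open>R\<^sub>T\<^sub>j\<^sub>T\<^sub>l\<close> with \<open>j\<close> raised; \<open>SRiem i j k l\<close> is the spacetime Riemann tensor on spatial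
  indices with the first pair raised (not the curvature of the slice), and \<open>SRic\<close> its contraction.\<close>

definition g :: "3 \<Rightarrow> 3 \<Rightarrow> real \<times> (real^3) \<Rightarrow> real" where "g i j = G (Some i) (Some j)"
definition gi :: "3 \<Rightarrow> 3 \<Rightarrow> real \<times> (real^3) \<Rightarrow> real" where "gi i j = Gi (Some i) (Some j)"
definition lapse2 :: "real \<times> (real^3) \<Rightarrow> real" where "lapse2 p = - G None None p"

definition expn :: "3 \<Rightarrow> 3 \<Rightarrow> real \<times> (real^3) \<Rightarrow> real" where
  "expn i j p = (1/2) * (\<Sum>m\<in>UNIV. gi i m p * D None (g m j) p)"

definition tidal_low :: "3 \<Rightarrow> 3 \<Rightarrow> real \<times> (real^3) \<Rightarrow> real" where
  "tidal_low j l p = Riem_low None (Some j) None (Some l) p / lapse2 p"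

definition tidal :: "3 \<Rightarrow> 3 \<Rightarrow> real \<times> (real^3) \<Rightarrow> real" where
  "tidal i l p = (\<Sum>j\<in>UNIV. gi i j p * tidal_low j l p)"

definition SRiem :: "3 \<Rightarrow> 3 \<Rightarrow> 3 \<Rightarrow> 3 \<Rightarrow> real \<times> (real^3) \<Rightarrow> real" where
  "SRiem i j k l p = (\<Sum>m\<in>UNIV. gi j m p * Riem (Some i) (Some m) (Some k) (Some l) p)"

definition SRic :: "3 \<Rightarrow> 3 \<Rightarrow> real \<times> (real^3) \<Rightarrow> real" where
  "SRic j l p = (\<Sum>i\<in>UNIV. SRiem i j i l p)"

section \<open>Block structure of the metric and of the Riemann tensor\<close>

lemma lapse2_pos: "p \<in> A \<Longrightarrow> 0 < lapse2 p"
  using G_time by (simp add: lapse2_def)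

lemma G_mixed': "p \<in> A \<Longrightarrow> G (Some i) None p = 0"
  using G_mixed G_sym by metis

lemma Gi_mixed: "p \<in> A \<Longrightarrow> Gi None (Some i) p = 0"
  using G_Gi[of p None "Some i"] G_time[of p] by (simp add: sum_option G_mixed)

lemma Gi_mixed': "p \<in> A \<Longrightarrow> Gi (Some i) None p = 0"
  using Gi_mixed Gi_sym by metis

lemma Gi_time: "p \<in> A \<Longrightarrow> Gi None None p = - 1 / lapse2 p"
  using G_Gi[of p None None] G_time[of p] by (simp add: sum_option G_mixed lapse2_def field_simps)

lemma g_gi: "p \<in> A \<Longrightarrow> (\<Sum>m\<in>UNIV. g i m p * gi m j p) = (if i = j then 1 else 0)"
  using G_Gi[of p "Some i" "Some j"] by (simp add: sum_option G_mixed' g_def gi_def)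

lemma gi_g: "p \<in> A \<Longrightarrow> (\<Sum>m\<in>UNIV. gi i m p * g m j p) = (if i = j then 1 else 0)"
  using Gi_G[of p "Some i" "Some j"] by (simp add: sum_option Gi_mixed' g_def gi_def)

lemma g_sym: "p \<in> A \<Longrightarrow> g i j p = g j i p"
  unfolding g_def by (rule G_sym)

lemma gi_sym: "p \<in> A \<Longrightarrow> gi i j p = gi j i p"
  unfolding gi_def by (rule Gi_sym)

lemma smooth_g: "smooth_on A (g i j)" and smooth_gi: "smooth_on A (gi i j)"
  by (simp_all add: g_def gi_def smooth_G smooth_Gi)

lemma smooth_SRiem: "smooth_on A (SRiem i j k l)"
  unfolding SRiem_def by (intro smooth_rules smooth_gi smooth_Riem)

lemma smooth_SRic: "smooth_on A (SRic i j)"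
  unfolding SRic_def by (intro smooth_rules smooth_SRiem)

text \<open>Every Ricci correction in this Weyl component carries a mixed component of
  \<open>G\<close> or of \<open>Ric\<close>; both vanish, the latter because the fluid has no
  momentum density.\<close>

lemma Riem_low_electric: "p \<in> A \<Longrightarrow> Riem_low None (Some i) (Some j) (Some l) p = 0"
  using weyl_electric[of p i j l] einstein_mixed[of p j] einstein_mixed[of p l]
  by (simp add: Weyl_def G_mixed)

lemma Riem_low_electric':
  assumes "p \<in> A"
  shows "Riem_low (Some i) None (Some j) (Some l) p = 0"
    "Riem_low (Some i) (Some j) None (Some l) p = 0"
    "Riem_low (Some i) (Some j) (Some l) None p = 0"
proof -
  show 1: "Riem_low (Some i) None (Some j) (Some l) p = 0" for i j l
    using Riem_low_antisym[OF assms, of "Some i" None] by (simp add: Riem_low_electric assms)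
  show "Riem_low (Some i) (Some j) None (Some l) p = 0"
    by (simp add: Riem_low_pair[OF assms, of "Some i"] Riem_low_electric assms)
  show "Riem_low (Some i) (Some j) (Some l) None p = 0"
    by (simp add: Riem_low_pair[OF assms, of "Some i"] 1)
qed

lemma Riem_low_time:
  assumes "p \<in> A"
  shows "Riem_low None (Some i) None (Some j) p = lapse2 p * tidal_low i j p"
    "Riem_low (Some i) None None (Some j) p = - lapse2 p * tidal_low i j p"
    "Riem_low None (Some i) (Some j) None p = - lapse2 p * tidal_low i j p"
    "Riem_low (Some i) None (Some j) None p = lapse2 p * tidal_low i j p"
proof -
  show 1: "Riem_low None (Some i) None (Some j) p = lapse2 p * tidal_low i j p"
    using lapse2_pos[OF assms] by (simp add: tidal_low_def)
  show 2: "Riem_low (Some i) None None (Some j) p = - lapse2 p * tidal_low i j p"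
    using Riem_low_antisym[OF assms, of "Some i" None] 1 by simp
  show "Riem_low None (Some i) (Some j) None p = - lapse2 p * tidal_low i j p"
    using Riem_low_antisym'[of None "Some i" "Some j" None p] 1 by simp
  show "Riem_low (Some i) None (Some j) None p = lapse2 p * tidal_low i j p"
    using Riem_low_antisym'[of "Some i" None "Some j" None p] 2 by simp
qed

lemma tidal_low_sym: "p \<in> A \<Longrightarrow> tidal_low i j p = tidal_low j i p"
  unfolding tidal_low_def using Riem_low_pair by metis

lemma Riem_components:
  assumes "p \<in> A"
  shows "Riem None (Some j) (Some k) (Some l) p = 0"
    "Riem (Some i) None (Some k) (Some l) p = 0"
    "Riem (Some i) (Some j) None (Some l) p = 0"
    "Riem (Some i) (Some j) (Some k) None p = 0"
    "Riem None (Some j) None (Some l) p = - tidal_low j l p"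
    "Riem None (Some j) (Some l) None p = tidal_low j l p"
    "Riem (Some i) None None (Some l) p = - lapse2 p * tidal i l p"
    "Riem (Some i) None (Some l) None p = lapse2 p * tidal i l p"
  using lapse2_pos[OF assms]
  by (simp_all add: Riem_eq_raise[OF assms] sum_option Riem_low_electric' Riem_low_electric
      Riem_low_time Gi_mixed Gi_mixed' Gi_time assms tidal_def gi_def sum_distrib_left mult_ac sum_negf)

lemma Riem_space:
  assumes "p \<in> A"
  shows "Riem (Some i) (Some j) (Some k) (Some l) p =
    (\<Sum>m\<in>UNIV. gi i m p * Riem_low (Some m) (Some j) (Some k) (Some l) p)"
  by (simp add: Riem_eq_raise[OF assms] sum_option Gi_mixed' assms gi_def)

lemma SRiem_eq:
  assumes "p \<in> A"
  shows "SRiem i j k l p =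
    (\<Sum>m\<in>UNIV. \<Sum>n\<in>UNIV. gi i m p * gi j n p * Riem_low (Some m) (Some n) (Some k) (Some l) p)"
proof -
  have "SRiem i j k l p =
    (\<Sum>n\<in>UNIV. \<Sum>m\<in>UNIV. gi i m p * gi j n p * Riem_low (Some m) (Some n) (Some k) (Some l) p)"
    by (simp add: SRiem_def Riem_space[OF assms] sum_distrib_left mult_ac)
  also have "\<dots> = (\<Sum>m\<in>UNIV. \<Sum>n\<in>UNIV. gi i m p * gi j n p * Riem_low (Some m) (Some n) (Some k) (Some l) p)"
    by (rule sum.swap)
  finally show ?thesis .
qed

lemma SRiem_antisym:
  assumes "p \<in> A"
  shows "SRiem i j k l p = - SRiem j i k l p"
proof -
  have "SRiem i j k l p =
    (\<Sum>n\<in>UNIV. \<Sum>m\<in>UNIV. gi i m p * gi j n p * Riem_low (Some m) (Some n) (Some k) (Some l) p)"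
    unfolding SRiem_eq[OF assms] by (rule sum.swap)
  also have "\<dots> = (\<Sum>n\<in>UNIV. \<Sum>m\<in>UNIV. - (gi j n p * gi i m p * Riem_low (Some n) (Some m) (Some k) (Some l) p))"
    by (intro sum.cong refl) (subst Riem_low_antisym[OF assms], simp add: mult_ac)
  finally show ?thesis by (simp add: SRiem_eq[OF assms] sum_negf)
qed

lemma SRiem_antisym': "SRiem i j k l p = - SRiem i j l k p"
  unfolding SRiem_def by (subst Riem_antisym) (simp add: sum_negf)

lemma SRiem_from_SRic:
  assumes "p \<in> A"
  shows "SRiem i j k l p = (if i = k then SRic j l p else 0) - (if i = l then SRic j k p else 0)
    - (if j = k then SRic i l p else 0) + (if j = l then SRic i k p else 0)
    - (1/2) * (\<Sum>m\<in>UNIV. SRic m m p) *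
      ((if i = k then 1 else 0) * (if j = l then 1 else 0) - (if i = l then 1 else 0) * (if j = k then 1 else 0))"
proof (rule curvature_from_contraction_3)
qed (rule SRiem_antisym[OF assms] SRiem_antisym' SRic_def)+

section \<open>Time evolution of the spatial Riemann block\<close>

lemma D_G_mixed:
  assumes "p \<in> A"
  shows "D a (G None (Some i)) p = 0" "D a (G (Some i) None) p = 0"
proof -
  show "D a (G None (Some i)) p = 0"
    using D_cong[of "G None (Some i)" "\<lambda>_. 0", OF G_mixed assms] D_const[OF assms] by simp
  then show "D a (G (Some i) None) p = 0"
    using D_G_sym[OF assms, of a "Some i" None] by simp
qed

lemma Chr_time:
  assumes "p \<in> A"
  shows "Chr (Some i) None (Some j) p = expn i j p" "Chr (Some i) (Some j) None p = expn i j p"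
    "Chr None (Some k) (Some j) p = D None (g k j) p / (2 * lapse2 p)"
proof -
  show 1: "Chr (Some i) None (Some j) p = expn i j p"
    by (simp add: Chr_def sum_option Gi_mixed' Chr1_def D_G_mixed assms expn_def gi_def g_def[abs_def]
        sum_distrib_left mult_ac)
  then show "Chr (Some i) (Some j) None p = expn i j p"
    using Chr_sym[OF assms, of "Some i" "Some j" None] by simp
  show "Chr None (Some k) (Some j) p = D None (g k j) p / (2 * lapse2 p)"
    by (simp add: Chr_def sum_option Gi_mixed Gi_time Chr1_def D_G_mixed assms g_def[abs_def])
qed

lemma D_Riem_zero:
  assumes "p \<in> A"
  shows "D a (Riem (Some i) (Some j) (Some l) None) p = 0" "D a (Riem (Some i) (Some j) None (Some l)) p = 0"
  using D_cong[of "Riem (Some i) (Some j) (Some l) None" "\<lambda>_. 0" p a]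
    D_cong[of "Riem (Some i) (Some j) None (Some l)" "\<lambda>_. 0" p a] D_const[OF assms, of a 0]
  by (simp_all add: Riem_components assms)

text \<open>The spatial derivatives in the Bianchi identity with one time index act on components that
  vanish on an open set, so only products with Christoffel symbols survive.\<close>

lemma D_time_Riem:
  assumes "p \<in> A"
  shows "D None (Riem (Some i) (Some j) (Some k) (Some l)) p =
    - (\<Sum>m\<in>UNIV. expn i m p * Riem (Some m) (Some j) (Some k) (Some l) p)
    + (\<Sum>m\<in>UNIV. Riem (Some i) (Some m) (Some k) (Some l) p * expn m j p)
    - expn i k p * tidal_low j l p + tidal i l p * (D None (g k j) p / 2)
    + expn i l p * tidal_low j k p - tidal i k p * (D None (g l j) p / 2)"
  using bianchi[OF assms, of None "Some i" "Some j" "Some k" "Some l"] lapse2_pos[OF assms]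
  by (simp add: sum_option Riem_components Chr_time D_Riem_zero assms)

text \<open>\<open>\<theta>\<close> with both indices raised is symmetric; this lets
  \<open>\<theta>\<close> pass through the raising of the second Riemann index.\<close>

lemma expn_gi:
  assumes "p \<in> A"
  shows "(\<Sum>m\<in>UNIV. expn i m p * gi m j p) = (\<Sum>m\<in>UNIV. gi i m p * expn j m p)"
proof -
  have "(\<Sum>m\<in>UNIV. expn i m p * gi m j p) =
      (\<Sum>m\<in>UNIV. \<Sum>n\<in>UNIV. (1/2) * gi i n p * D None (g n m) p * gi m j p)"
    by (simp add: expn_def sum_distrib_left sum_distrib_right mult_ac)
  also have "\<dots> = (\<Sum>n\<in>UNIV. \<Sum>m\<in>UNIV. (1/2) * gi i n p * D None (g n m) p * gi m j p)"
    by (rule sum.swap)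
  also have "\<dots> = (\<Sum>n\<in>UNIV. gi i n p * expn j n p)"
    unfolding expn_def sum_distrib_left
    by (intro sum.cong refl)
      (simp add: gi_sym[OF assms, of j] D_G_sym[OF assms, of None "Some _" "Some _", folded g_def] mult_ac)
  finally show ?thesis .
qed

lemma D_time_gi:
  assumes "p \<in> A"
  shows "D None (gi j m) p = - 2 * (\<Sum>q\<in>UNIV. expn j q p * gi q m p)"
proof -
  have 0: "(\<Sum>e\<in>UNIV. g i e p * D None (gi e m) p) = - (\<Sum>e\<in>UNIV. D None (g i e) p * gi e m p)" for i
  proof -
    have "(\<Sum>e\<in>UNIV. g i e p * D None (gi e m) p + D None (g i e) p * gi e m p) =
        D None (\<lambda>q. \<Sum>e\<in>UNIV. g i e q * gi e m q) p"
      using assms by (simp add: D_sum D_mult smooth_rules smooth_g smooth_gi)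
    also have "\<dots> = D None (\<lambda>q. if i = m then 1 else 0) p"
      by (rule D_cong[OF _ assms]) (rule g_gi)
    finally show ?thesis by (simp add: D_const[OF assms] sum.distrib)
  qed
  have "D None (gi j m) p = (\<Sum>e\<in>UNIV. (if j = e then 1 else 0) * D None (gi e m) p)"
    by (simp add: if_distrib[of "\<lambda>x. x * _"] cong: if_cong)
  also have "\<dots> = (\<Sum>e\<in>UNIV. (\<Sum>i\<in>UNIV. gi j i p * g i e p) * D None (gi e m) p)"
    by (simp only: gi_g[OF assms])
  also have "\<dots> = (\<Sum>i\<in>UNIV. gi j i p * (\<Sum>e\<in>UNIV. g i e p * D None (gi e m) p))"
    unfolding sum_distrib_left sum_distrib_right mult.assoc by (rule sum.swap)
  also have "\<dots> = - (\<Sum>i\<in>UNIV. \<Sum>e\<in>UNIV. gi j i p * D None (g i e) p * gi e m p)"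
    by (simp add: 0 sum_distrib_left sum_negf mult.assoc)
  also have "(\<Sum>i\<in>UNIV. \<Sum>e\<in>UNIV. gi j i p * D None (g i e) p * gi e m p) =
      (\<Sum>e\<in>UNIV. \<Sum>i\<in>UNIV. gi j i p * D None (g i e) p * gi e m p)"
    by (rule sum.swap)
  also have "\<dots> = 2 * (\<Sum>q\<in>UNIV. expn j q p * gi q m p)"
    by (simp add: expn_def sum_distrib_left sum_distrib_right)
  finally show ?thesis by simp
qed

lemma raise_D_g: "p \<in> A \<Longrightarrow> (\<Sum>m\<in>UNIV. gi j m p * (D None (g k m) p / 2)) = expn j k p"
  unfolding expn_def sum_distrib_left
  by (intro sum.cong refl) (simp add: D_G_sym[of p None "Some k" "Some _", folded g_def])

text \<open>The time derivative of \<open>gi\<close> contributes \<open>- 2 * \<theta>\<close> on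
  the index \<open>j\<close>, which turns the coefficient 1 of \<open>D_time_Riem\<close> into -1.
  Both raised indices are then treated alike.\<close>

lemma D_time_SRiem:
  assumes "p \<in> A"
  shows "D None (SRiem i j k l) p =
    - (\<Sum>m\<in>UNIV. expn i m p * SRiem m j k l p) - (\<Sum>m\<in>UNIV. expn j m p * SRiem i m k l p)
    - expn i k p * tidal j l p + tidal i l p * expn j k p
    + expn i l p * tidal j k p - tidal i k p * expn j l p"
proof -
  let ?R = "\<lambda>i m. Riem (Some i) (Some m) (Some k) (Some l) p"
  have "D None (SRiem i j k l) p =
      (\<Sum>m\<in>UNIV. gi j m p * D None (Riem (Some i) (Some m) (Some k) (Some l)) p + D None (gi j m) p * ?R i m)"
    unfolding SRiem_def using assms by (simp add: D_sum D_mult smooth_rules smooth_gi smooth_Riem)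
  also have "\<dots> =
      - (\<Sum>m\<in>UNIV. gi j m p * (\<Sum>n\<in>UNIV. expn i n p * ?R n m))
      + (\<Sum>m\<in>UNIV. gi j m p * (\<Sum>n\<in>UNIV. ?R i n * expn n m p))
      - expn i k p * (\<Sum>m\<in>UNIV. gi j m p * tidal_low m l p)
      + tidal i l p * (\<Sum>m\<in>UNIV. gi j m p * (D None (g k m) p / 2))
      + expn i l p * (\<Sum>m\<in>UNIV. gi j m p * tidal_low m k p)
      - tidal i k p * (\<Sum>m\<in>UNIV. gi j m p * (D None (g l m) p / 2))
      + (\<Sum>m\<in>UNIV. D None (gi j m) p * ?R i m)"
    unfolding D_time_Riem[OF assms]
    by (simp add: sum.distrib sum_subtractf sum_negf sum_distrib_left algebra_simps)
  also have "(\<Sum>m\<in>UNIV. gi j m p * (\<Sum>n\<in>UNIV. expn i n p * ?R n m)) =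
      (\<Sum>n\<in>UNIV. expn i n p * SRiem n j k l p)"
  proof -
    have "(\<Sum>m\<in>UNIV. gi j m p * (\<Sum>n\<in>UNIV. expn i n p * ?R n m)) =
        (\<Sum>n\<in>UNIV. \<Sum>m\<in>UNIV. gi j m p * (expn i n p * ?R n m))"
      unfolding sum_distrib_left by (rule sum.swap)
    then show ?thesis by (simp add: SRiem_def sum_distrib_left mult.left_commute)
  qed
  also have "(\<Sum>m\<in>UNIV. gi j m p * (\<Sum>n\<in>UNIV. ?R i n * expn n m p)) =
      (\<Sum>m\<in>UNIV. expn j m p * SRiem i m k l p)"
  proof -
    have "(\<Sum>m\<in>UNIV. gi j m p * (\<Sum>n\<in>UNIV. ?R i n * expn n m p)) =
        (\<Sum>n\<in>UNIV. \<Sum>m\<in>UNIV. gi j m p * (?R i n * expn n m p))"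
      unfolding sum_distrib_left by (rule sum.swap)
    also have "\<dots> = (\<Sum>n\<in>UNIV. (\<Sum>m\<in>UNIV. gi j m p * expn n m p) * ?R i n)"
      unfolding sum_distrib_right by (intro sum.cong refl) (simp add: mult_ac)
    also have "\<dots> = (\<Sum>n\<in>UNIV. \<Sum>m\<in>UNIV. expn j m p * gi m n p * ?R i n)"
      by (simp only: expn_gi[OF assms, symmetric] sum_distrib_right)
    also have "\<dots> = (\<Sum>m\<in>UNIV. \<Sum>n\<in>UNIV. expn j m p * gi m n p * ?R i n)"
      by (rule sum.swap)
    finally show ?thesis by (simp add: SRiem_def sum_distrib_left mult.assoc)
  qed
  also have "(\<Sum>m\<in>UNIV. D None (gi j m) p * ?R i m) = - 2 * (\<Sum>m\<in>UNIV. expn j m p * SRiem i m k l p)"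
  proof -
    have "(\<Sum>m\<in>UNIV. D None (gi j m) p * ?R i m) = - 2 * (\<Sum>m\<in>UNIV. \<Sum>q\<in>UNIV. expn j q p * gi q m p * ?R i m)"
      by (simp only: D_time_gi[OF assms] sum_distrib_left sum_distrib_right mult.assoc)
    also have "(\<Sum>m\<in>UNIV. \<Sum>q\<in>UNIV. expn j q p * gi q m p * ?R i m) =
      (\<Sum>q\<in>UNIV. \<Sum>m\<in>UNIV. expn j q p * gi q m p * ?R i m)"
      by (rule sum.swap)
    finally show ?thesis by (simp add: SRiem_def sum_distrib_left mult.assoc)
  qed
  finally show ?thesis
    unfolding raise_D_g[OF assms] tidal_def[symmetric] by simp
qed

section \<open>Einstein equation and evolution of the mass density and the electric tensor\<close>

lemma Ric_components:
  assumes "p \<in> A"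
  shows "Ric (Some j) (Some l) p = - tidal_low j l p + (\<Sum>i\<in>UNIV. Riem (Some i) (Some j) (Some i) (Some l) p)"
    and "Ric None None p = lapse2 p * (\<Sum>i\<in>UNIV. tidal i i p)"
proof -
  have "Riem None None None None p = 0" using Riem_antisym[of None None None None p] by simp
  then show "Ric None None p = lapse2 p * (\<Sum>i\<in>UNIV. tidal i i p)"
    by (simp add: Ric_def sum_option Riem_components assms sum_distrib_left)
qed (simp add: Ric_def sum_option Riem_components assms)

lemma raise_Ric:
  assumes "p \<in> A"
  shows "(\<Sum>j\<in>UNIV. gi m j p * Ric (Some j) (Some l) p) = SRic m l p - tidal m l p"
proof -
  have "(\<Sum>j\<in>UNIV. gi m j p * Ric (Some j) (Some l) p) =
     (\<Sum>j\<in>UNIV. \<Sum>i\<in>UNIV. gi m j p * Riem (Some i) (Some j) (Some i) (Some l) p) - tidal m l p"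
    by (simp add: Ric_components[OF assms] tidal_def algebra_simps sum.distrib sum_subtractf
        sum_distrib_left sum_negf)
  also have "(\<Sum>j\<in>UNIV. \<Sum>i\<in>UNIV. gi m j p * Riem (Some i) (Some j) (Some i) (Some l) p) =
     (\<Sum>i\<in>UNIV. \<Sum>j\<in>UNIV. gi m j p * Riem (Some i) (Some j) (Some i) (Some l) p)"
    by (rule sum.swap)
  finally show ?thesis by (simp add: SRic_def SRiem_def)
qed

lemma scal_eq:
  assumes "p \<in> A"
  shows "scal p = (\<Sum>i\<in>UNIV. SRic i i p) - 2 * (\<Sum>i\<in>UNIV. tidal i i p)"
proof -
  have "scal p = - (\<Sum>i\<in>UNIV. tidal i i p) + (\<Sum>i\<in>UNIV. \<Sum>j\<in>UNIV. gi i j p * Ric (Some i) (Some j) p)"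
    using lapse2_pos[OF assms]
    by (simp add: scal_def sum_option Gi_mixed Gi_mixed' Gi_time Ric_components(2) assms gi_def)
  also have "(\<Sum>i\<in>UNIV. \<Sum>j\<in>UNIV. gi i j p * Ric (Some i) (Some j) p) =
      (\<Sum>j\<in>UNIV. \<Sum>i\<in>UNIV. gi j i p * Ric (Some i) (Some j) p)"
    by (subst sum.swap) (simp add: gi_sym[OF assms])
  finally show ?thesis by (simp add: raise_Ric[OF assms] sum_subtractf)
qed

text \<open>The time component together with \<open>scal_eq\<close> fixes the trace of
  \<open>SRic\<close>; the trace of the spatial equations then fixes \<open>scal\<close>, and the
  spatial equations themselves express \<open>tidal\<close> by \<open>SRic\<close>.\<close>

lemma
  assumes "p \<in> A"
  shows SRic_trace: "(\<Sum>i\<in>UNIV. SRic i i p) = 2 * M p"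
    and scal_fluid: "scal p = M p - 3 * P p"
    and tidal_fluid: "tidal i j p = SRic i j p - (if i = j then (M p - P p) / 2 else 0)"
proof -
  let ?q = "\<Sum>i\<in>UNIV. SRic i i p" and ?a = "\<Sum>i\<in>UNIV. tidal i i p"
  have "lapse2 p * (?a + scal p / 2) = lapse2 p * M p"
    using einstein_time[OF assms] by (simp add: Ric_components(2)[OF assms] lapse2_def algebra_simps)
  then have "?a + scal p / 2 = M p" using lapse2_pos[OF assms] by simp
  then show q: "?q = 2 * M p" unfolding scal_eq[OF assms] by argo
  have E: "SRic i j p - tidal i j p = (P p + scal p / 2) * (if i = j then 1 else 0)" for i j
  proof -
    have "Ric (Some m) (Some j) p = (P p + scal p / 2) * g m j p" for m
      using einstein_space[OF assms, of m j] by (simp add: g_def algebra_simps)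
    then have "SRic i j p - tidal i j p = (P p + scal p / 2) * (\<Sum>m\<in>UNIV. gi i m p * g m j p)"
      by (simp add: raise_Ric[OF assms, symmetric] sum_distrib_left mult.left_commute)
    then show ?thesis by (simp only: gi_g[OF assms])
  qed
  have "?q - ?a = (\<Sum>i\<in>UNIV. SRic i i p - tidal i i p)"
    by (simp add: sum_subtractf)
  also have "\<dots> = 3 * (P p + scal p / 2)"
    unfolding E by (simp add: sum_3)
  finally have "?q - ?a = 3 * (P p + scal p / 2)" .
  then show s: "scal p = M p - 3 * P p" using scal_eq[OF assms] q by argo
  show "tidal i j p = SRic i j p - (if i = j then (M p - P p) / 2 else 0)"
    using E[of i j] s by (simp add: field_simps split: if_splits)
qed

text \<open>The trace of \<open>tidal\<close> is \<open>(M + 3 * P) / 2\<close>; a third of it is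
  removed on the diagonal, which leaves the electric Weyl tensor with one index raised.\<close>

definition elec :: "3 \<Rightarrow> 3 \<Rightarrow> real \<times> (real^3) \<Rightarrow> real" where
  "elec i j p = tidal i j p - (if i = j then (M p + 3 * P p) / 6 else 0)"

definition elec_sq :: "real \<times> (real^3) \<Rightarrow> real" where
  "elec_sq p = (\<Sum>i\<in>UNIV. \<Sum>j\<in>UNIV. elec i j p * elec j i p)"

lemma SRic_elec: "p \<in> A \<Longrightarrow> SRic i j p = elec i j p + (if i = j then 2 / 3 * M p else 0)"
  using tidal_fluid[of p i j] by (cases "i = j") (simp_all add: elec_def field_simps)

lemma elec_trace: "p \<in> A \<Longrightarrow> (\<Sum>i\<in>UNIV. elec i i p) = 0"
  using SRic_trace[of p] by (simp add: SRic_elec sum.distrib)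

lemma D_time_SRic:
  assumes "p \<in> A"
  shows "D None (SRic j l) p =
     - (\<Sum>i\<in>UNIV. \<Sum>m\<in>UNIV. expn i m p * SRiem m j i l p) - (\<Sum>m\<in>UNIV. expn j m p * SRic m l p)
    - (\<Sum>i\<in>UNIV. expn i i p) * tidal j l p + (\<Sum>i\<in>UNIV. tidal i l p * expn j i p)
    + (\<Sum>i\<in>UNIV. expn i l p * tidal j i p) - (\<Sum>i\<in>UNIV. tidal i i p) * expn j l p"
proof -
  have "D None (SRic j l) p = (\<Sum>i\<in>UNIV. D None (SRiem i j i l) p)"
    unfolding SRic_def using assms by (simp add: D_sum smooth_SRiem)
  also have "\<dots> = - (\<Sum>i\<in>UNIV. \<Sum>m\<in>UNIV. expn i m p * SRiem m j i l p)
    - (\<Sum>i\<in>UNIV. \<Sum>m\<in>UNIV. expn j m p * SRiem i m i l p)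
    - (\<Sum>i\<in>UNIV. expn i i p) * tidal j l p + (\<Sum>i\<in>UNIV. tidal i l p * expn j i p)
    + (\<Sum>i\<in>UNIV. expn i l p * tidal j i p) - (\<Sum>i\<in>UNIV. tidal i i p) * expn j l p"
    unfolding D_time_SRiem[OF assms]
    by (simp add: sum.distrib sum_subtractf sum_negf sum_distrib_right)
  also have "(\<Sum>i\<in>UNIV. \<Sum>m\<in>UNIV. expn j m p * SRiem i m i l p) = (\<Sum>m\<in>UNIV. expn j m p * SRic m l p)"
    unfolding SRic_def sum_distrib_left by (rule sum.swap)
  finally show ?thesis .
qed

abbreviation expansion :: "real \<times> (real^3) \<Rightarrow> real" where
  "expansion p \<equiv> \<Sum>i\<in>UNIV. expn i i p"

lemma SRic_evolution:
  assumes "p \<in> A"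
  shows "(\<Sum>i\<in>UNIV. D None (SRic i i) p) = - 2 * expansion p * (M p + P p)"
    and "(\<Sum>i\<in>UNIV. \<Sum>j\<in>UNIV. elec i j p * D None (SRic j i) p) =
      - 2 * expansion p * elec_sq p
      + 3 * (\<Sum>i\<in>UNIV. \<Sum>j\<in>UNIV. \<Sum>k\<in>UNIV. expn i j p * elec j k p * elec k i p)
      - (1/2) * (M p + P p) * (\<Sum>i\<in>UNIV. \<Sum>j\<in>UNIV. expn i j p * elec j i p)"
proof -
  have q: "SRic i j p = elec i j p + (if i = j then 2 * (M p / 3) else 0)" for i j
    using SRic_elec[OF assms, of i j] by simp
  have t: "tidal i j p = elec i j p + (if i = j then (M p + 3 * P p) / 6 else 0)" for i j
    by (simp add: elec_def)
  have r: "SRiem i j k l p = (if i = k then SRic j l p else 0) - (if i = l then SRic j k p else 0)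
    - (if j = k then SRic i l p else 0) + (if j = l then SRic i k p else 0)
    - 3 * (M p / 3) * ((if i = k then 1 else 0) * (if j = l then 1 else 0) - (if i = l then 1 else 0) * (if j = k then 1 else 0))"
    for i j k l
    using SRiem_from_SRic[OF assms, of i j k l] SRic_trace[OF assms] by simp
  have c: "M p / 3 + (M p + 3 * P p) / 6 = (1/2) * (M p + P p)" by (simp add: field_simps)
  note ev = evolution_algebra[OF elec_trace[OF assms] q t r D_time_SRic[OF assms], unfolded c]
  show "(\<Sum>i\<in>UNIV. D None (SRic i i) p) = - 2 * expansion p * (M p + P p)"
    using ev(1) by simp
  show "(\<Sum>i\<in>UNIV. \<Sum>j\<in>UNIV. elec i j p * D None (SRic j i) p) =
      - 2 * expansion p * elec_sq p
      + 3 * (\<Sum>i\<in>UNIV. \<Sum>j\<in>UNIV. \<Sum>k\<in>UNIV. expn i j p * elec j k p * elec k i p)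
      - (1/2) * (M p + P p) * (\<Sum>i\<in>UNIV. \<Sum>j\<in>UNIV. expn i j p * elec j i p)"
    unfolding elec_sq_def by (rule ev(2))
qed

lemma M_eq: "p \<in> A \<Longrightarrow> M p = (1/2) * (\<Sum>i\<in>UNIV. SRic i i p)"
  by (simp add: SRic_trace)

text \<open>The mass density enters as an arbitrary function; the Einstein equation identifies it
  with a trace of the curvature, whose smoothness it inherits.\<close>

lemma smooth_M: "smooth_on A M"
  by (rule iffD2[OF smooth_on_cong[OF M_eq]]) (assumption, intro smooth_rules smooth_SRic)

lemma D_time_M:
  assumes "p \<in> A"
  shows "D None M p = - expansion p * (M p + P p)"
proof -
  have "D None M p = D None (\<lambda>q. (1/2) * (\<Sum>i\<in>UNIV. SRic i i q)) p"
    by (rule D_cong[OF M_eq assms])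
  also have "\<dots> = (1/2) * (\<Sum>i\<in>UNIV. D None (SRic i i) p)"
    using assms by (simp only: D_cmult D_sum smooth_rules smooth_SRic finite)
  finally show ?thesis by (simp add: SRic_evolution[OF assms])
qed

text \<open>Eliminates \<open>P\<close>, whose regularity is unknown: \<open>elec\<close> is
  \<open>SRic\<close> minus a multiple of \<open>M\<close> on the diagonal, and both of these are
  smooth.\<close>

lemma elec_sq_eq:
  assumes "p \<in> A"
  shows "elec_sq p = (\<Sum>i\<in>UNIV. \<Sum>j\<in>UNIV. SRic i j p * SRic j i p) - (4/3) * (M p * M p)"
proof -
  have "(\<Sum>i\<in>UNIV. \<Sum>j\<in>UNIV. SRic i j p * SRic j i p) =
      elec_sq p + (4/3) * M p * (\<Sum>i\<in>UNIV. elec i i p) + (4/3) * (M p * M p)"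
    by (simp add: elec_sq_def SRic_elec[OF assms] sum_3 algebra_simps)
  then show ?thesis by (simp add: elec_trace[OF assms])
qed

lemma smooth_elec_sq: "smooth_on A elec_sq"
  by (rule iffD2[OF smooth_on_cong[OF elec_sq_eq]])
    (assumption, intro smooth_rules smooth_SRic smooth_M)

text \<open>The diagonal part of \<open>SRic\<close>, paired with its derivative, gives
  \<open>M * D None M\<close> by the trace formula and cancels the derivative of the subtracted
  \<open>M\<close> square.\<close>

lemma D_time_elec_sq:
  assumes "p \<in> A"
  shows "D None elec_sq p = - 4 * expansion p * elec_sq p
      + 6 * (\<Sum>i\<in>UNIV. \<Sum>j\<in>UNIV. \<Sum>k\<in>UNIV. expn i j p * elec j k p * elec k i p)
      - (M p + P p) * (\<Sum>i\<in>UNIV. \<Sum>j\<in>UNIV. expn i j p * elec j i p)"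
proof -
  have "D None elec_sq p = D None (\<lambda>q. (\<Sum>i\<in>UNIV. \<Sum>j\<in>UNIV. SRic i j q * SRic j i q) - (4/3) * (M q * M q)) p"
    by (rule D_cong[OF elec_sq_eq assms])
  also have "\<dots> = (\<Sum>i\<in>UNIV. \<Sum>j\<in>UNIV. SRic i j p * D None (SRic j i) p + D None (SRic i j) p * SRic j i p)
      - (4/3) * (M p * D None M p + D None M p * M p)"
    using assms by (simp only: D_cmult D_diff D_mult D_sum smooth_rules smooth_SRic smooth_M finite)
  also have "\<dots> = 2 * (\<Sum>i\<in>UNIV. \<Sum>j\<in>UNIV. SRic i j p * D None (SRic j i) p) - (8/3) * (M p * D None M p)"
    by (simp add: sum_3 algebra_simps)
  also have "(\<Sum>i\<in>UNIV. \<Sum>j\<in>UNIV. SRic i j p * D None (SRic j i) p) =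
      (\<Sum>i\<in>UNIV. \<Sum>j\<in>UNIV. elec i j p * D None (SRic j i) p) + (2/3) * M p * (\<Sum>i\<in>UNIV. D None (SRic i i) p)"
    by (simp add: SRic_elec[OF assms] sum_3 algebra_simps)
  finally show ?thesis
    unfolding SRic_evolution[OF assms] D_time_M[OF assms] by (simp add: field_simps)
qed

end

section \<open>Norms of the Weyl and Riemann tensors\<close>

text \<open>With \<open>h\<close> as inverse metric, the squared norm of a symmetric tensor is the
  trace of the square of its mixed form.\<close>

lemma double_contraction:
  fixes h t :: "'j::finite \<Rightarrow> 'j \<Rightarrow> real"
  assumes h: "\<And>a b. h a b = h b a" and t: "\<And>a b. t a b = t b a"
  shows "(\<Sum>a\<in>UNIV. \<Sum>b\<in>UNIV. \<Sum>a'\<in>UNIV. \<Sum>b'\<in>UNIV. h a a' * h b b' * t a b * t a' b') =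
    (\<Sum>a\<in>UNIV. \<Sum>b\<in>UNIV. (\<Sum>c\<in>UNIV. h a c * t c b) * (\<Sum>c\<in>UNIV. h b c * t c a))"
proof -
  have "(\<Sum>a\<in>UNIV. \<Sum>b\<in>UNIV. \<Sum>a'\<in>UNIV. \<Sum>b'\<in>UNIV. h a a' * h b b' * t a b * t a' b') =
    (\<Sum>b\<in>UNIV. \<Sum>a\<in>UNIV. \<Sum>a'\<in>UNIV. \<Sum>b'\<in>UNIV. h a a' * h b b' * t a b * t a' b')"
    by (rule sum.swap)
  also have "\<dots> = (\<Sum>b\<in>UNIV. \<Sum>a'\<in>UNIV. \<Sum>a\<in>UNIV. \<Sum>b'\<in>UNIV. h a a' * h b b' * t a b * t a' b')"
    by (rule sum.cong[OF refl]) (rule sum.swap)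
  also have "\<dots> = (\<Sum>a'\<in>UNIV. \<Sum>b\<in>UNIV. \<Sum>a\<in>UNIV. \<Sum>b'\<in>UNIV. h a a' * h b b' * t a b * t a' b')"
    by (rule sum.swap)
  also have "\<dots> = (\<Sum>a\<in>UNIV. \<Sum>b\<in>UNIV. (\<Sum>c\<in>UNIV. h a c * t c b) * (\<Sum>c\<in>UNIV. h b c * t c a))"
    unfolding sum_product
    by (intro sum.cong refl) (metis (no_types, opaque_lifting) h t mult.assoc mult.commute)
  finally show ?thesis .
qed

text \<open>A pair of indices is treated as one index: \<open>t\<close> becomes a symmetric bilinear
  form on pairs with inverse metric \<open>H\<close>, the tensor square of \<open>h\<close>, and
  \<open>double_contraction\<close> applies.\<close>

lemma quadruple_contraction:
  fixes h :: "'j::finite \<Rightarrow> 'j \<Rightarrow> real" and t :: "'j \<Rightarrow> 'j \<Rightarrow> 'j \<Rightarrow> 'j \<Rightarrow> real"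
  assumes h: "\<And>a b. h a b = h b a" and t: "\<And>a b c d. t a b c d = t c d a b"
    and r: "\<And>i j k l. r i j k l = (\<Sum>m\<in>UNIV. \<Sum>n\<in>UNIV. h i m * h j n * t m n k l)"
  shows "(\<Sum>a\<in>UNIV. \<Sum>b\<in>UNIV. \<Sum>c\<in>UNIV. \<Sum>d\<in>UNIV. \<Sum>a'\<in>UNIV. \<Sum>b'\<in>UNIV. \<Sum>c'\<in>UNIV. \<Sum>d'\<in>UNIV.
      h a a' * h b b' * h c c' * h d d' * t a b c d * t a' b' c' d') =
    (\<Sum>a\<in>UNIV. \<Sum>b\<in>UNIV. \<Sum>c\<in>UNIV. \<Sum>d\<in>UNIV. r a b c d * r c d a b)"
proof -
  have pair: "(\<Sum>a\<in>UNIV. \<Sum>b\<in>UNIV. f (a, b)) = (\<Sum>x\<in>UNIV. f x)" for f :: "'j \<times> 'j \<Rightarrow> real"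
    unfolding UNIV_Times_UNIV[symmetric] sum.cartesian_product' ..
  define H where "H x y = h (fst x) (fst y) * h (snd x) (snd y)" for x y :: "'j \<times> 'j"
  define T where "T x y = t (fst x) (snd x) (fst y) (snd y)" for x y :: "'j \<times> 'j"
  define R where "R x y = r (fst x) (snd x) (fst y) (snd y)" for x y :: "'j \<times> 'j"
  have R: "R x y = (\<Sum>z\<in>UNIV. H x z * T z y)" for x y
    by (simp add: R_def r H_def T_def pair[symmetric])
  have "(\<Sum>a\<in>UNIV. \<Sum>b\<in>UNIV. \<Sum>c\<in>UNIV. \<Sum>d\<in>UNIV. \<Sum>a'\<in>UNIV. \<Sum>b'\<in>UNIV. \<Sum>c'\<in>UNIV. \<Sum>d'\<in>UNIV.
      h a a' * h b b' * h c c' * h d d' * t a b c d * t a' b' c' d') =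
    (\<Sum>x\<in>UNIV. \<Sum>y\<in>UNIV. \<Sum>x'\<in>UNIV. \<Sum>y'\<in>UNIV. H x x' * H y y' * T x y * T x' y')"
    by (simp add: pair[symmetric] H_def T_def mult_ac)
  also have "\<dots> = (\<Sum>x\<in>UNIV. \<Sum>y\<in>UNIV. R x y * R y x)"
    unfolding R by (rule double_contraction) (metis H_def h, metis T_def t)
  also have "\<dots> = (\<Sum>a\<in>UNIV. \<Sum>b\<in>UNIV. \<Sum>c\<in>UNIV. \<Sum>d\<in>UNIV. r a b c d * r c d a b)"
    by (simp add: pair[symmetric] R_def)
  finally show ?thesis .
qed

text \<open>By antisymmetry only the index pairs 12, 13 and 23 remain, and both sides become the
  same quadratic polynomial in nine components.\<close>

lemma curvature_square_3:
  fixes r :: "3 \<Rightarrow> 3 \<Rightarrow> 3 \<Rightarrow> 3 \<Rightarrow> real"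
  assumes "\<And>i j k l. r i j k l = - r j i k l" "\<And>i j k l. r i j k l = - r i j l k"
    and q: "\<And>j l. q j l = (\<Sum>i\<in>UNIV. r i j i l)"
  shows "(\<Sum>i\<in>UNIV. \<Sum>j\<in>UNIV. \<Sum>k\<in>UNIV. \<Sum>l\<in>UNIV. r i j k l * r k l i j) =
    4 * (\<Sum>i\<in>UNIV. \<Sum>j\<in>UNIV. q i j * q j i) - (\<Sum>i\<in>UNIV. q i i)\<^sup>2"
proof -
  have z: "r i i k l = 0" "r i j k k = 0" for i j k l
    using assms(1)[of i i k l] assms(2)[of i j k k] by auto
  have s: "r 2 1 k l = - r 1 2 k l" "r 3 1 k l = - r 1 3 k l" "r 3 2 k l = - r 2 3 k l"
    "r i j 2 1 = - r i j 1 2" "r i j 3 1 = - r i j 1 3" "r i j 3 2 = - r i j 2 3" for i j k l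
    by (rule assms)+
  show ?thesis
    by (simp add: sum_3 q z s power2_eq_square algebra_simps)
qed

text \<open>An odd number of time indices gives zero by \<open>elec\<close>, two in the same pair
  give zero by antisymmetry. What remains is the spatial block and four equal copies of the block
  with one time index in each pair, hence the factor 4. Each tensor in that block absorbs one factor
  \<open>H None None\<close>, which is the role of \<open>w\<close>.\<close>

lemma norm_sum_electric:
  fixes h :: "3 \<Rightarrow> 3 \<Rightarrow> real" and H :: "idx \<Rightarrow> idx \<Rightarrow> real" and T :: "idx \<Rightarrow> idx \<Rightarrow> idx \<Rightarrow> idx \<Rightarrow> real"
  assumes H: "\<And>i. H None (Some i) = 0" "\<And>i. H (Some i) None = 0"
    and Hs: "\<And>i j. H (Some i) (Some j) = h i j" and h: "\<And>i j. h i j = h j i"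
    and anti: "\<And>a b c d. T a b c d = - T b a c d" and anti': "\<And>a b c d. T a b c d = - T a b d c"
    and pair: "\<And>a b c d. T a b c d = T c d a b"
    and elec: "\<And>i j k. T None (Some i) (Some j) (Some k) = 0"
    and r: "\<And>i j k l. r i j k l = (\<Sum>m\<in>UNIV. \<Sum>n\<in>UNIV. h i m * h j n * T (Some m) (Some n) (Some k) (Some l))"
    and u: "\<And>i j. H None None * T None (Some i) None (Some j) = w i j"
  shows "(\<Sum>a\<in>UNIV. \<Sum>b\<in>UNIV. \<Sum>c\<in>UNIV. \<Sum>d\<in>UNIV. \<Sum>a'\<in>UNIV. \<Sum>b'\<in>UNIV. \<Sum>c'\<in>UNIV. \<Sum>d'\<in>UNIV.
      H a a' * H b b' * H c c' * H d d' * T a b c d * T a' b' c' d') =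
    (\<Sum>i\<in>UNIV. \<Sum>j\<in>UNIV. \<Sum>k\<in>UNIV. \<Sum>l\<in>UNIV. r i j k l * r k l i j)
    + 4 * (\<Sum>i\<in>UNIV. \<Sum>j\<in>UNIV. (\<Sum>m\<in>UNIV. h i m * w m j) * (\<Sum>m\<in>UNIV. h j m * w m i))"
proof -
  have z: "T a a c d = 0" "T a b c c = 0" for a b c d
    using anti[of a a c d] anti'[of a b c c] by auto
  have e: "T (Some i) None (Some j) (Some k) = 0" "T (Some i) (Some j) None (Some k) = 0"
    "T (Some i) (Some j) (Some k) None = 0" for i j k
    using anti[of "Some i" None "Some j" "Some k"] pair[of "Some i" "Some j" None "Some k"]
      anti'[of "Some i" "Some j" None "Some k"] elec by auto
  have e2: "T (Some i) None None (Some j) = - T None (Some i) None (Some j)"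
    "T None (Some i) (Some j) None = - T None (Some i) None (Some j)"
    "T (Some i) None (Some j) None = T None (Some i) None (Some j)" for i j
    using anti[of "Some i" None None "Some j"] anti'[of None "Some i" "Some j" None]
      anti[of "Some i" None "Some j" None] by auto
  have w_sym: "w i j = w j i" for i j
    using u[of i j] u[of j i] pair[of None "Some i" None "Some j"] by simp
  have "(\<Sum>a\<in>UNIV. \<Sum>b\<in>UNIV. \<Sum>c\<in>UNIV. \<Sum>d\<in>UNIV. \<Sum>a'\<in>UNIV. \<Sum>b'\<in>UNIV. \<Sum>c'\<in>UNIV. \<Sum>d'\<in>UNIV.
      H a a' * H b b' * H c c' * H d d' * T a b c d * T a' b' c' d') =
    (\<Sum>a\<in>UNIV. \<Sum>b\<in>UNIV. \<Sum>c\<in>UNIV. \<Sum>d\<in>UNIV. \<Sum>a'\<in>UNIV. \<Sum>b'\<in>UNIV. \<Sum>c'\<in>UNIV. \<Sum>d'\<in>UNIV.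
      h a a' * h b b' * h c c' * h d d' * T (Some a) (Some b) (Some c) (Some d) * T (Some a') (Some b') (Some c') (Some d'))
    + 4 * (\<Sum>a\<in>UNIV. \<Sum>b\<in>UNIV. \<Sum>a'\<in>UNIV. \<Sum>b'\<in>UNIV. h a a' * h b b' * w a b * w a' b')"
    by (simp add: sum_option H Hs z e e2 elec u[symmetric] mult_ac sum.distrib sum_distrib_left[symmetric])
  also have "(\<Sum>a\<in>UNIV. \<Sum>b\<in>UNIV. \<Sum>c\<in>UNIV. \<Sum>d\<in>UNIV. \<Sum>a'\<in>UNIV. \<Sum>b'\<in>UNIV. \<Sum>c'\<in>UNIV. \<Sum>d'\<in>UNIV.
      h a a' * h b b' * h c c' * h d d' * T (Some a) (Some b) (Some c) (Some d) * T (Some a') (Some b') (Some c') (Some d'))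
    = (\<Sum>i\<in>UNIV. \<Sum>j\<in>UNIV. \<Sum>k\<in>UNIV. \<Sum>l\<in>UNIV. r i j k l * r k l i j)"
    by (rule quadruple_contraction[OF h pair r])
  also have "(\<Sum>a\<in>UNIV. \<Sum>b\<in>UNIV. \<Sum>a'\<in>UNIV. \<Sum>b'\<in>UNIV. h a a' * h b b' * w a b * w a' b') =
     (\<Sum>i\<in>UNIV. \<Sum>j\<in>UNIV. (\<Sum>m\<in>UNIV. h i m * w m j) * (\<Sum>m\<in>UNIV. h j m * w m i))"
    by (rule double_contraction[OF h w_sym])
  finally show ?thesis .
qed

section \<open>Norms of the curvature in the fluid region\<close>

context perfect_fluid_metric
begin

definition sq_norm :: "(idx \<Rightarrow> idx \<Rightarrow> idx \<Rightarrow> idx \<Rightarrow> real) \<Rightarrow> (idx \<Rightarrow> idx \<Rightarrow> real) \<Rightarrow> real" where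
  "sq_norm T H = (\<Sum>a\<in>UNIV. \<Sum>b\<in>UNIV. \<Sum>c\<in>UNIV. \<Sum>d\<in>UNIV. \<Sum>a'\<in>UNIV. \<Sum>b'\<in>UNIV. \<Sum>c'\<in>UNIV. \<Sum>d'\<in>UNIV.
      H a a' * H b b' * H c c' * H d d' * T a b c d * T a' b' c' d')"

text \<open>Inverse of the associated Riemannian metric: only the time component of the Lorentzian
  inverse changes sign.\<close>

definition riem_Gi :: "real \<times> (real^3) \<Rightarrow> idx \<Rightarrow> idx \<Rightarrow> real" where
  "riem_Gi p a b = (if a = None \<and> b = None then 1 / lapse2 p else Gi a b p)"

lemma riem_Gi_simps:
  assumes "p \<in> A"
  shows "riem_Gi p None None = 1 / lapse2 p" "riem_Gi p None (Some i) = 0" "riem_Gi p (Some i) None = 0"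
    "riem_Gi p (Some i) (Some j) = gi i j p"
  using assms by (simp_all add: riem_Gi_def Gi_mixed Gi_mixed' gi_def)

text \<open>The spatial block contributes \<open>4 * elec_sq + 4/3 * M^2\<close>; four times the
  square of the tidal tensor contributes the rest, where the trace part separates because
  \<open>elec\<close> is trace-free.\<close>

lemma sq_norm_Riem:
  assumes "p \<in> A"
  shows "sq_norm (\<lambda>a b c d. Riem_low a b c d p) (riem_Gi p) =
    8 * elec_sq p + (4 * (M p)\<^sup>2 + (M p + 3 * P p)\<^sup>2) / 3"
proof -
  have "sq_norm (\<lambda>a b c d. Riem_low a b c d p) (riem_Gi p) =
    (\<Sum>i\<in>UNIV. \<Sum>j\<in>UNIV. \<Sum>k\<in>UNIV. \<Sum>l\<in>UNIV. SRiem i j k l p * SRiem k l i j p)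
    + 4 * (\<Sum>i\<in>UNIV. \<Sum>j\<in>UNIV. (\<Sum>m\<in>UNIV. gi i m p * tidal_low m j p) * (\<Sum>m\<in>UNIV. gi j m p * tidal_low m i p))"
    unfolding sq_norm_def
    using lapse2_pos[OF assms]
    by (intro norm_sum_electric SRiem_eq Riem_low_antisym Riem_low_antisym' Riem_low_pair
        Riem_low_electric gi_sym assms)
      (simp_all add: riem_Gi_simps[OF assms] tidal_low_def)
  also have "(\<Sum>i\<in>UNIV. \<Sum>j\<in>UNIV. \<Sum>k\<in>UNIV. \<Sum>l\<in>UNIV. SRiem i j k l p * SRiem k l i j p) =
     4 * (\<Sum>i\<in>UNIV. \<Sum>j\<in>UNIV. SRic i j p * SRic j i p) - (\<Sum>i\<in>UNIV. SRic i i p)\<^sup>2"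
    by (rule curvature_square_3) (rule SRiem_antisym[OF assms] SRiem_antisym' SRic_def)+
  also have "\<dots> = 4 * elec_sq p + 4 / 3 * (M p)\<^sup>2"
    using elec_sq_eq[OF assms] by (simp add: SRic_trace[OF assms] power2_eq_square)
  also have "(\<Sum>i\<in>UNIV. \<Sum>j\<in>UNIV. (\<Sum>m\<in>UNIV. gi i m p * tidal_low m j p) * (\<Sum>m\<in>UNIV. gi j m p * tidal_low m i p))
     = elec_sq p + 2 * ((M p + 3 * P p) / 6) * (\<Sum>i\<in>UNIV. elec i i p) + 3 * ((M p + 3 * P p) / 6)\<^sup>2"
  proof -
    have t: "tidal i j p = elec i j p + (if i = j then c else 0)" if "c = (M p + 3 * P p) / 6" for i j c
      by (simp add: elec_def that)
    define c where "c = (M p + 3 * P p) / 6"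
    show ?thesis
      unfolding tidal_def[symmetric] t[OF c_def] elec_sq_def c_def[symmetric]
      by (simp add: sum_3 algebra_simps power2_eq_square)
  qed
  finally show ?thesis
    by (simp add: elec_trace[OF assms] power2_eq_square field_simps)
qed

lemma Ric_fluid:
  assumes "p \<in> A"
  shows "Ric None None p = lapse2 p * ((M p + 3 * P p) / 2)"
    "Ric None (Some i) p = 0" "Ric (Some i) None p = 0"
    "Ric (Some i) (Some j) p = (M p - P p) / 2 * g i j p"
proof -
  show "Ric None None p = lapse2 p * ((M p + 3 * P p) / 2)"
    using einstein_time[OF assms] scal_fluid[OF assms] by (simp add: lapse2_def algebra_simps)
  show "Ric None (Some i) p = 0" "Ric (Some i) None p = 0"
    using einstein_mixed[OF assms, of i] einstein_mixed'[OF assms, of i]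
    by (simp_all add: G_mixed G_mixed' assms)
  show "Ric (Some i) (Some j) p = (M p - P p) / 2 * g i j p"
    using einstein_space[OF assms, of i j] scal_fluid[OF assms] by (simp add: g_def field_simps)
qed

lemma Weyl_space:
  assumes "p \<in> A"
  shows "Weyl (Some i) (Some j) (Some k) (Some l) p = Riem_low (Some i) (Some j) (Some k) (Some l) p
    - M p / 3 * (g i k p * g j l p - g i l p * g j k p)"
  by (simp add: Weyl_def Ric_fluid[OF assms] scal_fluid[OF assms] g_def[symmetric] field_simps)

lemma Weyl_time:
  assumes "p \<in> A"
  shows "Weyl None (Some i) None (Some j) p = lapse2 p * (tidal_low i j p - (M p + 3 * P p) / 6 * g i j p)"
  by (simp add: Weyl_def Ric_fluid[OF assms] scal_fluid[OF assms] g_def[symmetric] Riem_low_time[OF assms]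
      G_mixed[OF assms] G_mixed'[OF assms] lapse2_def field_simps)

lemma Ric_sym:
  assumes "p \<in> A"
  shows "Ric a b p = Ric b a p"
  by (cases a; cases b) (simp_all add: Ric_fluid[OF assms] g_sym[OF assms])

lemma Weyl_sym:
  assumes "p \<in> A"
  shows "Weyl a b c d p = - Weyl b a c d p" "Weyl a b c d p = - Weyl a b d c p"
    "Weyl a b c d p = Weyl c d a b p"
proof -
  show "Weyl a b c d p = - Weyl b a c d p"
    unfolding Weyl_def Riem_low_antisym[OF assms, of b a] by (simp add: algebra_simps)
  show "Weyl a b c d p = - Weyl a b d c p"
    unfolding Weyl_def Riem_low_antisym'[of a b d c] by (simp add: algebra_simps)
  show "Weyl a b c d p = Weyl c d a b p"
    unfolding Weyl_def Riem_low_pair[OF assms, of a b c d]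
    using G_sym[OF assms, of c a] G_sym[OF assms, of d a] G_sym[OF assms, of c b] G_sym[OF assms, of d b]
      Ric_sym[OF assms, of c a] Ric_sym[OF assms, of d a] Ric_sym[OF assms, of c b] Ric_sym[OF assms, of d b]
    by (simp add: mult.commute)
qed

lemma raise_g:
  assumes "p \<in> A"
  shows "(\<Sum>m\<in>UNIV. \<Sum>n\<in>UNIV. gi i m p * gi j n p * (g m k p * g n l p)) =
    (if i = k then 1 else 0) * (if j = l then 1 else 0)"
proof -
  have "(\<Sum>m\<in>UNIV. \<Sum>n\<in>UNIV. gi i m p * gi j n p * (g m k p * g n l p)) =
     (\<Sum>m\<in>UNIV. gi i m p * g m k p) * (\<Sum>n\<in>UNIV. gi j n p * g n l p)"
    unfolding sum_product by (intro sum.cong refl) (simp add: mult_ac)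
  then show ?thesis by (simp only: gi_g[OF assms])
qed

text \<open>The electric tensor occurs twice: as the contraction of the spatial Weyl block, and
  directly in the components with two time indices. Each occurrence gives
  \<open>4 * elec_sq\<close>.\<close>

lemma sq_norm_Weyl:
  assumes "p \<in> A"
  shows "sq_norm (\<lambda>a b c d. Weyl a b c d p) (riem_Gi p) = 8 * elec_sq p"
proof -
  define r where "r i j k l = SRiem i j k l p - M p / 3 *
    ((if i = k then 1 else 0) * (if j = l then 1 else 0) - (if i = l then 1 else 0) * (if j = k then 1 else 0))"
    for i j k l
  define w where "w i j = tidal_low i j p - (M p + 3 * P p) / 6 * g i j p" for i j
  have r: "r i j k l = (\<Sum>m\<in>UNIV. \<Sum>n\<in>UNIV. gi i m p * gi j n p * Weyl (Some m) (Some n) (Some k) (Some l) p)"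
    for i j k l
  proof -
    have "(\<Sum>m\<in>UNIV. \<Sum>n\<in>UNIV. gi i m p * gi j n p * Weyl (Some m) (Some n) (Some k) (Some l) p) =
      SRiem i j k l p - M p / 3 *
       ((\<Sum>m\<in>UNIV. \<Sum>n\<in>UNIV. gi i m p * gi j n p * (g m k p * g n l p))
       - (\<Sum>m\<in>UNIV. \<Sum>n\<in>UNIV. gi i m p * gi j n p * (g m l p * g n k p)))"
      unfolding SRiem_eq[OF assms] Weyl_space[OF assms] sum_distrib_left sum_subtractf[symmetric]
      by (intro sum.cong refl) (simp add: algebra_simps)
    then show ?thesis by (simp only: raise_g[OF assms] r_def)
  qed
  have w: "(\<Sum>m\<in>UNIV. gi i m p * w m j) = elec i j p" for i j
  proof -
    have "(\<Sum>m\<in>UNIV. gi i m p * w m j) = tidal i j p - (M p + 3 * P p) / 6 * (\<Sum>m\<in>UNIV. gi i m p * g m j p)"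
      unfolding w_def tidal_def sum_distrib_left sum_subtractf[symmetric]
      by (intro sum.cong refl) (simp add: algebra_simps)
    then show ?thesis by (simp add: gi_g[OF assms] elec_def)
  qed
  have "sq_norm (\<lambda>a b c d. Weyl a b c d p) (riem_Gi p) =
    (\<Sum>i\<in>UNIV. \<Sum>j\<in>UNIV. \<Sum>k\<in>UNIV. \<Sum>l\<in>UNIV. r i j k l * r k l i j)
    + 4 * (\<Sum>i\<in>UNIV. \<Sum>j\<in>UNIV. (\<Sum>m\<in>UNIV. gi i m p * w m j) * (\<Sum>m\<in>UNIV. gi j m p * w m i))"
    unfolding sq_norm_def
    using lapse2_pos[OF assms]
    by (intro norm_sum_electric Weyl_sym r gi_sym assms)
      (simp_all add: riem_Gi_simps[OF assms] w_def Weyl_time[OF assms] weyl_electric[OF assms])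
  also have "(\<Sum>i\<in>UNIV. \<Sum>j\<in>UNIV. \<Sum>k\<in>UNIV. \<Sum>l\<in>UNIV. r i j k l * r k l i j) =
     4 * (\<Sum>i\<in>UNIV. \<Sum>j\<in>UNIV. elec i j p * elec j i p) - (\<Sum>i\<in>UNIV. elec i i p)\<^sup>2"
  proof (rule curvature_square_3)
    show "r i j k l = - r j i k l" for i j k l
      unfolding r_def by (subst SRiem_antisym[OF assms]) (simp add: algebra_simps)
    show "r i j k l = - r i j l k" for i j k l
      unfolding r_def by (subst SRiem_antisym') (simp add: algebra_simps)
    have "\<forall>j l. (\<Sum>i\<in>UNIV. r i j i l) = SRic j l p - (if j = l then 2 / 3 * M p else 0)"
      unfolding forall_3 by (simp add: r_def sum_3 SRic_def)
    then show "elec j l p = (\<Sum>i\<in>UNIV. r i j i l)" for j l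
      by (simp add: SRic_elec[OF assms])
  qed
  finally show ?thesis by (simp add: w elec_trace[OF assms] elec_sq_def)
qed

text \<open>\<open>SRic\<close> and \<open>tidal\<close> carry the entire curvature. The lemma
  recognises the flat points, where the Weyl ratio is set to 1 by convention.\<close>

lemma Riem_low_eq_0:
  assumes "p \<in> A" "M p = 0" "P p = 0" "\<And>i j. elec i j p = 0"
  shows "Riem_low a b c d p = 0"
proof -
  note p = assms(1)
  have lower: "(\<Sum>m\<in>UNIV. g i m p * (\<Sum>n\<in>UNIV. gi m n p * f n)) = f i" for i and f :: "3 \<Rightarrow> real"
    using lower_raise[OF p, of "Some i" "\<lambda>a. case a of None \<Rightarrow> 0 | Some n \<Rightarrow> f n"]
    by (simp add: sum_option G_mixed'[OF p] g_def gi_def Gi_mixed'[OF p])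
  have "tidal i j p = 0" for i j using assms(2-4) by (simp add: elec_def split: if_splits)
  then have t: "tidal_low i j p = 0" for i j
    using lower[of i "\<lambda>n. tidal_low n j p"] by (simp add: tidal_def)
  have "SRiem i j k l p = 0" for i j k l
    unfolding SRiem_from_SRic[OF p] SRic_elec[OF p] by (simp add: assms)
  then have "Riem (Some i) (Some j) (Some k) (Some l) p = 0" for i j k l
    using lower[of j "\<lambda>n. Riem (Some i) (Some n) (Some k) (Some l) p"] by (simp add: SRiem_def)
  then have s: "Riem_low (Some i) (Some j) (Some k) (Some l) p = 0" for i j k l
    by (simp add: Riem_low_def sum_option G_mixed'[OF p])
  have z: "Riem_low a a c d p = 0" "Riem_low a b c c p = 0" for a b c d
    using Riem_low_antisym[OF p, of a a c d] Riem_low_antisym'[of a b c c p] by auto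
  show ?thesis
    by (cases a; cases b; cases c; cases d)
      (simp_all add: s t z Riem_low_time[OF p] Riem_low_electric[OF p] Riem_low_electric'[OF p])
qed

lemma Weyl_vacuum: "p \<in> A \<Longrightarrow> M p = 0 \<Longrightarrow> P p = 0 \<Longrightarrow> Weyl a b c d p = Riem_low a b c d p"
  by (cases a; cases b; cases c; cases d) (simp_all add: Weyl_def Ric_fluid scal_fluid)

end

section \<open>Trace inequalities for mixed tensors\<close>

lemma symmetric_matrix_component:
  assumes "transpose B = (B :: real^'n^'n)"
  shows "B $ i $ j = B $ j $ i"
proof -
  have "B $ j $ i = transpose B $ i $ j" by (simp add: transpose_def)
  then show ?thesis by (simp add: assms)
qed

text \<open>Applied to the inverse metric, the factor \<open>L\<close> provides an orthonormal
  frame, in which mixed tensors become symmetric matrices.\<close>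

lemma cholesky_3:
  fixes B :: "real^3^3"
  assumes sym: "transpose B = B" and pos: "\<And>v. v \<noteq> 0 \<Longrightarrow> 0 < v \<bullet> (B *v v)"
  obtains L :: "real^3^3" where "B = L ** transpose L"
proof -
  define b1 b2 b3 c12 c13 c23 where b: "b1 = B $ 1 $ 1" "b2 = B $ 2 $ 2" "b3 = B $ 3 $ 3"
    "c12 = B $ 1 $ 2" "c13 = B $ 1 $ 3" "c23 = B $ 2 $ 3"
  have s: "B $ 2 $ 1 = c12" "B $ 3 $ 1 = c13" "B $ 3 $ 2 = c23"
    using symmetric_matrix_component[OF sym] by (simp_all add: b)
  have q: "0 < b1 * x^2 + b2 * y^2 + b3 * z^2 + 2 * c12 * x * y + 2 * c13 * x * z + 2 * c23 * y * z"
    if "x \<noteq> 0 \<or> y \<noteq> 0 \<or> z \<noteq> 0" for x y z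
  proof -
    have "(vector [x, y, z] :: real^3) \<noteq> 0" using that by (auto simp: vec_eq_iff forall_3)
    from pos[OF this] show ?thesis
      by (simp add: inner_vec_def matrix_vector_mult_def sum_3 b[symmetric] s power2_eq_square algebra_simps)
  qed
  \<comment> \<open>Pivots of Gaussian elimination; each is positive as the value of the quadratic
    form at the vector that completes the square.\<close>
  define d2 f where "d2 = b2 - c12^2 / b1" and "f = c23 - c12 * c13 / b1"
  have b1: "b1 > 0" using q[of 1 0 0] by simp
  have d2: "d2 > 0" using q[of "- c12 / b1" 1 0] b1
    by (simp add: d2_def power2_eq_square field_simps)
  define d3 where "d3 = b3 - c13^2 / b1 - f^2 / d2"
  have d3: "d3 > 0"
  proof -
    \<comment> \<open>\<open>x\<close> and \<open>y\<close> minimise the form on the plane with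
      third coordinate 1, and the minimum is the last pivot \<open>d3\<close>.\<close>
    define y where "y = - f / d2"
    define x where "x = - (c12 * y + c13) / b1"
    have y: "d2 * y = - f" using d2 by (simp add: y_def)
    have x: "b1 * x = - (c12 * y + c13)" using b1 by (simp add: x_def)
    have "b1 * (b1 * x^2 + b2 * y^2 + b3 + 2 * c12 * x * y + 2 * c13 * x + 2 * c23 * y)
      = (b1 * x)^2 + 2 * (b1 * x) * (c12 * y + c13) + b1 * (b2 * y^2 + b3 + 2 * c23 * y)"
      by (simp add: power2_eq_square algebra_simps)
    also have "\<dots> = b1 * (b2 * y^2 + b3 + 2 * c23 * y) - (c12 * y + c13)^2"
      unfolding x by (simp add: power2_eq_square algebra_simps)
    also have "\<dots> = b1 * ((d2 * y) * y + 2 * f * y + b3 - c13^2 / b1)"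
      using b1 by (simp add: d2_def f_def power2_eq_square field_simps)
    also have "\<dots> = b1 * d3"
      unfolding y using d2 by (simp add: d3_def y_def power2_eq_square field_simps)
    finally have "b1 * x^2 + b2 * y^2 + b3 + 2 * c12 * x * y + 2 * c13 * x + 2 * c23 * y = d3"
      using b1 by simp
    then show ?thesis using q[of x y 1] by simp
  qed
  define L :: "real^3^3" where "L = vector [vector [sqrt b1, 0, 0],
    vector [c12 / sqrt b1, sqrt d2, 0], vector [c13 / sqrt b1, f / sqrt d2, sqrt d3]]"
  have e: "b2 = c12^2 / b1 + d2" "b3 = c13^2 / b1 + f^2 / d2 + d3" "c23 = c12 * c13 / b1 + f"
    by (simp_all add: d2_def d3_def f_def)
  have "B = L ** transpose L"
    using b1 d2 d3
    by (simp add: vec_eq_iff forall_3 matrix_matrix_mult_def transpose_def sum_3 L_def b[symmetric] s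
       e power2_eq_square)
  then show thesis by (rule that)
qed

lemma psd_minor:
  fixes a b c :: real
  assumes "\<And>x y. 0 \<le> a * x^2 + 2 * c * x * y + b * y^2"
  shows "c^2 \<le> a * b"
proof (cases "a = 0")
  case True
  have *: "0 \<le> 2 * c * x + b" for x using assms[of x 1] True by simp
  have "c = 0"
  proof (rule ccontr)
    assume "c \<noteq> 0"
    \<comment> \<open>At this \<open>x\<close> the affine function takes the value -1.\<close>
    then show False using *[of "- (b + 1) / (2 * c)"] by simp
  qed
  then show ?thesis using True by simp
next
  case False
  have "0 \<le> a" using assms[of 1 0] by simp
  with False have "a > 0" by simp
  \<comment> \<open>The form at the vector \<open>(c, - a)\<close> equals \<open>a\<close> times the
    minor.\<close>
  have "0 \<le> a * c^2 + 2 * c * c * (- a) + b * (- a)^2" by (rule assms)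
  then have "0 \<le> a * (a * b - c^2)" by (simp add: power2_eq_square algebra_simps)
  then show ?thesis using \<open>a > 0\<close> by (simp add: zero_le_mult_iff)
qed

lemma inner_matrix: "(X::real^3^3) \<bullet> Y = trace (X ** transpose Y)"
  by (simp add: inner_vec_def trace_def matrix_matrix_mult_def transpose_def)

lemma trace_square_symmetric:
  fixes e :: "real^3^3"
  assumes "transpose e = e"
  shows "trace (e ** e) = e \<bullet> e"
  using assms by (simp add: inner_matrix)

text \<open>Cyclicity of the trace and symmetry of \<open>e\<close> turn it into the sum of the form
  of \<open>b\<close> over the rows of \<open>e\<close>.\<close>

lemma psd_trace_square_nonneg:
  fixes b e :: "real^3^3"
  assumes e: "transpose e = e" and b: "\<And>v. 0 \<le> v \<bullet> (b *v v)"
  shows "0 \<le> trace (b ** (e ** e))"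
proof -
  have e': "e $ i $ j = e $ j $ i" for i j by (rule symmetric_matrix_component[OF e])
  have "trace (b ** (e ** e)) = trace ((e ** b) ** e)"
    using trace_mul_sym[of "b ** e" e] by (simp add: matrix_mul_assoc)
  also have "\<dots> = (\<Sum>i\<in>UNIV. e $ i \<bullet> (b *v (e $ i)))"
    by (simp add: trace_def matrix_matrix_mult_def inner_vec_def matrix_vector_mult_def sum_3 e'[of 2 1]
      e'[of 3 1] e'[of 3 2] algebra_simps)
  also have "\<dots> \<ge> 0" by (intro sum_nonneg b)
  finally show ?thesis .
qed

text \<open>As \<open>e\<close> is trace-free, only the trace-free part \<open>b0\<close> of
  \<open>b\<close> pairs with it, and Cauchy-Schwarz applies. A positive semidefinite matrix has
  norm at most its trace, so the square of the norm of \<open>b0\<close> is at most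
  \<open>1 - 1/3\<close> times the square of the trace.\<close>

lemma psd_trace_bound:
  fixes b e :: "real^3^3"
  assumes e: "transpose e = e" and b: "\<And>v. 0 \<le> v \<bullet> (b *v v)" and bs: "transpose b = b"
    and tr: "trace e = 0"
  shows "(trace (b ** e))\<^sup>2 \<le> 2 / 3 * (trace b)\<^sup>2 * trace (e ** e)"
proof -
  define t where "t = trace b / 3"
  define b0 where "b0 = b - t *\<^sub>R mat 1"
  have bs': "b $ i $ j = b $ j $ i" for i j by (rule symmetric_matrix_component[OF bs])
  have q: "0 \<le> b$1$1 * x^2 + b$2$2 * y^2 + b$3$3 * z^2 + 2 * b$1$2 * x * y + 2 * b$1$3 * x * z + 2 * b$2$3 * y * z" for x y z
    using b[of "vector [x, y, z]"]
    by (simp add: inner_vec_def matrix_vector_mult_def sum_3 bs'[of 2 1]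
      bs'[of 3 1] bs'[of 3 2] power2_eq_square algebra_simps)
  have m: "(b$1$2)^2 \<le> b$1$1 * b$2$2" "(b$1$3)^2 \<le> b$1$1 * b$3$3" "(b$2$3)^2 \<le> b$2$2 * b$3$3"
  proof (rule psd_minor)
    show "0 \<le> b$1$1 * x^2 + 2 * b$1$2 * x * y + b$2$2 * y^2" for x y using q[of x y 0] by (simp add: algebra_simps)
  next
    show "(b$1$3)^2 \<le> b$1$1 * b$3$3"
      by (rule psd_minor) (use q[of _ 0] in \<open>simp add: algebra_simps\<close>)
    show "(b$2$3)^2 \<le> b$2$2 * b$3$3"
      by (rule psd_minor) (use q[of 0] in \<open>simp add: algebra_simps\<close>)
  qed
  \<comment> \<open>The minors bound the off-diagonal squares by products of diagonal entries, so
    the square norm of \<open>b\<close> is at most the square of its trace.\<close>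
  have "b0 \<bullet> b0 \<le> 2 / 3 * (trace b)\<^sup>2"
    using m unfolding b0_def t_def
    by (simp add: inner_vec_def sum_3 trace_def mat_def bs'[of 2 1] bs'[of 3 1] bs'[of 3 2]
      power2_eq_square field_simps)
  have "trace (b ** e) = b0 \<bullet> e"
    using tr unfolding b0_def by (simp add: inner_diff_left inner_matrix[of b] e)
      (simp add: inner_vec_def mat_def trace_def sum_3 )
  then have "(trace (b ** e))\<^sup>2 \<le> (b0 \<bullet> b0) * (e \<bullet> e)"
    using Cauchy_Schwarz_ineq by metis
  also have "\<dots> \<le> 2 / 3 * (trace b)\<^sup>2 * (e \<bullet> e)"
    by (intro mult_right_mono) (use \<open>b0 \<bullet> b0 \<le> _\<close> in auto)
  finally show ?thesis by (simp add: trace_square_symmetric[OF e])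
qed

lemma inner_transpose_vector: "v \<bullet> (transpose L *v w) = (L *v v) \<bullet> (w :: real^'n)"
proof -
  have "v \<bullet> (transpose L *v w) = (w v* L) \<bullet> v" by (simp add: inner_commute)
  also have "\<dots> = w \<bullet> (L *v v)" by (rule dot_lmul_matrix)
  finally show ?thesis by (simp add: inner_commute)
qed

text \<open>The columns of \<open>L\<close> are an orthonormal frame for \<open>G\<close>, and
  \<open>hat x\<close> is the matrix of the covariant tensor \<open>x\<close> in it. Traces of
  products of mixed tensors \<open>Gi ** x\<close> agree with traces of products of
  \<open>hat x\<close>, where the Euclidean inequalities are available.\<close>

locale metric_frame =
  fixes G Gi L :: "real^3^3"
  assumes inverse: "G ** Gi = mat 1" and frame: "Gi = L ** transpose L"
begin

definition hat :: "real^3^3 \<Rightarrow> real^3^3" where "hat x = transpose L ** x ** L"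

lemma trace_hat: "trace (Gi ** x) = trace (hat x)"
  unfolding hat_def frame using trace_mul_sym[of L "transpose L ** x"] by (simp add: matrix_mul_assoc)

lemma trace_hat2: "trace ((Gi ** x) ** (Gi ** y)) = trace (hat x ** hat y)"
  unfolding hat_def frame using trace_mul_sym[of L "transpose L ** x ** L ** transpose L ** y"]
  by (simp add: matrix_mul_assoc)

lemma trace_hat3: "trace ((Gi ** x) ** ((Gi ** y) ** (Gi ** z))) = trace (hat x ** (hat y ** hat z))"
  unfolding hat_def frame
  using trace_mul_sym[of L "transpose L ** x ** L ** transpose L ** y ** L ** transpose L ** z"]
  by (simp add: matrix_mul_assoc)

lemma transpose_hat: "transpose x = x \<Longrightarrow> transpose (hat x) = hat x"
  by (simp add: hat_def matrix_transpose_mul matrix_mul_assoc)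

lemma hat_psd:
  assumes "\<And>v. 0 \<le> v \<bullet> (x *v v)"
  shows "0 \<le> v \<bullet> (hat x *v v)"
proof -
  have "hat x *v v = transpose L *v (x *v (L *v v))"
    by (simp add: hat_def matrix_vector_mul_assoc matrix_mul_assoc)
  then have "v \<bullet> (hat x *v v) = (L *v v) \<bullet> (x *v (L *v v))" by (simp only: inner_transpose_vector)
  then show ?thesis using assms by simp
qed

lemma hat_eq_0:
  assumes "hat x = 0"
  shows "x = 0"
proof -
  have "Gi ** x ** Gi = L ** hat x ** transpose L"
    by (simp add: frame hat_def matrix_mul_assoc)
  then have "Gi ** x ** Gi = 0" using assms by simp
  then have 0: "G ** (Gi ** x ** Gi) ** G = 0" by simp
  have "Gi ** G = mat 1" by (rule iffD1[OF matrix_left_right_inverse inverse])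
  then have "x = (G ** Gi) ** x ** (Gi ** G)" by (simp add: inverse)
  also have "\<dots> = G ** (Gi ** x ** Gi) ** G" by (simp only: matrix_mul_assoc)
  finally show ?thesis by (simp only: 0)
qed

lemma mixed_square_nonneg:
  assumes "transpose e = e"
  shows "0 \<le> trace ((Gi ** e) ** (Gi ** e))"
  by (simp add: trace_hat2 trace_square_symmetric transpose_hat assms)

lemma mixed_square_eq_0:
  assumes "transpose e = e" "trace ((Gi ** e) ** (Gi ** e)) = 0"
  shows "e = 0"
  using assms by - (rule hat_eq_0, simp add: trace_hat2 trace_square_symmetric transpose_hat)

lemma mixed_trace_nonneg:
  assumes "\<And>v. 0 \<le> v \<bullet> (b *v v)"
  shows "0 \<le> trace (Gi ** b)"
proof -
  have "0 \<le> hat b $ i $ i" for i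
    using hat_psd[OF assms, of "axis i 1"]
    by (simp add: matrix_vector_mul_component inner_axis inner_axis' inner_commute)
  then show ?thesis unfolding trace_hat by (simp add: trace_def sum_nonneg)
qed

lemma mixed_psd_trace:
  assumes "transpose e = e" "\<And>v. 0 \<le> v \<bullet> (b *v v)"
  shows "0 \<le> trace ((Gi ** b) ** ((Gi ** e) ** (Gi ** e)))"
  unfolding trace_hat3 by (intro psd_trace_square_nonneg transpose_hat hat_psd assms)

lemma mixed_psd_bound:
  assumes "transpose e = e" "\<And>v. 0 \<le> v \<bullet> (b *v v)" "transpose b = b" "trace (Gi ** e) = 0"
  shows "(trace ((Gi ** b) ** (Gi ** e)))\<^sup>2 \<le> 2 / 3 * (trace (Gi ** b))\<^sup>2 * trace ((Gi ** e) ** (Gi ** e))"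
  unfolding trace_hat2 trace_hat
  by (intro psd_trace_bound transpose_hat hat_psd assms) (simp add: trace_hat[symmetric] assms)

end

lemma metric_frame_exists:
  fixes G Gi :: "real^3^3"
  assumes G: "transpose G = G" "\<And>v. v \<noteq> 0 \<Longrightarrow> 0 < v \<bullet> (G *v v)" and inv: "G ** Gi = mat 1"
  obtains L where "metric_frame G Gi L"
proof -
  have inv': "Gi ** G = mat 1" by (rule iffD1[OF matrix_left_right_inverse inv])
  have tG: "transpose Gi ** G = mat 1"
    using arg_cong[OF inv, of transpose] by (simp add: matrix_transpose_mul G)
  have "transpose Gi = transpose Gi ** (G ** Gi)" by (simp add: inv)
  also have "\<dots> = Gi" by (simp add: matrix_mul_assoc tG)
  finally have sym: "transpose Gi = Gi" .
  have pos: "0 < v \<bullet> (Gi *v v)" if "v \<noteq> 0" for v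
  proof -
    have v: "G *v (Gi *v v) = v" by (simp add: matrix_vector_mul_assoc inv)
    then have "Gi *v v \<noteq> 0" using that by auto
    from G(2)[OF this] show ?thesis by (simp add: v inner_commute)
  qed
  show thesis
  proof (rule cholesky_3[OF sym pos])
    fix L :: "real^3^3" assume "Gi = L ** transpose L"
    with inv show thesis by (rule that[OF metric_frame.intro])
  qed
qed

section \<open>Application to the expansion and electric tensors\<close>

context perfect_fluid_metric
begin

definition g_mat :: "real \<times> (real^3) \<Rightarrow> real^3^3" where "g_mat p = (\<chi> i j. g i j p)"
definition gi_mat :: "real \<times> (real^3) \<Rightarrow> real^3^3" where "gi_mat p = (\<chi> i j. gi i j p)"
definition dg_mat :: "real \<times> (real^3) \<Rightarrow> real^3^3" where "dg_mat p = (\<chi> i j. D None (g i j) p / 2)"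
definition elec_low :: "real \<times> (real^3) \<Rightarrow> real^3^3" where
  "elec_low p = (\<chi> i j. tidal_low i j p - (M p + 3 * P p) / 6 * g i j p)"

lemma expn_mat: "(\<chi> i j. expn i j p) = gi_mat p ** dg_mat p"
  by (simp add: vec_eq_iff expn_def gi_mat_def dg_mat_def matrix_matrix_mult_def sum_distrib_left)

lemma elec_mat:
  assumes "p \<in> A"
  shows "(\<chi> i j. elec i j p) = gi_mat p ** elec_low p"
proof -
  have "(\<Sum>m\<in>UNIV. gi i m p * (tidal_low m j p - (M p + 3 * P p) / 6 * g m j p)) = elec i j p" for i j
  proof -
    have "(\<Sum>m\<in>UNIV. gi i m p * (tidal_low m j p - (M p + 3 * P p) / 6 * g m j p)) =
       tidal i j p - (M p + 3 * P p) / 6 * (\<Sum>m\<in>UNIV. gi i m p * g m j p)"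
      unfolding tidal_def sum_distrib_left sum_subtractf[symmetric]
      by (intro sum.cong refl) (simp add: algebra_simps)
    then show ?thesis by (simp add: gi_g[OF assms] elec_def)
  qed
  then show ?thesis
    by (simp add: vec_eq_iff gi_mat_def elec_low_def matrix_matrix_mult_def)
qed

lemma g_gi_mat: "p \<in> A \<Longrightarrow> g_mat p ** gi_mat p = mat 1" "p \<in> A \<Longrightarrow> gi_mat p ** g_mat p = mat 1"
  by (simp_all add: vec_eq_iff g_mat_def gi_mat_def matrix_matrix_mult_def mat_def g_gi gi_g)

lemma transpose_mats:
  assumes "p \<in> A"
  shows "transpose (g_mat p) = g_mat p" "transpose (elec_low p) = elec_low p" "transpose (dg_mat p) = dg_mat p"
  using g_sym[OF assms] tidal_low_sym[OF assms] D_G_sym[OF assms, of None "Some _" "Some _", folded g_def]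
  by (simp_all add: vec_eq_iff transpose_def g_mat_def elec_low_def dg_mat_def)

lemma trace_mat: "(\<Sum>i\<in>UNIV. f i i) = trace (\<chi> i j. f i j)"
  by (simp add: trace_def)

lemma trace_mat2: "(\<Sum>i\<in>UNIV. \<Sum>j\<in>UNIV. f i j * h j i) = trace ((\<chi> i j. f i j) ** (\<chi> i j. h i j))"
  by (simp add: trace_def matrix_matrix_mult_def)

lemma trace_mat3: "(\<Sum>i\<in>UNIV. \<Sum>j\<in>UNIV. \<Sum>k\<in>UNIV. f i j * h j k * r k i) =
   trace ((\<chi> i j. f i j) ** ((\<chi> i j. h i j) ** (\<chi> i j. r i j)))"
  by (simp add: trace_def matrix_matrix_mult_def sum_distrib_left mult.assoc)

context
  fixes p
  assumes p: "p \<in> A" and pos: "\<And>v. v \<noteq> 0 \<Longrightarrow> 0 < v \<bullet> (g_mat p *v v)"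
begin

lemma elec_sq_nonneg: "0 \<le> elec_sq p"
proof -
  obtain L where "metric_frame (g_mat p) (gi_mat p) L"
    by (rule metric_frame_exists[OF transpose_mats(1)[OF p] pos g_gi_mat(1)[OF p]])
  then interpret metric_frame "g_mat p" "gi_mat p" L .
  show ?thesis
    unfolding elec_sq_def trace_mat2 elec_mat[OF p] by (rule mixed_square_nonneg[OF transpose_mats(2)[OF p]])
qed

lemma elec_sq_eq_0: "elec_sq p = 0 \<Longrightarrow> elec i j p = 0"
proof -
  assume 0: "elec_sq p = 0"
  obtain L where "metric_frame (g_mat p) (gi_mat p) L"
    by (rule metric_frame_exists[OF transpose_mats(1)[OF p] pos g_gi_mat(1)[OF p]])
  then interpret metric_frame "g_mat p" "gi_mat p" L .
  have "elec_low p = 0"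
    using 0 unfolding elec_sq_def trace_mat2 elec_mat[OF p]
    by (rule mixed_square_eq_0[OF transpose_mats(2)[OF p]])
  then have "(\<chi> i j. elec i j p) = 0" by (simp add: elec_mat[OF p])
  then show ?thesis by (simp add: vec_eq_iff)
qed

lemma expansion_nonneg:
  assumes "\<And>v. 0 \<le> v \<bullet> (dg_mat p *v v)"
  shows "0 \<le> expansion p"
proof -
  obtain L where "metric_frame (g_mat p) (gi_mat p) L"
    by (rule metric_frame_exists[OF transpose_mats(1)[OF p] pos g_gi_mat(1)[OF p]])
  then interpret metric_frame "g_mat p" "gi_mat p" L .
  show ?thesis
    unfolding trace_mat[of "\<lambda>i j. expn i j p"] expn_mat by (rule mixed_trace_nonneg[OF assms])
qed

text \<open>Split \<open>\<theta>\<close> into \<open>c\<close> times the identity and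
  \<open>b\<close>. In the term with \<open>E\<close> squared, the identity part changes the
  coefficient -4 into \<open>- 4 + 6 * al\<close>, and \<open>b\<close> adds something non-negative.
  In the term linear in \<open>E\<close>, the identity part vanishes with the trace, and
  \<open>mixed_psd_bound\<close> estimates the rest.\<close>

lemma elec_sq_decay:
  assumes al: "0 \<le> expansion p" "al \<le> 1 / 3"
    and exp: "\<And>v. al * expansion p * (v \<bullet> (g_mat p *v v)) \<le> v \<bullet> (dg_mat p *v v)"
  shows "- 2 * expansion p * ((2 - 3 * al) * elec_sq p)
      - \<bar>M p + P p\<bar> * (sqrt (2 / 3) * (1 - 3 * al) * expansion p * sqrt (elec_sq p)) \<le> D None elec_sq p"
proof -
  obtain L where "metric_frame (g_mat p) (gi_mat p) L"
    by (rule metric_frame_exists[OF transpose_mats(1)[OF p] pos g_gi_mat(1)[OF p]])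
  then interpret metric_frame "g_mat p" "gi_mat p" L .
  define E where "E = gi_mat p ** elec_low p"
  define c where "c = al * expansion p"
  define b where "b = dg_mat p - c *\<^sub>R g_mat p"
  have bs: "transpose b = b"
    using transpose_mats[OF p] by (simp add: b_def vec_eq_iff transpose_def)
  have bp: "0 \<le> v \<bullet> (b *v v)" for v
    using exp[of v] by (simp add: b_def c_def matrix_vector_mult_diff_rdistrib inner_diff_right
        scaleR_matrix_vector_assoc[symmetric])
  have gb: "gi_mat p ** dg_mat p = gi_mat p ** b + c *\<^sub>R mat 1"
    by (simp add: b_def matrix_diff_ldistrib matrix_scalar_ac scalar_matrix_assoc[symmetric] g_gi_mat(2)[OF p])
  have sq: "elec_sq p = trace (E ** E)"
    unfolding elec_sq_def trace_mat2 elec_mat[OF p] E_def ..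
  have trE: "trace E = 0"
    using elec_trace[OF p] unfolding trace_mat[of "\<lambda>i j. elec i j p"] elec_mat[OF p] E_def .
  have trb: "trace (gi_mat p ** b) = (1 - 3 * al) * expansion p"
  proof -
    have "expansion p = trace (gi_mat p ** b) + 3 * c"
      unfolding trace_mat[of "\<lambda>i j. expn i j p"] expn_mat gb by (simp add: trace_add trace_def mat_def sum.distrib)
    then show ?thesis by (simp add: c_def algebra_simps)
  qed
  have t3: "(\<Sum>i\<in>UNIV. \<Sum>j\<in>UNIV. \<Sum>k\<in>UNIV. expn i j p * elec j k p * elec k i p)
      = trace ((gi_mat p ** b) ** (E ** E)) + c * elec_sq p"
    unfolding trace_mat3 expn_mat elec_mat[OF p] gb sq E_def[symmetric]
    by (simp add: matrix_add_rdistrib trace_add scalar_matrix_assoc[symmetric] trace_def sum_distrib_left sum.distrib)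
  have t2: "(\<Sum>i\<in>UNIV. \<Sum>j\<in>UNIV. expn i j p * elec j i p) = trace ((gi_mat p ** b) ** E)"
    unfolding trace_mat2 expn_mat elec_mat[OF p] gb E_def[symmetric]
    using trE by (simp add: matrix_add_rdistrib trace_add scalar_matrix_assoc[symmetric] trace_def sum_distrib_left[symmetric] sum.distrib)
  have "0 \<le> trace ((gi_mat p ** b) ** (E ** E))"
    unfolding E_def by (rule mixed_psd_trace[OF transpose_mats(2)[OF p] bp])
  then have 3: "c * elec_sq p \<le> (\<Sum>i\<in>UNIV. \<Sum>j\<in>UNIV. \<Sum>k\<in>UNIV. expn i j p * elec j k p * elec k i p)"
    unfolding t3 by simp
  define s where "s = sqrt (2 / 3) * (1 - 3 * al) * expansion p * sqrt (elec_sq p)"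
  have "(trace ((gi_mat p ** b) ** E))\<^sup>2 \<le> 2 / 3 * ((1 - 3 * al) * expansion p)\<^sup>2 * elec_sq p"
    using mixed_psd_bound[OF transpose_mats(2)[OF p] bp bs trE[unfolded E_def]]
    unfolding E_def[symmetric] trb sq .
  also have "\<dots> = s\<^sup>2" using elec_sq_nonneg by (simp add: s_def power_mult_distrib)
  finally have "\<bar>trace ((gi_mat p ** b) ** E)\<bar> \<le> \<bar>s\<bar>" by (simp only: abs_le_square_iff)
  also have "\<bar>s\<bar> = s" using al elec_sq_nonneg by (simp add: s_def)
  finally have "\<bar>(M p + P p) * trace ((gi_mat p ** b) ** E)\<bar> \<le> \<bar>M p + P p\<bar> * s"
    unfolding abs_mult by (rule mult_left_mono) simp
  then have 2: "(M p + P p) * (\<Sum>i\<in>UNIV. \<Sum>j\<in>UNIV. expn i j p * elec j i p) \<le> \<bar>M p + P p\<bar> * s"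
    unfolding t2 by linarith
  have "- 2 * expansion p * ((2 - 3 * al) * elec_sq p) = - 4 * expansion p * elec_sq p + 6 * (c * elec_sq p)"
    by (simp add: c_def algebra_simps)
  then show ?thesis
    unfolding D_time_elec_sq[OF p] s_def[symmetric] using 2 3 by linarith
qed

end

end

section \<open>The differential inequality for the entropy\<close>

text \<open>For \<open>P = (k - 1) * M\<close> the matter part
  \<open>4 * M^2 + (M + 3 * P)^2\<close> of the Riemann norm is
  \<open>(4 + (3*k - 2)^2) * M^2\<close>, that is \<open>fluid_quad k * M^2\<close>.\<close>

abbreviation fluid_quad :: "real \<Rightarrow> real" where "fluid_quad k \<equiv> 9*k\<^sup>2 - 12*k + 8"

lemma fluid_quad_pos: "0 < fluid_quad k"
proof -
  have "fluid_quad k = (3 * k - 2)\<^sup>2 + 4" by (simp add: power2_eq_square algebra_simps)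
  then show ?thesis using zero_le_power2[of "3 * k - 2"] by linarith
qed

text \<open>This factor is the decay rate of \<open>fluid_quad k * M^2\<close> relative to
  \<open>- 2 * th\<close>. For \<open>k\<close> at least 2/3 both summands are non-negative; below,
  the entry 1 of the minimum suffices since \<open>6 - 9*k \<le> 3 * (4 - 3*k)\<close>.\<close>

lemma parameter_bounds_ratio:
  assumes "parameter_bounds k al k' al'" "0 \<le> k" "k \<le> 4/3" "0 \<le> al" "al \<le> 1/3"
  shows "0 \<le> k + (9*k - 6) * k' / fluid_quad k"
proof (cases "2/3 \<le> k")
  case True
  then show ?thesis
    using assms fluid_quad_pos[of k] by (intro add_nonneg_nonneg) (auto simp: parameter_bounds_def)
next
  case False
  let ?D = "fluid_quad k"
  have k: "0 < 4 - 3 * k" and D: "0 < ?D" using False fluid_quad_pos[of k] by auto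
  have k': "0 \<le> k'" using assms(1) by (simp add: parameter_bounds_def)
  have f: "(if al = 1/3 then 1 else min (9 * al' / (4 * (1 - 3*al))) 1) \<le> 1" by simp
  have "k' \<le> k * ?D / (3 * (4 - 3*k)) * (if al = 1/3 then 1 else min (9 * al' / (4 * (1 - 3*al))) 1)"
    using assms(1) k by (auto simp: parameter_bounds_def)
  also have "\<dots> \<le> k * ?D / (3 * (4 - 3*k)) * 1"
    by (rule mult_left_mono[OF f]) (use assms k D in auto)
  finally have "k' / ?D \<le> k / (3 * (4 - 3*k))"
    using D k by (simp add: field_simps)
  then have "(6 - 9*k) * (k' / ?D) \<le> (6 - 9*k) * (k / (3 * (4 - 3*k)))"
    using False by (intro mult_left_mono) auto
  also have "\<dots> = ((6 - 9*k) / (3 * (4 - 3*k))) * k" by simp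
  also have "\<dots> \<le> 1 * k"
    using k assms(2) by (intro mult_right_mono) (auto simp: field_simps)
  finally have "0 \<le> k + (9*k - 6) * (k' / ?D)" by (simp only: left_diff_distrib)
  then show ?thesis by simp
qed

text \<open>The sign condition for the derivative of the second summand of \<open>s_crit\<close>; it
  rests on the entry of the minimum that contains \<open>al'\<close>. In the cases of a zero
  denominator the left side vanishes.\<close>

lemma parameter_bounds_critical:
  assumes "parameter_bounds k al k' al'" "0 \<le> k" "k \<le> 4/3" "0 \<le> al" "al \<le> 1/3"
  shows "4 * k' * (1 - 3*al) * (4 - 3*k) / fluid_quad k \<le> 6 * k * al'"
proof (cases "k = 4/3 \<or> al = 1/3")
  case True
  then have "(1 - 3*al) * (4 - 3*k) = 0" by auto
  then have "4 * k' * (1 - 3*al) * (4 - 3*k) = 0" by simp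
  moreover have "0 \<le> 6 * k * al'" using assms by (simp add: parameter_bounds_def)
  ultimately show ?thesis by (simp only: div_0)
next
  case False
  let ?D = "fluid_quad k"
  have k: "0 < 4 - 3 * k" "0 < 1 - 3 * al" and D: "0 < ?D" and al': "0 \<le> al'"
    using False assms fluid_quad_pos[of k] by (auto simp: parameter_bounds_def)
  have f: "min (9 * al' / (4 * (1 - 3*al))) 1 \<le> 9 * al' / (4 * (1 - 3*al))" by simp
  have "k' \<le> k * ?D / (3 * (4 - 3*k)) * min (9 * al' / (4 * (1 - 3*al))) 1"
    using assms(1) False by (auto simp: parameter_bounds_def)
  also have "\<dots> \<le> k * ?D / (3 * (4 - 3*k)) * (9 * al' / (4 * (1 - 3*al)))"
    by (rule mult_left_mono[OF f]) (use assms k D in auto)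
  finally have "k' * (4 * (1 - 3*al) * (4 - 3*k) / ?D) \<le>
      k * ?D / (3 * (4 - 3*k)) * (9 * al' / (4 * (1 - 3*al))) * (4 * (1 - 3*al) * (4 - 3*k) / ?D)"
    by (rule mult_right_mono) (use k D in auto)
  also have "\<dots> = 3 * k * al'"
  proof -
    have "k * d / (3 * x) * (9 * al' / (4 * y)) * (4 * y * x / d) = 3 * k * al'"
      if "d > 0" "x > 0" "y > 0" for d x y :: real
      using that by (simp add: field_simps)
    from this[OF D k] show ?thesis .
  qed
  also have "\<dots> \<le> 6 * k * al'" using assms(2) al' by simp
  finally show ?thesis by (simp add: mult_ac)
qed

text \<open>The constant \<open>\<surd>2/4\<close> is not sharp; \<open>21/50\<close> is a rational number slightly above the critical
  point \<open>1/\<surd>6\<close> of the left-hand side.\<close>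

lemma cubic_bound:
  fixes u :: real
  assumes "0 \<le> u"
  shows "u - 2 * u^3 \<le> sqrt 2 / 4"
proof -
  have "0 \<le> (u - 21/50)\<^sup>2 * (u + 21/25)" using assms by simp
  also have "(u - 21/50)\<^sup>2 * (u + 21/25) = u^3 - 1323/2500 * u + 9261/62500"
    by (simp add: power2_eq_square power3_eq_cube field_simps)
  finally have "u - 2 * u^3 \<le> 7/20" using assms by linarith
  moreover have "7/5 \<le> sqrt 2" by (rule real_le_rsqrt) (simp add: power2_eq_square)
  ultimately show ?thesis by simp
qed

lemma has_real_derivative_sqrt:
  assumes "(f has_real_derivative f') (at t within S)" "0 < f t"
  shows "((\<lambda>s. sqrt (f s)) has_real_derivative inverse (sqrt (f t)) / 2 * f') (at t within S)"
  by (rule DERIV_chain'[OF assms(1) DERIV_real_sqrt[OF assms(2)]])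

text \<open>In terms of \<open>u = y / r\<close> the quotient rule gives
  \<open>d \<ge> - th * (1 + be) * (u - u^3) - th * c\<close>. The derivative of the volume supplies
  the additional \<open>th * u\<close>, which leaves a cubic in \<open>u\<close> to be bounded
  below. Here \<open>be\<close> will be \<open>1 - 3 * al\<close>.\<close>

lemma weyl_ratio_derivative:
  fixes Y q :: "real \<Rightarrow> real"
  assumes Y: "(Y has_real_derivative Y') (at t within S)" and q: "(q has_real_derivative - 2 * th * ka * q t) (at t within S)"
    and pos: "0 < Y t" "0 \<le> q t" "0 \<le> th" "0 \<le> ka" "0 \<le> be" "be \<le> 1" "0 \<le> c"
    and Y': "- 2 * th * (1 + be) * Y t - 2 * th * c * sqrt (q t) * sqrt (Y t) \<le> Y'"
  shows "\<exists>d. ((\<lambda>s. sqrt (Y s) / sqrt (Y s + q s)) has_real_derivative d) (at t within S) \<and>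
    - th * (be * (sqrt 2 / 4) + c) \<le> d + th * (sqrt (Y t) / sqrt (Y t + q t))"
proof -
  define y where "y = sqrt (Y t)"
  define z where "z = sqrt (q t)"
  define r where "r = sqrt (Y t + q t)"
  define u where "u = y / r"
  define d where "d = (Y' * q t + 2 * th * ka * q t * Y t) / (2 * y * r^3)"
  have y: "y > 0" "y^2 = Y t" and z: "z \<ge> 0" "z^2 = q t" and r: "r > 0" "r^2 = Y t + q t"
    using pos by (simp_all add: y_def z_def r_def)
  have D: "((\<lambda>s. sqrt (Y s) / sqrt (Y s + q s)) has_real_derivative d) (at t within S)"
  proof -
    have "((\<lambda>s. sqrt (Y s)) has_real_derivative inverse y / 2 * Y') (at t within S)"
      using has_real_derivative_sqrt[OF Y pos(1)] by (simp add: y_def)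
    moreover have "((\<lambda>s. sqrt (Y s + q s)) has_real_derivative inverse r / 2 * (Y' + - 2 * th * ka * q t)) (at t within S)"
      using has_real_derivative_sqrt[OF DERIV_add[OF Y q]] pos by (simp add: r_def)
    ultimately have "((\<lambda>s. sqrt (Y s) / sqrt (Y s + q s)) has_real_derivative
        ((inverse y / 2 * Y') * r - y * (inverse r / 2 * (Y' + - 2 * th * ka * q t))) / (r * r)) (at t within S)"
      unfolding y_def r_def by (rule DERIV_divide) (use pos in auto)
    moreover have "((inverse y / 2 * Y') * r - y * (inverse r / 2 * (Y' + - 2 * th * ka * q t))) / (r * r) =
      (Y' * r^2 - y^2 * (Y' + - 2 * th * ka * q t)) / (2 * y * r^3)"
      using y(1) r(1) by (simp add: field_simps power2_eq_square power3_eq_cube)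
    moreover have "Y' * r^2 - y^2 * (Y' + - 2 * th * ka * q t) = Y' * q t + 2 * th * ka * q t * Y t"
      unfolding r y by (simp add: algebra_simps)
    ultimately show ?thesis unfolding d_def by simp
  qed
  have u: "0 \<le> u" "u \<le> 1" using y r by (simp_all add: u_def y_def r_def pos)
  have zr: "z^3 \<le> r^3" using z r pos by (intro power_mono) (simp_all add: z_def r_def)
  have "- 2 * th * (1 + be) * y^2 - 2 * th * c * z * y \<le> Y'"
    unfolding y(2) unfolding y_def z_def by (rule Y')
  then have "(- 2 * th * (1 + be) * y^2 - 2 * th * c * z * y) * z^2 \<le> Y' * z^2"
    by (rule mult_right_mono) simp
  \<comment> \<open>The decay of \<open>q\<close> increases the ratio, because \<open>ka\<close> is
    non-negative.\<close>
  also have "\<dots> \<le> Y' * q t + 2 * th * ka * q t * Y t" using pos z by simp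
  finally have "(- 2 * th * (1 + be) * y^2 - 2 * th * c * z * y) * z^2 / (2 * y * r^3) \<le> d"
    unfolding d_def using y r by (intro divide_right_mono) auto
  also have "(- 2 * th * (1 + be) * y^2 - 2 * th * c * z * y) * z^2 / (2 * y * r^3) =
     - th * (1 + be) * (y * z^2 / r^3) - th * c * (z^3 / r^3)"
    using y(1) r(1) by (simp add: field_simps power2_eq_square power3_eq_cube)
  also have "y * z^2 / r^3 = u - u^3"
  proof -
    have z2: "z^2 = r^2 - y^2" using y z r by simp
    show ?thesis
      unfolding z2 u_def using r(1) by (simp add: field_simps power2_eq_square power3_eq_cube)
  qed
  finally have 1: "- th * (1 + be) * (u - u^3) - th * c * (z^3 / r^3) \<le> d" .
  have "th * c * (z^3 / r^3) \<le> th * c * 1"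
    using zr r pos by (intro mult_left_mono) (auto simp: divide_le_eq)
  then have "- th * (1 + be) * (u - u^3) - th * c \<le> d" using 1 by simp
  then have "th * (- be * u + (1 + be) * u^3 - c) \<le> d + th * u" by (simp add: algebra_simps)
  moreover have "- be * (sqrt 2 / 4) \<le> - be * u + (1 + be) * u^3"
  proof -
    have "be * (u - 2 * u^3) \<le> be * (sqrt 2 / 4)" using cubic_bound[OF u(1)] pos by (intro mult_left_mono) auto
    \<comment> \<open>\<open>be \<le> 1\<close> replaces \<open>1 + be\<close> by
      \<open>2 * be\<close>, so that \<open>be\<close> factors out and \<open>cubic_bound\<close>
      applies.\<close>
    moreover have "2 * be * u^3 \<le> (1 + be) * u^3" using pos u by (intro mult_right_mono) auto
    ultimately show ?thesis by (simp add: algebra_simps)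
  qed
  then have "th * (- be * (sqrt 2 / 4) - c) \<le> th * (- be * u + (1 + be) * u^3 - c)"
    using pos by (intro mult_left_mono) auto
  ultimately have "- th * (be * (sqrt 2 / 4) + c) \<le> d + th * u" by (simp add: algebra_simps)
  with D show ?thesis unfolding u_def y_def r_def by blast
qed

text \<open>\<open>ep\<close> is needed under the first root only: in the second summand of
  \<open>s_crit\<close> the root of \<open>1 - 3 * al\<close> occurs twice, which makes it a smooth
  function of \<open>k\<close> and \<open>al\<close>.\<close>

lemma critical_derivative:
  fixes k al :: "real \<Rightarrow> real"
  assumes k: "(k has_real_derivative - k' * th) (at t within S)" and al: "(al has_real_derivative - al' * th) (at t within S)"
    and range: "0 \<le> k t" "k t \<le> 4/3" "0 \<le> al t" "al t \<le> 1/3" and th: "0 \<le> th" and ep: "0 < ep"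
    and bounds: "parameter_bounds (k t) (al t) k' al'"
  shows "\<exists>d\<ge>0. ((\<lambda>s. sqrt (1 - 3 * al s + ep) * (sqrt 2 / 4) + 2 * k s * (1 - 3 * al s) / sqrt (fluid_quad (k s)))
     has_real_derivative d) (at t within S)"
proof -
  define D where "D = fluid_quad (k t)"
  define v where "v = sqrt (1 - 3 * al t + ep)"
  have D: "D > 0" and v: "v > 0" using fluid_quad_pos range ep by (simp_all add: D_def v_def)
  have b: "((\<lambda>s. 1 - 3 * al s) has_real_derivative 3 * al' * th) (at t within S)"
    by (rule derivative_eq_intros al refl)+ simp
  have b': "((\<lambda>s. 1 - 3 * al s + ep) has_real_derivative 3 * al' * th) (at t within S)"
    by (rule derivative_eq_intros al refl)+ simp
  have 1: "((\<lambda>s. sqrt (1 - 3 * al s + ep) * (sqrt 2 / 4)) has_real_derivative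
       inverse v / 2 * (3 * al' * th) * (sqrt 2 / 4)) (at t within S)"
    using DERIV_cmult_right[OF has_real_derivative_sqrt[OF b'], of "sqrt 2 / 4"] range ep by (simp add: v_def)
  have dD: "((\<lambda>s. fluid_quad (k s)) has_real_derivative (18 * k t - 12) * (- k' * th)) (at t within S)"
    by (rule derivative_eq_intros k refl)+ (simp add: algebra_simps)
  have 2: "((\<lambda>s. sqrt (fluid_quad (k s))) has_real_derivative inverse (sqrt D) / 2 * ((18 * k t - 12) * (- k' * th))) (at t within S)"
    using has_real_derivative_sqrt[OF dD] fluid_quad_pos by (simp add: D_def)
  have 3: "((\<lambda>s. 2 * k s * (1 - 3 * al s)) has_real_derivative
      2 * (- k' * th) * (1 - 3 * al t) + 2 * k t * (3 * al' * th)) (at t within S)"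
    by (rule derivative_eq_intros k b refl)+ simp
  define e where "e = th * (6 * k t * al' - 4 * k' * (1 - 3 * al t) * (4 - 3 * k t) / D) / sqrt D"
  have 4: "((\<lambda>s. 2 * k s * (1 - 3 * al s) / sqrt (fluid_quad (k s))) has_real_derivative e) (at t within S)"
  proof -
    have "((\<lambda>s. 2 * k s * (1 - 3 * al s) / sqrt (fluid_quad (k s))) has_real_derivative
       ((2 * (- k' * th) * (1 - 3 * al t) + 2 * k t * (3 * al' * th)) * sqrt D
        - 2 * k t * (1 - 3 * al t) * (inverse (sqrt D) / 2 * ((18 * k t - 12) * (- k' * th)))) / (sqrt D * sqrt D)) (at t within S)"
      using DERIV_divide[OF 3 2] fluid_quad_pos[of "k t"] by (simp add: D_def)
    moreover have "((2 * (- k' * th) * (1 - 3 * al t) + 2 * k t * (3 * al' * th)) * sqrt D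
        - 2 * k t * (1 - 3 * al t) * (inverse (sqrt D) / 2 * ((18 * k t - 12) * (- k' * th)))) / (sqrt D * sqrt D)
       = (th * (6 * k t * al' * D - 2 * k' * (1 - 3 * al t) * (D - k t * (9 * k t - 6))) / D) / sqrt D"
      (is "?l = ?r")
    proof -
      have "((2 * (- k' * th) * be + 2 * kk * (3 * al' * th)) * w
        - 2 * kk * be * (inverse w / 2 * ((18 * kk - 12) * (- k' * th)))) / (w * w)
       = (th * (6 * kk * al' * w^2 - 2 * k' * be * (w^2 - kk * (9 * kk - 6))) / w^2) / w"
        if "w > 0" for w be kk :: real
        using that by (simp add: field_simps power2_eq_square)
      from this[of "sqrt D"] D show ?thesis by simp
    qed
    moreover have "D - k t * (9 * k t - 6) = 2 * (4 - 3 * k t)"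
      by (simp add: D_def power2_eq_square algebra_simps)
    moreover have "th * (6 * k t * al' * D - 2 * k' * (1 - 3 * al t) * (2 * (4 - 3 * k t))) / D / sqrt D = e"
      using D by (simp add: e_def field_simps)
    ultimately show ?thesis by simp
  qed
  have "0 \<le> e"
    unfolding e_def using parameter_bounds_critical[OF bounds range] D th
    by (intro divide_nonneg_nonneg mult_nonneg_nonneg) (auto simp: D_def)
  moreover have "0 \<le> inverse v / 2 * (3 * al' * th) * (sqrt 2 / 4)"
    using v th bounds by (intro mult_nonneg_nonneg) (auto simp: parameter_bounds_def)
  ultimately show ?thesis using DERIV_add[OF 1 4] by (meson add_nonneg_nonneg)
qed

text \<open>Between \<open>a\<close> and \<open>b\<close> the derivative within \<open>S\<close> is
  two-sided; at the end points only continuity is used, so \<open>a\<close> may be the initial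
  time.\<close>

lemma nondecreasing_within:
  fixes f :: "real \<Rightarrow> real"
  assumes "a \<le> b" "{a..b} \<subseteq> S"
    and "\<And>t. t \<in> {a..b} \<Longrightarrow> \<exists>d\<ge>0. (f has_real_derivative d) (at t within S)"
  shows "f a \<le> f b"
proof (rule DERIV_nonneg_imp_increasing_open[OF assms(1)])
  show "\<exists>d. (f has_real_derivative d) (at x) \<and> 0 \<le> d" if "a < x" "x < b" for x
  proof -
    have "x \<in> {a..b}" using that by simp
    from assms(3)[OF this] obtain d where d: "0 \<le> d" "(f has_real_derivative d) (at x within S)" by blast
    have "x \<in> {a<..<b}" using that by simp
    moreover have "{a<..<b} \<subseteq> S" using assms(2) by auto
    ultimately have "x \<in> interior S" using interior_maximal[OF _ open_greaterThanLessThan] by blast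
    then have "at x within S = at x" by (rule at_within_interior)
    with d show ?thesis by auto
  qed
  show "continuous_on {a..b} f"
    unfolding continuous_on_eq_continuous_within
  proof
    fix x assume "x \<in> {a..b}"
    from assms(3)[OF this] obtain d where "(f has_real_derivative d) (at x within S)" by blast
    from DERIV_continuous[OF this] show "continuous (at x within {a..b}) f"
      by (rule continuous_within_subset[OF _ assms(2)])
  qed
qed

text \<open>The volume factor \<open>w\<close> grows at rate \<open>th\<close>, so the product rule
  adds \<open>th\<close> times the ratio and \<open>th\<close> times the critical term. The latter
  absorbs the lower bound of \<open>weyl_ratio_derivative\<close>, and the derivative of the
  critical term has the right sign by itself.\<close>

lemma regularised_entropy_derivative:
  fixes Y M k al w :: "real \<Rightarrow> real"
  assumes Y: "(Y has_real_derivative Y') (at t within S)"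
    and M: "(M has_real_derivative - th * (k t * M t)) (at t within S)"
    and k: "(k has_real_derivative - k' * th) (at t within S)"
    and al: "(al has_real_derivative - al' * th) (at t within S)"
    and w: "(w has_real_derivative th * w t) (at t within S)"
    and pos: "0 \<le> Y t" "0 \<le> th" "0 \<le> w t" "0 < ep"
    and range: "0 \<le> k t" "k t \<le> 4/3" "0 \<le> al t" "al t \<le> 1/3"
    and bounds: "parameter_bounds (k t) (al t) k' al'"
    and Y': "- 2 * th * ((2 - 3 * al t) * Y t)
      - \<bar>k t * M t\<bar> * (sqrt (2 / 3) * (1 - 3 * al t) * th * sqrt (Y t)) \<le> Y'"
  shows "\<exists>d\<ge>0. ((\<lambda>s. (sqrt (Y s + ep) / sqrt (Y s + ep + fluid_quad (k s) * (M s)\<^sup>2 / 24)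
      + (sqrt (1 - 3 * al s + ep) * (sqrt 2 / 4) + 2 * k s * (1 - 3 * al s) / sqrt (fluid_quad (k s)))) * w s)
      has_real_derivative d) (at t within S)"
proof -
  define D where "D = fluid_quad (k t)"
  define be where "be = 1 - 3 * al t"
  \<comment> \<open>Chosen so that \<open>2 * th * c * sqrt (q t) * sqrt (Y t)\<close> is the second
    term in the hypothesis on \<open>Y'\<close>; it is also the second summand of
    \<open>s_crit\<close>.\<close>
  define c where "c = 2 * k t * be / sqrt D"
  \<comment> \<open>The matter part \<open>fluid_quad k * M^2 / 3\<close> of the squared Riemann
    norm, divided by the 8 in front of \<open>Y\<close>.\<close>
  define q where "q s = fluid_quad (k s) * (M s)\<^sup>2 / 24" for s
  define ka where "ka = k t + (9 * k t - 6) * k' / D"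
  have D: "D > 0" using fluid_quad_pos by (simp add: D_def)
  have be: "0 \<le> be" "be \<le> 1" using range by (simp_all add: be_def)
  have c: "0 \<le> c" using range D be by (simp add: c_def)
  have ka: "0 \<le> ka" unfolding ka_def D_def by (rule parameter_bounds_ratio[OF bounds range])
  have q0: "0 \<le> q t" using D by (simp add: q_def D_def)
  have Yep: "((\<lambda>s. Y s + ep) has_real_derivative Y') (at t within S)"
    by (rule derivative_eq_intros Y refl)+ simp
  have dD: "((\<lambda>s. fluid_quad (k s)) has_real_derivative (18 * k t - 12) * (- k' * th)) (at t within S)"
    by (rule derivative_eq_intros k refl)+ (simp add: algebra_simps)
  have M2: "((\<lambda>s. (M s)\<^sup>2) has_real_derivative 2 * M t * (- th * (k t * M t))) (at t within S)"
    by (rule derivative_eq_intros M refl)+ simp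
  have "(q has_real_derivative ((18 * k t - 12) * (- k' * th) * (M t)\<^sup>2 + D * (2 * M t * (- th * (k t * M t)))) / 24)
      (at t within S)"
    using DERIV_cdivide[OF DERIV_mult[OF dD M2], of 24] by (simp add: q_def[abs_def] D_def mult.commute)
  also have "((18 * k t - 12) * (- k' * th) * (M t)\<^sup>2 + D * (2 * M t * (- th * (k t * M t)))) / 24 = - 2 * th * ka * q t"
  proof -
    have "((18 * x - 12) * (- k' * th) * m\<^sup>2 + d * (2 * m * (- th * (x * m)))) / 24 =
      - 2 * th * (x + (9 * x - 6) * k' / d) * (d * m\<^sup>2 / 24)" if "d > 0" for x m d
      using that by (simp add: power2_eq_square field_simps)
    from this[OF D] show ?thesis by (simp only: q_def ka_def D_def)
  qed
  finally have dq: "(q has_real_derivative - 2 * th * ka * q t) (at t within S)" .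
  have sq: "c * sqrt (q t) = k t * be * \<bar>M t\<bar> * (sqrt (2 / 3) / 2)"
  proof -
    have "sqrt 24 * sqrt (2 / 3) = sqrt (4\<^sup>2)" unfolding real_sqrt_mult[symmetric] by simp
    then have "sqrt 24 * sqrt (2 / 3) = 4" by (simp only: real_sqrt_abs abs_numeral)
    then have s: "2 / sqrt 24 = sqrt (2 / 3) / 2" by (simp add: field_simps)
    have "c * sqrt (q t) = k t * be * \<bar>M t\<bar> * (2 / sqrt 24)"
      using D by (simp add: c_def q_def D_def[symmetric] real_sqrt_mult real_sqrt_divide)
    then show ?thesis unfolding s .
  qed
  \<comment> \<open>Adding \<open>ep\<close> to \<open>Y\<close> only lowers the right side of the
    hypothesis on \<open>Y'\<close>, so the shifted function satisfies the same inequality.\<close>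
  have "- 2 * th * (1 + be) * (Y t + ep) - 2 * th * c * sqrt (q t) * sqrt (Y t + ep)
      \<le> - 2 * th * (1 + be) * Y t - 2 * th * c * sqrt (q t) * sqrt (Y t)"
  proof -
    have "th * (1 + be) * Y t \<le> th * (1 + be) * (Y t + ep)"
      using pos be by (intro mult_left_mono) auto
    moreover have "th * c * sqrt (q t) * sqrt (Y t) \<le> th * c * sqrt (q t) * sqrt (Y t + ep)"
      using pos c q0 by (intro mult_left_mono) auto
    ultimately show ?thesis by linarith
  qed
  also have "\<dots> = - 2 * th * ((2 - 3 * al t) * Y t)
      - \<bar>k t * M t\<bar> * (sqrt (2 / 3) * (1 - 3 * al t) * th * sqrt (Y t))"
  proof -
    have "2 * th * c * sqrt (q t) * sqrt (Y t) = 2 * th * (c * sqrt (q t)) * sqrt (Y t)" by simp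
    also have "\<dots> = \<bar>k t * M t\<bar> * (sqrt (2 / 3) * be * th * sqrt (Y t))"
      unfolding sq using range by (simp add: abs_mult)
    finally show ?thesis by (simp add: be_def algebra_simps)
  qed
  also have "\<dots> \<le> Y'" by (rule Y')
  finally have "\<exists>d. ((\<lambda>s. sqrt (Y s + ep) / sqrt (Y s + ep + q s)) has_real_derivative d) (at t within S) \<and>
    - th * (be * (sqrt 2 / 4) + c) \<le> d + th * (sqrt (Y t + ep) / sqrt (Y t + ep + q t))"
    using pos by (intro weyl_ratio_derivative[OF Yep dq _ q0 pos(2) ka be c]) auto
  then obtain d1 where d1: "((\<lambda>s. sqrt (Y s + ep) / sqrt (Y s + ep + q s)) has_real_derivative d1) (at t within S)"
    and d1': "- th * (be * (sqrt 2 / 4) + c) \<le> d1 + th * (sqrt (Y t + ep) / sqrt (Y t + ep + q t))" by blast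
  obtain d2 where "0 \<le> d2" and d2:
    "((\<lambda>s. sqrt (1 - 3 * al s + ep) * (sqrt 2 / 4) + 2 * k s * (1 - 3 * al s) / sqrt (fluid_quad (k s)))
     has_real_derivative d2) (at t within S)"
    using critical_derivative[OF k al range pos(2,4) bounds] by blast
  define s1 where "s1 = sqrt (Y t + ep) / sqrt (Y t + ep + q t)"
  define s2 where "s2 = sqrt (be + ep) * (sqrt 2 / 4) + c"
  \<comment> \<open>The estimate produces \<open>be\<close> where \<open>s_crit\<close> has its
    square root; for \<open>be\<close> in the unit interval the root is larger.\<close>
  have "be\<^sup>2 \<le> be + ep" using mult_left_mono[of be 1 be] be pos by (simp add: power2_eq_square)
  then have "be \<le> sqrt (be + ep)" by (rule real_le_rsqrt)
  then have "be * (sqrt 2 / 4) + c \<le> s2" unfolding s2_def by (intro add_right_mono mult_right_mono) auto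
  then have "th * (be * (sqrt 2 / 4) + c) \<le> th * s2" using pos by (intro mult_left_mono)
  with d1' \<open>0 \<le> d2\<close> have "0 \<le> d1 + d2 + th * (s1 + s2)" unfolding s1_def by (simp add: algebra_simps)
  then have "0 \<le> (d1 + d2 + th * (s1 + s2)) * w t" using pos by simp
  moreover have "(d1 + d2 + th * (s1 + s2)) * w t = (d1 + d2) * w t + (th * w t) * (s1 + s2)"
    by (simp add: algebra_simps)
  ultimately have nn: "0 \<le> (d1 + d2) * w t + (th * w t) * (s1 + s2)" by simp
  have "((\<lambda>s. (sqrt (Y s + ep) / sqrt (Y s + ep + q s)
      + (sqrt (1 - 3 * al s + ep) * (sqrt 2 / 4) + 2 * k s * (1 - 3 * al s) / sqrt (fluid_quad (k s)))) * w s)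
      has_real_derivative (d1 + d2) * w t + (th * w t) * (s1 + s2)) (at t within S)"
    using DERIV_mult[OF DERIV_add[OF d1 d2] w]
    by (simp add: s1_def s2_def be_def c_def D_def)
  with nn show ?thesis unfolding q_def by blast
qed

lemma entropy_nondecreasing:
  fixes Y Y' M k al w th k' al' :: "real \<Rightarrow> real"
  assumes "a \<le> b" "{a..b} \<subseteq> S"
    and Y: "\<And>t. t \<in> {a..b} \<Longrightarrow> (Y has_real_derivative Y' t) (at t within S)"
    and M: "\<And>t. t \<in> {a..b} \<Longrightarrow> (M has_real_derivative - th t * (k t * M t)) (at t within S)"
    and k: "\<And>t. t \<in> {a..b} \<Longrightarrow> (k has_real_derivative - k' t * th t) (at t within S)"
    and al: "\<And>t. t \<in> {a..b} \<Longrightarrow> (al has_real_derivative - al' t * th t) (at t within S)"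
    and w: "\<And>t. t \<in> {a..b} \<Longrightarrow> (w has_real_derivative th t * w t) (at t within S)"
    and pos: "\<And>t. t \<in> {a..b} \<Longrightarrow> 0 \<le> Y t \<and> 0 \<le> th t \<and> 0 \<le> w t"
    and range: "\<And>t. t \<in> {a..b} \<Longrightarrow> k t \<in> {0..4/3} \<and> al t \<in> {0..1/3}"
    and bounds: "\<And>t. t \<in> {a..b} \<Longrightarrow> parameter_bounds (k t) (al t) (k' t) (al' t)"
    and Y': "\<And>t. t \<in> {a..b} \<Longrightarrow> - 2 * th t * ((2 - 3 * al t) * Y t)
      - \<bar>k t * M t\<bar> * (sqrt (2 / 3) * (1 - 3 * al t) * th t * sqrt (Y t)) \<le> Y' t"
  defines "F \<equiv> \<lambda>t. ((if M t = 0 then 1 else sqrt (Y t) / sqrt (Y t + fluid_quad (k t) * (M t)\<^sup>2 / 24))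
      + s_crit (k t) (al t)) * w t"
  shows "F a \<le> F b"
proof -
  define Fe where "Fe ep s = (sqrt (Y s + ep) / sqrt (Y s + ep + fluid_quad (k s) * (M s)\<^sup>2 / 24)
      + (sqrt (1 - 3 * al s + ep) * (sqrt 2 / 4) + 2 * k s * (1 - 3 * al s) / sqrt (fluid_quad (k s)))) * w s" for ep s
  have mono: "Fe ep a \<le> Fe ep b" if "0 < ep" for ep
  proof (rule nondecreasing_within[OF assms(1,2)])
    fix t assume t: "t \<in> {a..b}"
    show "\<exists>d\<ge>0. (Fe ep has_real_derivative d) (at t within S)"
      unfolding Fe_def
      using pos[OF t] range[OF t] that
      by (intro regularised_entropy_derivative[OF Y[OF t] M[OF t] k[OF t] al[OF t] w[OF t]] bounds Y' t) auto
  qed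
  have lim: "((\<lambda>ep. Fe ep t) \<longlongrightarrow> F t) (at_right 0)" if t: "t \<in> {a..b}" for t
  proof -
    define q where "q = fluid_quad (k t) * (M t)\<^sup>2 / 24"
    have Yt: "0 \<le> Y t" using pos[OF t] by simp
    have r: "((\<lambda>ep. sqrt (Y t + ep) / sqrt (Y t + ep + q)) \<longlongrightarrow>
        (if M t = 0 then 1 else sqrt (Y t) / sqrt (Y t + q))) (at_right 0)"
    proof (cases "M t = 0")
      case True
      have "eventually (\<lambda>ep. sqrt (Y t + ep) / sqrt (Y t + ep + q) = 1) (at_right 0)"
        using Yt True by (auto simp: eventually_at_right_field q_def intro!: exI[of _ 1])
      then show ?thesis using True by (simp add: tendsto_eventually)
    next
      case False
      then have "0 < q" using fluid_quad_pos by (simp add: q_def)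
      with Yt have "sqrt (Y t + 0 + q) \<noteq> 0" by simp
      then have "((\<lambda>ep. sqrt (Y t + ep) / sqrt (Y t + ep + q)) \<longlongrightarrow>
        sqrt (Y t + 0) / sqrt (Y t + 0 + q)) (at_right 0)"
        by (intro tendsto_intros)
      then show ?thesis using False by simp
    qed
    have be: "0 \<le> 1 - 3 * al t" using range[OF t] by simp
    have "sqrt (1 - 3 * al t) * sqrt (1 - 3 * al t) = 1 - 3 * al t" using be by simp
    then have sc: "s_crit (k t) (al t) =
       sqrt (1 - 3 * al t + 0) * (sqrt 2 / 4) + 2 * k t * (1 - 3 * al t) / sqrt (fluid_quad (k t))"
      unfolding s_crit_def by (simp add: real_sqrt_divide algebra_simps)
    show ?thesis
      unfolding Fe_def F_def q_def[symmetric] sc by (intro tendsto_intros r)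
  qed
  have "eventually (\<lambda>ep. Fe ep a \<le> Fe ep b) (at_right 0)"
    using mono by (auto simp: eventually_at_right_field intro!: exI[of _ 1])
  then show ?thesis
    using assms(1) by (intro tendsto_le[OF _ lim lim]) auto
qed

section \<open>Spacetimes in a chart\<close>

lemma matrix_inv_eqI:
  fixes A B :: "real^'n^'n"
  assumes AB: "A ** B = mat 1"
  shows "matrix_inv A = B"
  unfolding matrix_inv_def
proof (rule someI2[of _ B])
  show "A ** B = mat 1 \<and> B ** A = mat 1"
    using AB iffD1[OF matrix_left_right_inverse AB] by simp
  fix C assume "A ** C = mat 1 \<and> C ** A = mat 1"
  then have CA: "C ** A = mat 1" by simp
  have "C = C ** (A ** B)" by (simp add: AB)
  also have "\<dots> = (C ** A) ** B" by (simp only: matrix_mul_assoc)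
  finally show "C = B" by (simp add: CA)
qed

lemma matrix_inv_mult:
  fixes A :: "real^'n^'n"
  assumes "det A \<noteq> 0"
  shows "A ** matrix_inv A = mat 1"
proof -
  have "invertible A" using assms by (simp add: invertible_det_nz)
  then obtain B where "A ** B = mat 1" by (auto simp: invertible_def)
  then show ?thesis using matrix_inv_eqI[of A B] by simp
qed

text \<open>Cramer's rule; it exhibits the entries of the inverse as quotients of determinants, from
  which smoothness follows.\<close>

lemma matrix_inv_entry:
  fixes A :: "real^'n^'n"
  assumes "det A \<noteq> 0"
  shows "matrix_inv A $ k $ l = det (\<chi> i j. if j = k then axis l 1 $ i else A $ i $ j) / det A"
proof -
  have "A *v (matrix_inv A *v axis l 1) = axis l 1"
    by (simp add: matrix_vector_mul_assoc matrix_inv_mult[OF assms])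
  then have "matrix_inv A *v axis l 1 = (\<chi> k. det (\<chi> i j. if j = k then axis l 1 $ i else A $ i $ j) / det A)"
    by (simp only: cramer[OF assms])
  moreover have "(matrix_inv A *v axis l 1) $ k = matrix_inv A $ k $ l"
    by (simp add: matrix_vector_mult_basis column_def)
  ultimately show ?thesis by simp
qed

lemma smooth_on_prod:
  fixes f :: "'j \<Rightarrow> 'a::euclidean_space \<Rightarrow> real"
  assumes "thick A" "finite J" "\<And>j. j \<in> J \<Longrightarrow> smooth_on A (f j)"
  shows "smooth_on A (\<lambda>p. \<Prod>j\<in>J. f j p)"
  using assms(2,3) by (induction J) (auto intro: smooth_on_const smooth_on_mult assms(1))

lemma smooth_on_det:
  fixes F :: "'a::euclidean_space \<Rightarrow> real^'n^'n"
  assumes "thick A" "\<And>i j. smooth_on A (\<lambda>p. F p $ i $ j)"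
  shows "smooth_on A (\<lambda>p. det (F p))"
  unfolding det_def
  by (intro smooth_on_sum smooth_on_mult smooth_on_const smooth_on_prod assms finite_permutations finite)

lemma smooth_on_matrix_inv:
  fixes F :: "'a::euclidean_space \<Rightarrow> real^'n^'n"
  assumes A: "thick A" and F: "\<And>i j. smooth_on A (\<lambda>p. F p $ i $ j)" and nz: "\<And>p. p \<in> A \<Longrightarrow> det (F p) \<noteq> 0"
  shows "smooth_on A (\<lambda>p. matrix_inv (F p) $ k $ l)"
proof -
  have "smooth_on A (\<lambda>p. det (\<chi> i j. if j = k then axis l 1 $ i else F p $ i $ j) * inverse (det (F p)))"
  proof (intro smooth_on_mult smooth_on_inverse smooth_on_det A F nz)
    fix i j
    show "smooth_on A (\<lambda>p. (\<chi> i j. if j = k then axis l 1 $ i else F p $ i $ j) $ i $ j)"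
      by (cases "j = k") (simp_all add: F smooth_on_const A)
  qed
  then show ?thesis
    by (rule iffD2[OF smooth_on_cong, rotated]) (simp add: matrix_inv_entry[OF nz] divide_inverse)
qed

text \<open>Jacobi's formula. Multiplication by the constant matrix \<open>B\<close> turns
  \<open>F\<close> into the identity at time \<open>t\<close>, where the derivative of the
  determinant is the trace.\<close>

lemma det_time_derivative:
  fixes F :: "real \<Rightarrow> real^3^3"
  assumes F: "\<And>i j. ((\<lambda>s. F s $ i $ j) has_real_derivative F' $ i $ j) (at t within S)"
    and inv: "B ** F t = mat 1"
  shows "((\<lambda>s. det (F s)) has_real_derivative det (F t) * trace (B ** F')) (at t within S)"
proof -
  define m where "m i j s = (\<Sum>l\<in>UNIV. B $ i $ l * F s $ l $ j)" for i j s
  have m: "(m i j has_real_derivative (B ** F') $ i $ j) (at t within S)" for i j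
    unfolding m_def matrix_matrix_mult_def
    by (auto intro!: DERIV_sum DERIV_cmult F)
  have m1: "m i j t = (if i = j then 1 else 0)" for i j
    using arg_cong[OF inv, of "\<lambda>M. M $ i $ j"] by (simp add: m_def matrix_matrix_mult_def mat_def)
  have "B ** F s = (\<chi> i j. m i j s)" for s
    by (simp add: m_def matrix_matrix_mult_def)
  then have d: "det B * det (F s) = det (\<chi> i j. m i j s)" for s
    by (simp add: det_mul[symmetric])
  have Bt: "det (F t) * det B = 1"
    using arg_cong[OF inv, of det] by (simp add: det_mul mult.commute)
  have "((\<lambda>s. det (\<chi> i j. m i j s)) has_real_derivative trace (B ** F')) (at t within S)"
    unfolding det_3 trace_def sum_3
    by (rule derivative_eq_intros m refl | simp)+ (simp add: m1)
  from DERIV_cmult[OF this, of "det (F t)"]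
  have "((\<lambda>s. det (F t) * (det B * det (F s))) has_real_derivative det (F t) * trace (B ** F')) (at t within S)"
    by (simp only: d)
  then show ?thesis by (simp only: mult.assoc[symmetric] Bt mult_1)
qed

section \<open>Products of a time set with an open set\<close>

lemma at_right_half_open:
  fixes S :: "real set"
  assumes "0 < e" "{t..<t + e} \<subseteq> S"
  shows "at t within S \<noteq> bot"
proof -
  have "t islimpt {t<..<t + e}" using assms(1) by (simp add: islimpt_greaterThanLessThan1)
  then have "t islimpt S" by (rule islimpt_subset) (use assms(2) in auto)
  then show ?thesis by (simp add: trivial_limit_within)
qed

text \<open>Holds also at time 0, since the right end of the time interval is never
  attained.\<close>

lemma time_interval_right_open:
  assumes "openin (top_of_set (time_interval X)) J" "t \<in> J"
  obtains e where "0 < e" "{t..<t + e} \<subseteq> J"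
proof -
  obtain W where W: "open W" "J = time_interval X \<inter> W" using assms(1) by (auto simp: openin_open)
  then obtain d where d: "0 < d" "ball t d \<subseteq> W" using assms(2) open_contains_ball by blast
  have t: "0 \<le> t" "ereal t < st_end X" using assms(2) W by (auto simp: time_interval_def)
  obtain r where r: "t < r" "ereal r < st_end X" using ereal_dense2[OF t(2)] by auto
  show thesis
  proof (rule that[of "min d (r - t)"])
    show "{t..<t + min d (r - t)} \<subseteq> J"
    proof
      fix s assume s: "s \<in> {t..<t + min d (r - t)}"
      then have "s \<in> ball t d" by (auto simp: dist_real_def)
      moreover have "ereal s < st_end X" using s r by (auto intro: less_trans[OF _ r(2)])
      ultimately show "s \<in> J" using s t d W by (auto simp: time_interval_def)
    qed
  qed (use d r in auto)
qed

lemma coord_dir_Basis: "coord_dir a \<in> Basis"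
  by (cases a) (auto simp: coord_dir_def Basis_prod_def axis_in_Basis_iff)

lemma Basis_coord_dir:
  assumes "b \<in> Basis"
  obtains a where "b = coord_dir a"
  using assms that[of None] that[of "Some _"]
  by (force simp: coord_dir_def Basis_prod_def Basis_vec_def)

text \<open>Every point, also one at time 0, is a limit of points with slightly later time, which
  are interior.\<close>

lemma thick_product:
  assumes J: "openin (top_of_set (time_interval X)) J" and V: "open V"
  shows "thick (J \<times> V :: (real \<times> (real^3)) set)"
  unfolding thick_def
proof (intro conjI ballI subsetI)
  fix p assume p: "p \<in> J \<times> V"
  obtain t y where ty: "p = (t, y)" "t \<in> J" "y \<in> V" using p by auto
  obtain e where e: "0 < e" "{t..<t + e} \<subseteq> J" using time_interval_right_open[OF J ty(2)] .
  have "{t<..<t + e} \<times> V \<subseteq> interior (J \<times> V)"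
    using e V by (intro interior_maximal) (auto intro: open_Times)
  moreover have "p \<in> closure ({t<..<t + e} \<times> V)"
    using e ty closure_subset[of V] by (auto simp: closure_Times)
  ultimately show "p \<in> closure (interior (J \<times> V))" using closure_mono by blast
next
  fix p b :: "real \<times> (real^3)" assume p: "p \<in> J \<times> V" and b: "b \<in> Basis"
  obtain t y where ty: "p = (t, y)" "t \<in> J" "y \<in> V" using p by auto
  obtain a where a: "b = coord_dir a" using Basis_coord_dir[OF b] .
  obtain e where "0 < e" "{0..<0 + e} \<subseteq> {s. p + s *\<^sub>R b \<in> J \<times> V}"
  proof (cases a)
    case None
    obtain e where e: "0 < e" "{t..<t + e} \<subseteq> J" using time_interval_right_open[OF J ty(2)] .
    have "{0..<0 + e} \<subseteq> {s. p + s *\<^sub>R b \<in> J \<times> V}"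
      using e(2) by (auto simp: a None coord_dir_def ty subset_iff)
    with e(1) show thesis by (rule that)
  next
    case (Some i)
    have "open ((\<lambda>s. y + s *\<^sub>R axis i 1) -` V)" by (intro open_vimage V continuous_intros)
    moreover have "0 \<in> (\<lambda>s. y + s *\<^sub>R axis i 1) -` V" using ty by simp
    ultimately obtain e where e: "0 < e" "ball 0 e \<subseteq> (\<lambda>s. y + s *\<^sub>R axis i 1) -` V"
      using open_contains_ball by blast
    have "{0..<0 + e} \<subseteq> {s. p + s *\<^sub>R b \<in> J \<times> V}"
      using e(2) by (auto simp: a Some coord_dir_def ty subset_iff)
    with e(1) show thesis by (rule that)
  qed
  then show "at 0 within {s. p + s *\<^sub>R b \<in> J \<times> V} \<noteq> bot" by (rule at_right_half_open)
qed

text \<open>One chart is fixed, while mass density and pressure remain functions on the manifold, as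
  they are chosen independently of the chart.\<close>

locale fluid_chart =
  fixes X :: "'m::{t2_space, second_countable_topology} spacetime"
    and I' :: "real set" and U :: "'m set" and c :: "'m chart"
    and M0 P0 :: "real \<Rightarrow> 'm \<Rightarrow> real"
  assumes agh: "almost_globally_hyperbolic X" and region: "is_region X I' U" and c: "c \<in> st_atlas X"
    and lapse_pos: "\<And>t x. t \<in> I' \<Longrightarrow> x \<in> U \<Longrightarrow> 0 < lapse X t x"
    and stress_time: "\<And>t x. t \<in> I' \<Longrightarrow> x \<in> U \<Longrightarrow> x \<in> chart_dom c \<Longrightarrow>
      stress X c t x $ None $ None / (lapse X t x)\<^sup>2 = M0 t x"
    and stress_mixed: "\<And>t x i. t \<in> I' \<Longrightarrow> x \<in> U \<Longrightarrow> x \<in> chart_dom c \<Longrightarrow>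
      stress X c t x $ None $ Some i / lapse X t x = 0"
    and stress_space: "\<And>t x i j. t \<in> I' \<Longrightarrow> x \<in> U \<Longrightarrow> x \<in> chart_dom c \<Longrightarrow>
      stress X c t x $ Some i $ Some j = P0 t x * slice_metric X c t x $ i $ j"
    and electric: "\<And>t x i j l. t \<in> I' \<Longrightarrow> x \<in> U \<Longrightarrow> x \<in> chart_dom c \<Longrightarrow>
      weyl X c (t, chart_map c x) None (Some i) (Some j) (Some l) / lapse X t x = 0"
begin

text \<open>The region in coordinates. It is open relative to \<open>region X c\<close> only,
  because \<open>I'\<close> may contain the initial time.\<close>

definition patch :: "(real \<times> (real^3)) set" where
  "patch = I' \<times> chart_map c ` (U \<inter> chart_dom c)"

lemma chart: "open (chart_dom c)" "open (chart_img c)"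
  "homeomorphism (chart_dom c) (chart_img c) (chart_map c) (chart_inv c)"
  using agh c by (auto simp: almost_globally_hyperbolic_def smooth_atlas_def)

lemma chart_inv_map: "x \<in> chart_dom c \<Longrightarrow> chart_inv c (chart_map c x) = x"
  using chart(3) by (rule homeomorphism_apply1)

lemma I'_open: "openin (top_of_set (time_interval X)) I'" and U_open: "open U"
  using region by (auto simp: is_region_def)

lemma patchE:
  assumes "p \<in> patch"
  obtains t x where "p = (t, chart_map c x)" "t \<in> I'" "x \<in> U" "x \<in> chart_dom c" "t \<in> time_interval X"
  using assms openin_imp_subset[OF I'_open] by (auto simp: patch_def)

lemma image_openin: "openin (top_of_set (chart_img c)) (chart_map c ` (U \<inter> chart_dom c))"
proof (rule homeomorphism_imp_open_map[OF chart(3)])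
  show "openin (top_of_set (chart_dom c)) (U \<inter> chart_dom c)"
    using openin_open_Int[OF U_open, of "chart_dom c"] by (simp add: Int_commute)
qed

lemma image_open: "open (chart_map c ` (U \<inter> chart_dom c))"
  by (rule openin_open_trans[OF image_openin chart(2)])

lemma patch_openin: "openin (top_of_set (region X c)) patch"
  unfolding patch_def region_def by (rule openin_Times[OF I'_open image_openin])

lemma thick_patch: "thick patch"
  unfolding patch_def by (rule thick_product[OF I'_open image_open])

lemma st_metric_simps:
  "block_metric ep X c (t, y) $ None $ None = ep * (lapse X t (chart_inv c y))\<^sup>2"
  "block_metric ep X c (t, y) $ None $ Some i = 0" "block_metric ep X c (t, y) $ Some i $ None = 0"
  "block_metric ep X c (t, y) $ Some i $ Some j = slice_metric X c t (chart_inv c y) $ i $ j"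
  by (simp_all add: block_metric_def Let_def)

lemma slice_sym:
  assumes "t \<in> time_interval X" "x \<in> chart_dom c"
  shows "transpose (slice_metric X c t x) = slice_metric X c t x"
  using agh c assms unfolding almost_globally_hyperbolic_def by blast

lemma slice_pos:
  assumes "t \<in> time_interval X" "x \<in> chart_dom c" "v \<noteq> 0"
  shows "0 < v \<bullet> (slice_metric X c t x *v v)"
  using agh c assms unfolding almost_globally_hyperbolic_def by blast

lemma stress_sym:
  assumes "t \<in> time_interval X" "x \<in> chart_dom c"
  shows "transpose (stress X c t x) = stress X c t x"
  using agh c assms unfolding almost_globally_hyperbolic_def by blast

lemma einstein:
  assumes "t \<in> time_interval X" "x \<in> chart_dom c" "0 < lapse X t x"
  shows "ricci X c (t, chart_map c x) a b
      - (1/2) * scalar_curv X c (t, chart_map c x) * st_metric X c (t, chart_map c x) $ a $ b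
     = stress X c t x $ a $ b"
  using agh c assms unfolding almost_globally_hyperbolic_def Let_def by blast

lemma smooth_metric: "smooth_on patch (\<lambda>p. st_metric X c p $ a $ b)"
  using agh c smooth_on_openin[OF patch_openin] unfolding almost_globally_hyperbolic_def by blast

lemma metric_sym:
  assumes "p \<in> patch"
  shows "st_metric X c p $ a $ b = st_metric X c p $ b $ a"
proof -
  obtain t x where p: "p = (t, chart_map c x)" "x \<in> chart_dom c" "t \<in> time_interval X"
    using assms by (rule patchE)
  show ?thesis
    using symmetric_matrix_component[OF slice_sym[OF p(3,2)]]
    by (cases a; cases b) (simp_all add: p(1) st_metric_simps chart_inv_map p(2))
qed

text \<open>The kernel is trivial: the block form separates the components, the positive lapse
  removes the time component and the definite slice metric the others.\<close>

lemma metric_det: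
  assumes "p \<in> patch"
  shows "det (st_metric X c p) \<noteq> 0"
proof -
  obtain t x where p: "p = (t, chart_map c x)" "t \<in> I'" "x \<in> U" "x \<in> chart_dom c" "t \<in> time_interval X"
    using assms by (rule patchE)
  have "v = 0" if v: "st_metric X c p *v v = 0" for v
  proof -
    have 0: "(\<Sum>b\<in>UNIV. st_metric X c p $ a $ b * v $ b) = 0" for a
      using arg_cong[OF v, of "\<lambda>w. w $ a"] by (simp add: matrix_vector_mult_def)
    have n: "v $ None = 0"
      using 0[of None] lapse_pos[OF p(2,3)] by (simp add: sum_option p(1) st_metric_simps chart_inv_map p(4))
    define w :: "real^3" where "w = (\<chi> j. v $ Some j)"
    have "slice_metric X c t x *v w = 0"
      using 0[of "Some _"]
      by (simp add: vec_eq_iff matrix_vector_mult_def w_def sum_option p(1) st_metric_simps chart_inv_map p(4) n)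
    then have "w = 0" using slice_pos[OF p(5,4), of w] by (cases "w = 0") auto
    then have "v $ Some j = 0" for j by (simp add: w_def vec_eq_iff)
    with n show ?thesis by (simp add: vec_eq_iff split_option_all)
  qed
  then have "\<exists>B. B ** st_metric X c p = mat 1" by (simp add: matrix_left_invertible_ker)
  then show ?thesis by (simp add: invertible_left_inverse[symmetric] invertible_det_nz)
qed

lemma metric_inv_mult:
  assumes "p \<in> patch"
  shows "(\<Sum>e\<in>UNIV. st_metric X c p $ a $ e * matrix_inv (st_metric X c p) $ e $ b) = (if a = b then 1 else 0)"
  using arg_cong[OF matrix_inv_mult[OF metric_det[OF assms]], of "\<lambda>M. M $ a $ b"]
  by (simp add: matrix_matrix_mult_def mat_def)

lemma metric_inv_sym:
  assumes "p \<in> patch"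
  shows "matrix_inv (st_metric X c p) $ a $ b = matrix_inv (st_metric X c p) $ b $ a"
proof (rule symmetric_matrix_component)
  let ?A = "st_metric X c p"
  have t: "transpose ?A = ?A" using metric_sym[OF assms] by (simp add: vec_eq_iff transpose_def)
  have "matrix_inv ?A ** ?A = mat 1"
    by (rule iffD1[OF matrix_left_right_inverse matrix_inv_mult[OF metric_det[OF assms]]])
  then have "?A ** transpose (matrix_inv ?A) = mat 1"
    using matrix_transpose_mul[of "matrix_inv ?A" ?A] by (simp add: t)
  then show "transpose (matrix_inv ?A) = matrix_inv ?A" by (rule matrix_inv_eqI[symmetric])
qed

sublocale coordinate_metric patch coord_dir
  "\<lambda>a b p. st_metric X c p $ a $ b" "\<lambda>a b p. matrix_inv (st_metric X c p) $ a $ b"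
  by unfold_locales
    (rule thick_patch coord_dir_Basis smooth_metric metric_sym metric_inv_sym metric_inv_mult
      smooth_on_matrix_inv[OF thick_patch smooth_metric metric_det] | assumption)+

lemma pd_eq: "p \<in> patch \<Longrightarrow> pd X c a f p = D a f p"
  unfolding pd_def D_def by (rule partial_on_subset_eq[OF patch_openin, symmetric])

lemma christoffel_eq:
  assumes "p \<in> patch"
  shows "christoffel X c a b e p = Chr a b e p"
  unfolding christoffel_def Chr_def Chr1_def
  by (simp add: pd_eq[OF assms] sum_distrib_left mult.left_commute)

lemma pd_christoffel: "p \<in> patch \<Longrightarrow> pd X c d (christoffel X c a b e) p = D d (Chr a b e) p"
  by (simp add: pd_eq D_cong[OF christoffel_eq])

lemma riemann_up_eq: "p \<in> patch \<Longrightarrow> riemann_up X c p a b d e = Riem a b d e p"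
  by (simp add: riemann_up_def Riem_def pd_christoffel christoffel_eq)

lemma riemann_eq: "p \<in> patch \<Longrightarrow> riemann X c p a b d e = Riem_low a b d e p"
  by (simp add: riemann_def Riem_low_def riemann_up_eq)

lemma ricci_eq: "p \<in> patch \<Longrightarrow> ricci X c p a b = Ric a b p"
  by (simp add: ricci_def Ric_def riemann_up_eq)

lemma scalar_curv_eq: "p \<in> patch \<Longrightarrow> scalar_curv X c p = scal p"
  by (simp add: scalar_curv_def scal_def ricci_eq)

lemma weyl_eq: "p \<in> patch \<Longrightarrow> weyl X c p a b d e = Weyl a b d e p"
  by (simp add: weyl_def Weyl_def riemann_eq ricci_eq scalar_curv_eq Let_def)

definition M_fun :: "real \<times> (real^3) \<Rightarrow> real" where "M_fun p = M0 (fst p) (chart_inv c (snd p))"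
definition P_fun :: "real \<times> (real^3) \<Rightarrow> real" where "P_fun p = P0 (fst p) (chart_inv c (snd p))"

sublocale perfect_fluid_metric patch
  "\<lambda>a b p. st_metric X c p $ a $ b" "\<lambda>a b p. matrix_inv (st_metric X c p) $ a $ b" M_fun P_fun
proof
  fix p assume "p \<in> patch"
  note pd = this
  obtain t x where p: "p = (t, chart_map c x)" and tx: "t \<in> I'" "x \<in> U" "x \<in> chart_dom c" "t \<in> time_interval X"
    using pd by (rule patchE)
  note simps = p st_metric_simps chart_inv_map[OF tx(3)] M_fun_def P_fun_def
  have N: "0 < lapse X t x" by (rule lapse_pos[OF tx(1,2)])
  have E: "Ric a b p - (1/2) * scal p * st_metric X c p $ a $ b = stress X c t x $ a $ b" for a b
    using einstein[OF tx(4,3) N] ricci_eq[OF pd] scalar_curv_eq[OF pd] by (simp add: p)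
  have mixed: "stress X c t x $ None $ Some i = 0" for i
    using stress_mixed[OF tx(1-3), of i] N by simp
  show "st_metric X c p $ None $ Some i = 0" for i by (simp add: simps)
  show "st_metric X c p $ None $ None < 0" using N by (simp add: simps)
  show "Ric None None p - (1/2) * scal p * st_metric X c p $ None $ None = - M_fun p * st_metric X c p $ None $ None"
    unfolding E using stress_time[OF tx(1-3)] N by (simp add: simps field_simps)
  show "Ric None (Some i) p - (1/2) * scal p * st_metric X c p $ None $ Some i = 0" for i
    unfolding E by (rule mixed)
  show "Ric (Some i) None p - (1/2) * scal p * st_metric X c p $ Some i $ None = 0" for i
    unfolding E using mixed[of i] symmetric_matrix_component[OF stress_sym[OF tx(4,3)], of None "Some i"] by simp
  show "Ric (Some i) (Some j) p - (1/2) * scal p * st_metric X c p $ Some i $ Some j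
     = P_fun p * st_metric X c p $ Some i $ Some j" for i j
    unfolding E stress_space[OF tx(1-3)] by (simp add: simps)
  show "Weyl None (Some i) (Some j) (Some l) p = 0" for i j l
    using electric[OF tx(1-3), of i j l] N weyl_eq[OF pd] by (simp add: p)
qed

text \<open>Shifts the directional derivative from parameter 0 to time \<open>t\<close>, and uses
  relative openness to pass from \<open>patch\<close> to the full time interval.\<close>

lemma has_time_derivative:
  assumes f: "smooth_on patch f" and p: "(t, y) \<in> patch"
  shows "((\<lambda>s. f (s, y)) has_real_derivative D None f (t, y)) (at t within time_interval X)"
proof -
  have y: "y \<in> chart_img c" using p by (auto simp: patch_def)
  have "((\<lambda>s. f ((t, y) + s *\<^sub>R coord_dir None)) has_vector_derivative D None f (t, y))
      (at 0 within {s. (t, y) + s *\<^sub>R coord_dir None \<in> patch})"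
    unfolding D_def by (rule partial_on_has_vector_derivative[OF smooth_on_partial_exists[OF f coord_dir_Basis] p])
  moreover have "{s. (t, y) + s *\<^sub>R coord_dir None \<in> region X c} = {s. t + s \<in> time_interval X}"
    using y by (simp add: coord_dir_def region_def)
  ultimately have "((\<lambda>s. f (t + s, y)) has_real_derivative D None f (t, y)) (at 0 within {s. t + s \<in> time_interval X})"
    unfolding partial_on_openin[OF patch_openin p] has_real_derivative_iff_has_vector_derivative
    by (simp add: coord_dir_def)
  moreover have "(+) t ` {s. t + s \<in> time_interval X} = time_interval X"
  proof (intro equalityI subsetI)
    fix r assume "r \<in> time_interval X"
    then show "r \<in> (+) t ` {s. t + s \<in> time_interval X}" by (intro image_eqI[of _ _ "r - t"]) auto
  qed auto
  ultimately show ?thesis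
    using DERIV_at_within_shift[of "\<lambda>s. f (s, y)" "D None f (t, y)" t 0 "{s. t + s \<in> time_interval X}"] by simp
qed

lemma time_limit_point: "t \<in> I' \<Longrightarrow> at t within time_interval X \<noteq> bot"
  using time_interval_right_open[OF I'_open] at_right_half_open openin_imp_subset[OF I'_open] by (metis order_trans)

lemma D_T_eq:
  assumes "t \<in> I'" "((\<lambda>s. u s x) has_real_derivative d) (at t within time_interval X)"
  shows "D_T X u t x = d / lapse X t x"
proof -
  have "vector_derivative (\<lambda>s. u s x) (at t within time_interval X) = d"
    using assms(2)
    by (intro vector_derivative_within[OF time_limit_point[OF assms(1)]])
      (simp add: has_real_derivative_iff_has_vector_derivative)
  then show ?thesis by (simp add: D_T_def)
qed

section \<open>Slice geometry and Weyl ratio at a point of the region\<close>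

context
  fixes t x
  assumes tx: "t \<in> I'" "x \<in> U" "x \<in> chart_dom c"
begin

abbreviation (input) pt :: "real \<times> (real^3)" where "pt \<equiv> (t, chart_map c x)"

lemma pt_patch: "pt \<in> patch" and t_time: "t \<in> time_interval X"
  using tx openin_imp_subset[OF I'_open] by (auto simp: patch_def)

lemma N_pos: "0 < lapse X t x"
  by (rule lapse_pos[OF tx(1,2)])

lemma g_mat_eq: "g_mat pt = slice_metric X c t x"
  by (simp add: g_mat_def g_def st_metric_simps chart_inv_map[OF tx(3)] vec_eq_iff)

lemma slice_inv: "matrix_inv (slice_metric X c t x) = gi_mat pt"
  using matrix_inv_eqI[OF g_gi_mat(1)[OF pt_patch]] by (simp add: g_mat_eq)

lemma slice_derivative:
  "((\<lambda>s. slice_metric X c s x $ i $ j) has_real_derivative D None (g i j) pt) (at t within time_interval X)"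
  using has_time_derivative[OF smooth_g pt_patch, of i j]
  by (simp add: g_def st_metric_simps chart_inv_map[OF tx(3)])

lemma second_ff_eq: "second_ff X c t x = (- 1 / lapse X t x) *\<^sub>R dg_mat pt"
proof -
  have "D_T X (\<lambda>s y. slice_metric X c s y $ i $ j) t x = D None (g i j) pt / lapse X t x" for i j
    by (rule D_T_eq[OF tx(1)]) (rule slice_derivative)
  then show ?thesis by (simp add: second_ff_def dg_mat_def vec_eq_iff)
qed

lemma mean_curv_eq: "mean_curv X c t x = - expansion pt / lapse X t x"
proof -
  have s: "dg_mat pt $ i $ j = dg_mat pt $ j $ i" for i j
    by (rule symmetric_matrix_component[OF transpose_mats(3)[OF pt_patch]])
  have "expansion pt = (\<Sum>i\<in>UNIV. \<Sum>j\<in>UNIV. gi_mat pt $ i $ j * dg_mat pt $ j $ i)"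
    unfolding trace_mat[of "\<lambda>i j. expn i j pt"] expn_mat by (simp add: trace_def matrix_matrix_mult_def)
  then have e: "expansion pt = (\<Sum>i\<in>UNIV. \<Sum>j\<in>UNIV. gi_mat pt $ i $ j * dg_mat pt $ i $ j)"
    by (simp only: s)
  show ?thesis
    unfolding mean_curv_def slice_inv second_ff_eq e
    by (simp add: sum_divide_distrib sum_negf)
qed

lemma g_mat_pos: "v \<noteq> 0 \<Longrightarrow> 0 < v \<bullet> (g_mat pt *v v)"
  unfolding g_mat_eq by (rule slice_pos[OF t_time tx(3)])

text \<open>The inverse metric has the form \<open>L ** transpose L\<close>, so its determinant is a
  square.\<close>

lemma slice_det_pos: "0 < det (slice_metric X c t x)"
proof -
  obtain L where "metric_frame (g_mat pt) (gi_mat pt) L"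
    by (rule metric_frame_exists[OF transpose_mats(1)[OF pt_patch] g_mat_pos g_gi_mat(1)[OF pt_patch]])
  then have "gi_mat pt = L ** transpose L" by (simp add: metric_frame_def)
  then have "0 \<le> det (gi_mat pt)" by (simp add: det_mul)
  moreover have "det (g_mat pt) * det (gi_mat pt) = 1"
    using arg_cong[OF g_gi_mat(1)[OF pt_patch], of det] by (simp add: det_mul)
  ultimately have "0 < det (g_mat pt)" by (metis mult_nonpos_nonneg not_less not_one_le_zero)
  then show ?thesis by (simp add: g_mat_eq)
qed

lemma sqrt_det_derivative:
  "((\<lambda>s. sqrt_det X c s x) has_real_derivative expansion pt * sqrt_det X c t x) (at t within time_interval X)"
proof -
  have inv: "gi_mat pt ** slice_metric X c t x = mat 1"
    using g_gi_mat(2)[OF pt_patch] by (simp add: g_mat_eq)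
  have "((\<lambda>s. slice_metric X c s x $ i $ j) has_real_derivative (2 *\<^sub>R dg_mat pt) $ i $ j) (at t within time_interval X)"
    for i j using slice_derivative by (simp add: dg_mat_def)
  from det_time_derivative[OF this inv]
  have "((\<lambda>s. det (slice_metric X c s x)) has_real_derivative
      det (slice_metric X c t x) * (2 * expansion pt)) (at t within time_interval X)"
    unfolding trace_mat[of "\<lambda>i j. expn i j pt"] expn_mat
    by (simp add: matrix_scalar_ac scalar_matrix_assoc[symmetric] trace_def sum_distrib_left)
  from has_real_derivative_sqrt[OF this slice_det_pos]
  have "((\<lambda>s. sqrt_det X c s x) has_real_derivative
      inverse (sqrt_det X c t x) / 2 * (det (slice_metric X c t x) * (2 * expansion pt))) (at t within time_interval X)"
    by (simp add: sqrt_det_def)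
  moreover have "det (slice_metric X c t x) = sqrt_det X c t x * sqrt_det X c t x"
    using slice_det_pos by (simp add: sqrt_det_def)
  moreover have "0 < sqrt_det X c t x" using slice_det_pos by (simp add: sqrt_det_def)
  ultimately show ?thesis by (simp add: field_simps)
qed

lemma norm4_eq: "norm4 (riem_metric X c pt) T = sqrt (sq_norm T (riem_Gi pt))"
proof -
  have l: "lapse2 pt = (lapse X t x)\<^sup>2"
    by (simp add: lapse2_def st_metric_simps chart_inv_map[OF tx(3)])
  have "riem_metric X c pt ** (\<chi> a b. riem_Gi pt a b) = mat 1"
  proof -
    have "(\<Sum>e\<in>UNIV. riem_metric X c pt $ a $ e * riem_Gi pt e b) = (if a = b then 1 else 0)" for a b
      using N_pos g_gi[OF pt_patch]
      by (cases a; cases b)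
        (simp_all add: sum_option riem_Gi_simps[OF pt_patch] st_metric_simps chart_inv_map[OF tx(3)] l g_def)
    then show ?thesis by (simp add: vec_eq_iff matrix_matrix_mult_def mat_def)
  qed
  then show ?thesis
    by (simp add: norm4_def Let_def sq_norm_def matrix_inv_eqI)
qed

lemma weyl_ratio_eq:
  assumes P: "P0 t x = (k - 1) * M0 t x"
  shows "weyl_ratio X c t x = (if M0 t x = 0 then 1
    else sqrt (elec_sq pt) / sqrt (elec_sq pt + fluid_quad k * (M0 t x)\<^sup>2 / 24))"
proof -
  let ?W = "weyl X c pt" and ?R = "riemann X c pt"
  have M: "M_fun pt = M0 t x" "P_fun pt = P0 t x"
    by (simp_all add: M_fun_def P_fun_def chart_inv_map[OF tx(3)])
  have "?W = (\<lambda>a b d e. Weyl a b d e pt)" "?R = (\<lambda>a b d e. Riem_low a b d e pt)"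
    by (simp_all add: fun_eq_iff weyl_eq[OF pt_patch] riemann_eq[OF pt_patch])
  then have nW: "sq_norm ?W (riem_Gi pt) = 8 * elec_sq pt"
    and nR: "sq_norm ?R (riem_Gi pt) = 8 * (elec_sq pt + fluid_quad k * (M0 t x)\<^sup>2 / 24)"
    by (simp_all add: sq_norm_Weyl[OF pt_patch] sq_norm_Riem[OF pt_patch] M P power2_eq_square field_simps)
  have nonneg: "0 \<le> elec_sq pt" by (rule elec_sq_nonneg[OF pt_patch g_mat_pos])
  show ?thesis
  proof (cases "M0 t x = 0")
    case True
    then have vac: "M_fun pt = 0" "P_fun pt = 0" by (simp_all add: M P)
    have WR: "?W = ?R"
      by (simp add: fun_eq_iff weyl_eq[OF pt_patch] riemann_eq[OF pt_patch] Weyl_vacuum[OF pt_patch vac])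
    \<comment> \<open>In vacuum the ratio is a number divided by itself; as
      \<open>0 / 0 = 0\<close>, it equals 1 only once the norm is known to be non-zero.\<close>
    have "elec_sq pt \<noteq> 0" if "\<not> (\<forall>a b d e. ?R a b d e = 0)"
    proof
      assume "elec_sq pt = 0"
      then have "elec i j pt = 0" for i j using elec_sq_eq_0[OF pt_patch g_mat_pos] by blast
      then have "\<forall>a b d e. ?R a b d e = 0"
        by (simp add: riemann_eq[OF pt_patch] Riem_low_eq_0[OF pt_patch vac])
      with that show False by blast
    qed
    then show ?thesis
      using True by (auto simp: weyl_ratio_def Let_def WR norm4_eq nR)
  next
    case False
    have pos: "0 < fluid_quad k * (M0 t x)\<^sup>2 / 24" using False fluid_quad_pos by simp
    have "\<not> (\<forall>a b d e. ?R a b d e = 0)"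
    proof
      assume "\<forall>a b d e. ?R a b d e = 0"
      then have "sq_norm ?R (riem_Gi pt) = 0" by (simp add: sq_norm_def)
      then have "elec_sq pt + fluid_quad k * (M0 t x)\<^sup>2 / 24 = 0"
        unfolding nR by (simp only: mult_eq_0_iff) simp
      then show False using add_nonneg_pos[OF nonneg pos] by simp
    qed
    then have "weyl_ratio X c t x =
        sqrt (8 * elec_sq pt) / sqrt (8 * (elec_sq pt + fluid_quad k * (M0 t x)\<^sup>2 / 24))"
      unfolding weyl_ratio_def Let_def norm4_eq nR nW by (rule if_not_P)
    then show ?thesis using False by (simp only: real_sqrt_mult if_False) simp
  qed
qed

text \<open>Since \<open>H\<close> is \<open>- expansion / N\<close>, the lapse cancels in
  \<open>D_T u = u' H\<close>. At points with \<open>H = 0\<close> the second assumption says that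
  \<open>u\<close> is stationary.\<close>

lemma H_deriv_derivative:
  assumes "(\<lambda>s. u s x) differentiable (at t within time_interval X)"
    and "D_T X u t x = H_deriv X c u t x * mean_curv X c t x"
  shows "((\<lambda>s. u s x) has_real_derivative - H_deriv X c u t x * expansion pt) (at t within time_interval X)"
proof -
  have d: "((\<lambda>s. u s x) has_real_derivative vector_derivative (\<lambda>s. u s x) (at t within time_interval X))
      (at t within time_interval X)"
    using assms(1) by (simp add: vector_derivative_works has_real_derivative_iff_has_vector_derivative)
  have "vector_derivative (\<lambda>s. u s x) (at t within time_interval X) = - H_deriv X c u t x * expansion pt"
    using assms(2) N_pos unfolding D_T_def mean_curv_eq by (simp add: field_simps)
  with d show ?thesis by simp
qed

text \<open>The two inequalities chained make \<open>dg_mat\<close> positive semidefinite, and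
  therefore its trace non-negative, even where \<open>al\<close> is zero.\<close>

lemma expanding_expansion:
  assumes "expanding X al I' U"
  shows "0 \<le> expansion pt"
    "al t x * expansion pt * (v \<bullet> (g_mat pt *v v)) \<le> v \<bullet> (dg_mat pt *v v)"
proof -
  have e: "v \<bullet> (second_ff X c t x *v v) \<le> al t x * mean_curv X c t x * (v \<bullet> (slice_metric X c t x *v v))"
    "al t x * mean_curv X c t x * (v \<bullet> (slice_metric X c t x *v v)) \<le> 0" for v
    using assms tx c unfolding expanding_def by blast+
  have H: "al t x * mean_curv X c t x * r = - (al t x * expansion pt * r) / lapse X t x" for r
    by (simp add: mean_curv_eq)
  have h: "v \<bullet> (second_ff X c t x *v v) = - (v \<bullet> (dg_mat pt *v v)) / lapse X t x" for v
    unfolding second_ff_eq scaleR_matrix_vector_assoc[symmetric] by simp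
  have e1: "al t x * expansion pt * (v \<bullet> (g_mat pt *v v)) \<le> v \<bullet> (dg_mat pt *v v)" for v
    using e(1)[of v] N_pos unfolding H h g_mat_eq by (simp only: divide_le_cancel) simp
  have e2: "0 \<le> al t x * expansion pt * (v \<bullet> (g_mat pt *v v))" for v
    using e(2)[of v] N_pos unfolding H g_mat_eq by (simp only: divide_le_0_iff) simp
  show "0 \<le> expansion pt"
    by (rule expansion_nonneg[OF pt_patch g_mat_pos]) (assumption, rule order_trans[OF e2 e1])
  show "al t x * expansion pt * (v \<bullet> (g_mat pt *v v)) \<le> v \<bullet> (dg_mat pt *v v)" by (rule e1)
qed

end

end

lemma nondecreasing_derivative_nonneg:
  fixes f :: "real \<Rightarrow> real"
  assumes "0 < e" "{t..<t + e} \<subseteq> S" and mono: "\<And>s. t \<le> s \<Longrightarrow> s < t + e \<Longrightarrow> f t \<le> f s"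
    and f: "(f has_real_derivative d) (at t within S)"
  shows "0 \<le> d"
proof -
  have "(f has_real_derivative d) (at t within {t..<t + e})" by (rule DERIV_subset[OF f assms(2)])
  then have "((\<lambda>s. (f s - f t) / (s - t)) \<longlongrightarrow> d) (at t within {t..<t + e})"
    by (simp add: has_field_derivative_iff)
  moreover have "eventually (\<lambda>s. 0 \<le> (f s - f t) / (s - t)) (at t within {t..<t + e})"
    unfolding eventually_at_filter by (rule always_eventually) (auto intro!: divide_nonneg_nonneg mono)
  moreover have "at t within {t..<t + e} \<noteq> bot" by (rule at_right_half_open[OF assms(1) order_refl])
  ultimately show ?thesis by (rule tendsto_lowerbound)
qed

theorem theorem1p1:
  fixes X :: "'m::{t2_space, second_countable_topology} spacetime"
    and k \<alpha> :: "real \<Rightarrow> 'm \<Rightarrow> real"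
    and I' :: "real set" and U :: "'m set"
  assumes "almost_globally_hyperbolic X"
    and "perfect_fluid_electric X k I' U"
    and "expanding X \<alpha> I' U"
    and diff: "\<And>t x. t \<in> I' \<Longrightarrow> x \<in> U \<Longrightarrow>
          (\<lambda>s. k s x) differentiable (at t within time_interval X) \<and>
          (\<lambda>s. \<alpha> s x) differentiable (at t within time_interval X)"
    and prime: "\<And>t x c. t \<in> I' \<Longrightarrow> x \<in> U \<Longrightarrow> c \<in> st_atlas X \<Longrightarrow> x \<in> chart_dom c \<Longrightarrow>
          D_T X k t x = H_deriv X c k t x * mean_curv X c t x \<and>
          D_T X \<alpha> t x = H_deriv X c \<alpha> t x * mean_curv X c t x"
    and bounds: "\<And>t x c. t \<in> I' \<Longrightarrow> x \<in> U \<Longrightarrow> c \<in> st_atlas X \<Longrightarrow> x \<in> chart_dom c \<Longrightarrow>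
          parameter_bounds (k t x) (\<alpha> t x) (H_deriv X c k t x) (H_deriv X c \<alpha> t x)"
  shows "\<forall>c\<in>st_atlas X. \<forall>x\<in>U \<inter> chart_dom c.
           (\<forall>t1 t2. t1 \<le> t2 \<and> {t1..t2} \<subseteq> I' \<longrightarrow>
              pf_entropy X k \<alpha> c t1 x \<le> pf_entropy X k \<alpha> c t2 x) \<and>
           (\<forall>t\<in>I'. (\<lambda>s. pf_entropy X k \<alpha> c s x) differentiable (at t within time_interval X) \<longrightarrow>
              0 \<le> D_T X (pf_entropy X k \<alpha> c) t x)"
proof (intro ballI)
  fix c x assume c: "c \<in> st_atlas X" and x: "x \<in> U \<inter> chart_dom c"
  then have xU: "x \<in> U" and xc: "x \<in> chart_dom c" by auto
  obtain M0 P0 where fluid: "\<forall>t\<in>I'. \<forall>x\<in>U.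
        0 < lapse X t x \<and> k t x \<in> {0..4/3} \<and> P0 t x = (k t x - 1) * M0 t x \<and>
        (\<forall>c\<in>st_atlas X. x \<in> chart_dom c \<longrightarrow>
           stress X c t x $ None $ None / (lapse X t x)\<^sup>2 = M0 t x \<and>
           (\<forall>i. stress X c t x $ None $ Some i / lapse X t x = 0) \<and>
           (\<forall>i j. stress X c t x $ Some i $ Some j = P0 t x * slice_metric X c t x $ i $ j) \<and>
           (\<forall>i j l. weyl X c (t, chart_map c x) None (Some i) (Some j) (Some l) / lapse X t x = 0))"
    and region: "is_region X I' U"
    using assms(2) unfolding perfect_fluid_electric_def by blast
  interpret fluid_chart X I' U c M0 P0
    using assms(1) region c fluid by unfold_locales blast+
  let ?y = "chart_map c x"
  have al: "\<alpha> t x \<in> {0..1/3}" if "t \<in> I'" for t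
    using assms(3) that xU unfolding expanding_def by blast
  have k: "k t x \<in> {0..4/3}" "P0 t x = (k t x - 1) * M0 t x" if "t \<in> I'" for t
    using fluid that xU by blast+
  have M: "M_fun (s, ?y) = M0 s x" "P_fun (s, ?y) = P0 s x" for s
    by (simp_all add: M_fun_def P_fun_def chart_inv_map[OF xc])
  have mono: "pf_entropy X k \<alpha> c t1 x \<le> pf_entropy X k \<alpha> c t2 x" if t12: "t1 \<le> t2" "{t1..t2} \<subseteq> I'" for t1 t2
  proof -
    have I: "t \<in> I'" if "t \<in> {t1..t2}" for t using that t12 by blast
    have pf: "pf_entropy X k \<alpha> c t x = ((if M0 t x = 0 then 1
        else sqrt (elec_sq (t, ?y)) / sqrt (elec_sq (t, ?y) + fluid_quad (k t x) * (M0 t x)\<^sup>2 / 24))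
      + s_crit (k t x) (\<alpha> t x)) * sqrt_det X c t x" if "t \<in> {t1..t2}" for t
      unfolding pf_entropy_def weyl_entropy_def weyl_ratio_eq[OF I[OF that] xU xc k(2)[OF I[OF that]]]
      by (simp add: distrib_right)
    have "((if M0 t1 x = 0 then 1
        else sqrt (elec_sq (t1, ?y)) / sqrt (elec_sq (t1, ?y) + fluid_quad (k t1 x) * (M0 t1 x)\<^sup>2 / 24))
      + s_crit (k t1 x) (\<alpha> t1 x)) * sqrt_det X c t1 x \<le>
      ((if M0 t2 x = 0 then 1
        else sqrt (elec_sq (t2, ?y)) / sqrt (elec_sq (t2, ?y) + fluid_quad (k t2 x) * (M0 t2 x)\<^sup>2 / 24))
      + s_crit (k t2 x) (\<alpha> t2 x)) * sqrt_det X c t2 x"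
    proof (rule entropy_nondecreasing[where Y = "\<lambda>t. elec_sq (t, ?y)" and M = "\<lambda>t. M0 t x"
          and k = "\<lambda>t. k t x" and al = "\<lambda>t. \<alpha> t x" and w = "\<lambda>t. sqrt_det X c t x"
          and th = "\<lambda>t. expansion (t, ?y)" and Y' = "\<lambda>t. D None elec_sq (t, ?y)"
          and k' = "\<lambda>t. H_deriv X c k t x" and al' = "\<lambda>t. H_deriv X c \<alpha> t x"
          and S = "time_interval X"])
      show "{t1..t2} \<subseteq> time_interval X" using t12 openin_imp_subset[OF I'_open] by blast
      fix t assume "t \<in> {t1..t2}"
      then have t: "t \<in> I'" by (rule I)
      note pd = pt_patch[OF t xU xc]
      note pos = g_mat_pos[OF t xU xc]
      note ex = expanding_expansion[OF t xU xc assms(3)]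
      have MP: "M_fun (t, ?y) + P_fun (t, ?y) = k t x * M0 t x"
        unfolding M k(2)[OF t] by (simp add: algebra_simps)
      show "((\<lambda>t. elec_sq (t, ?y)) has_real_derivative D None elec_sq (t, ?y)) (at t within time_interval X)"
        by (rule has_time_derivative[OF smooth_elec_sq pd])
      show "((\<lambda>t. M0 t x) has_real_derivative - expansion (t, ?y) * (k t x * M0 t x)) (at t within time_interval X)"
        using has_time_derivative[OF smooth_M pd] unfolding D_time_M[OF pd] MP unfolding M .
      show "((\<lambda>t. k t x) has_real_derivative - H_deriv X c k t x * expansion (t, ?y)) (at t within time_interval X)"
        using diff[OF t xU] prime[OF t xU c xc] by (intro H_deriv_derivative[OF t xU xc]) auto
      show "((\<lambda>t. \<alpha> t x) has_real_derivative - H_deriv X c \<alpha> t x * expansion (t, ?y)) (at t within time_interval X)"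
        using diff[OF t xU] prime[OF t xU c xc] by (intro H_deriv_derivative[OF t xU xc]) auto
      show "((\<lambda>t. sqrt_det X c t x) has_real_derivative expansion (t, ?y) * sqrt_det X c t x) (at t within time_interval X)"
        by (rule sqrt_det_derivative[OF t xU xc])
      show "0 \<le> elec_sq (t, ?y) \<and> 0 \<le> expansion (t, ?y) \<and> 0 \<le> sqrt_det X c t x"
        using elec_sq_nonneg[OF pd pos] ex(1) slice_det_pos[OF t xU xc] by (simp add: sqrt_det_def)
      show "k t x \<in> {0..4/3} \<and> \<alpha> t x \<in> {0..1/3}" using k[OF t] al[OF t] by blast
      show "parameter_bounds (k t x) (\<alpha> t x) (H_deriv X c k t x) (H_deriv X c \<alpha> t x)"
        by (rule bounds[OF t xU c xc])
      show "- 2 * expansion (t, ?y) * ((2 - 3 * \<alpha> t x) * elec_sq (t, ?y))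
          - \<bar>k t x * M0 t x\<bar> * (sqrt (2 / 3) * (1 - 3 * \<alpha> t x) * expansion (t, ?y) * sqrt (elec_sq (t, ?y)))
          \<le> D None elec_sq (t, ?y)"
        using elec_sq_decay[OF pd pos ex(1) _ ex(2)] al[OF t] unfolding MP by simp
    qed (rule t12(1))
    then show ?thesis using pf[of t1] pf[of t2] t12(1) by simp
  qed
  show "(\<forall>t1 t2. t1 \<le> t2 \<and> {t1..t2} \<subseteq> I' \<longrightarrow> pf_entropy X k \<alpha> c t1 x \<le> pf_entropy X k \<alpha> c t2 x) \<and>
    (\<forall>t\<in>I'. (\<lambda>s. pf_entropy X k \<alpha> c s x) differentiable (at t within time_interval X) \<longrightarrow>
              0 \<le> D_T X (pf_entropy X k \<alpha> c) t x)"
  proof (intro conjI allI ballI impI)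
    fix t assume t: "t \<in> I'"
      and d: "(\<lambda>s. pf_entropy X k \<alpha> c s x) differentiable (at t within time_interval X)"
    \<comment> \<open>The derivative within the time interval is restricted to a right neighbourhood
      inside \<open>I'\<close>, where monotonicity makes all difference quotients
      non-negative.\<close>
    obtain e where e: "0 < e" "{t..<t + e} \<subseteq> I'" using time_interval_right_open[OF I'_open t] .
    have "0 \<le> vector_derivative (\<lambda>s. pf_entropy X k \<alpha> c s x) (at t within time_interval X)"
    proof (rule nondecreasing_derivative_nonneg[OF e(1)])
      show "{t..<t + e} \<subseteq> time_interval X" using e(2) openin_imp_subset[OF I'_open] by blast
      show "pf_entropy X k \<alpha> c t x \<le> pf_entropy X k \<alpha> c s x" if "t \<le> s" "s < t + e" for s
      proof (rule mono[OF that(1)])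
        show "{t..s} \<subseteq> I'" using that e(2) by (auto simp: subset_iff)
      qed
      show "((\<lambda>s. pf_entropy X k \<alpha> c s x) has_real_derivative
          vector_derivative (\<lambda>s. pf_entropy X k \<alpha> c s x) (at t within time_interval X)) (at t within time_interval X)"
        using d by (simp add: vector_derivative_works has_real_derivative_iff_has_vector_derivative)
    qed
    then show "0 \<le> D_T X (pf_entropy X k \<alpha> c) t x"
      using lapse_pos[OF t xU] by (simp add: D_T_def)
  qed (use mono in blast)
qed

end
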